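(* For every integer $k\geq 1$, if $n=28\cdot 2^{k-1}-9$, then $F_5(n)\geq \frac{3n-1}{28}$.
   Context: A finite set of points in the plane is in general position if no three of its points lie on a line. For a finite point set $S$ in the plane in general position, a $5$-hole (empty convex pentagon) of $S$ is a subset of $5$ points of $S$ which are the vertices of a convex pentagon whose interior contains no points of $S$. Two holes are disjoint if their convex hulls do not intersect. For a positive integer $n$, $F_5(n)$ denotes the minimum, over all sets $S$ of $n$ points in the plane in general position, of the maximum number of pairwise disjoint $5$-holes of $S$. *)

theory Defs
  imports "HOL-Analysis.Analysis"
begin

definition general_position :: "(real^2) set \<Rightarrow> bool" where
  "general_position S \<longleftrightarrow> (\<forall>T\<subseteq>S. card T = 3 \<longrightarrow> \<not> collinear T)"

(* The vertices of a convex polygon are the extreme points of its convex hull, so the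
   second conjunct says that the five points of H are in convex position. *)
definition five_hole :: "(real^2) set \<Rightarrow> (real^2) set \<Rightarrow> bool" where
  "five_hole S H \<longleftrightarrow>
     H \<subseteq> S \<and> card H = 5 \<and>
     {x. x extreme_point_of (convex hull H)} = H \<and>
     interior (convex hull H) \<inter> S = {}"

definition disjoint_five_holes :: "(real^2) set \<Rightarrow> (real^2) set set \<Rightarrow> bool" where
  "disjoint_five_holes S \<H> \<longleftrightarrow>
     (\<forall>H\<in>\<H>. five_hole S H) \<and>
     pairwise (\<lambda>A B. disjnt (convex hull A) (convex hull B)) \<H>"

(* For finite S the set below is finite, and it contains 0 (the empty family). *)
definition max_disjoint_five_holes :: "(real^2) set \<Rightarrow> nat" where
  "max_disjoint_five_holes S = Max {card \<H> |\<H>. disjoint_five_holes S \<H>}"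

(* On nat, the infimum of a nonempty set is its minimum; nonemptiness is
   ex_general_position below. *)
definition F5 :: "nat \<Rightarrow> nat" where
  "F5 n = Inf {max_disjoint_five_holes S |S. finite S \<and> card S = n \<and> general_position S}"

lemma finite_card_disjoint_five_holes:
  assumes "finite S"
  shows "finite {card \<H> |\<H>. disjoint_five_holes S \<H>}"
proof -
  have "\<H> \<in> Pow (Pow S)" if "disjoint_five_holes S \<H>" for \<H>
    using that by (auto simp: disjoint_five_holes_def five_hole_def)
  then have "{card \<H> |\<H>. disjoint_five_holes S \<H>} \<subseteq> card ` Pow (Pow S)"
    by blast
  then show ?thesis
    by (rule finite_subset) (simp add: assms)
qed

lemma ex_general_position:
  "\<exists>S. finite S \<and> card S = n \<and> general_position S"
proof -
  define f :: "nat \<Rightarrow> real^2" where "f i = vector [real i, (real i)\<^sup>2]" for i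
  have f1: "f i $ 1 = real i" and f2: "f i $ 2 = (real i)\<^sup>2" for i
    by (simp_all add: f_def)
  have inj: "inj f"
    by (metis f1 injI of_nat_eq_iff)
  have nc: "\<not> collinear {f a, f b, f c}" if "a \<noteq> b" "a \<noteq> c" "b \<noteq> c" for a b c
  proof
    assume "collinear {f a, f b, f c}"
    then obtain u where u: "\<And>x y. x \<in> {f a, f b, f c} \<Longrightarrow> y \<in> {f a, f b, f c} \<Longrightarrow> \<exists>t. x - y = t *\<^sub>R u"
      unfolding collinear_def by blast
    obtain s where s: "f b - f a = s *\<^sub>R u" using u[of "f b" "f a"] by auto
    obtain t where t: "f c - f a = t *\<^sub>R u" using u[of "f c" "f a"] by auto
    have "real b - real a = s * u$1" "(real b)\<^sup>2 - (real a)\<^sup>2 = s * u$2"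
      using arg_cong[OF s, of "\<lambda>v. v$1"] arg_cong[OF s, of "\<lambda>v. v$2"] by (simp_all add: f1 f2)
    moreover have "real c - real a = t * u$1" "(real c)\<^sup>2 - (real a)\<^sup>2 = t * u$2"
      using arg_cong[OF t, of "\<lambda>v. v$1"] arg_cong[OF t, of "\<lambda>v. v$2"] by (simp_all add: f1 f2)
    ultimately have "(real b - real a) * ((real c)\<^sup>2 - (real a)\<^sup>2) = (real c - real a) * ((real b)\<^sup>2 - (real a)\<^sup>2)"
      by simp
    then have "(real b - real a) * (real c - real a) * (real c - real b) = 0"
      by (simp add: power2_eq_square algebra_simps)
    then show False using that by simp
  qed
  have "general_position (f ` {..<n})"
    unfolding general_position_def
  proof (intro allI impI)
    fix T assume T: "T \<subseteq> f ` {..<n}" "card T = 3"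
    then obtain x y z where xyz: "T = {x, y, z}" "x \<noteq> y" "x \<noteq> z" "y \<noteq> z"
      by (auto simp: card_3_iff)
    with T obtain a b c where "x = f a" "y = f b" "z = f c" by auto
    moreover have "a \<noteq> b" "a \<noteq> c" "b \<noteq> c" using xyz calculation by auto
    ultimately show "\<not> collinear T" using nc xyz(1) by simp
  qed
  moreover have "card (f ` {..<n}) = n"
    using inj by (simp add: card_image inj_on_subset)
  ultimately show ?thesis by blast
qed

end

theory Submission
  imports Defs "HOL-Library.Sublist"
begin

text \<open>The bound comes from a statement about single holes: every set of at least ten points in general
position has a subset of exactly nine points that can be cut off by a line and contains a 5-hole
(\<open>exists_cut_with_five_hole\<close>). Cutting off such a subset costs nine points and yields one hole whose
convex hull misses the hull of the remaining points. Hence \<open>F5 n \<ge> (n - 1) div 9\<close>, and for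
\<open>n = 28 * m - 9\<close> with \<open>m \<ge> 1\<close> the right-hand side is at least \<open>3 * m - 1 = (3 * n - 1) / 28\<close>.

For the statement about single holes, suppose that no nine-point cut of \<open>T\<close> contains a 5-hole, and fix
an edge \<open>w r\<close> of the convex hull of \<open>T\<close>. Every other point gets two coordinates \<open>X\<close> and \<open>Y\<close> that
are, up to sign, the cotangents of its angles at \<open>r\<close> and at \<open>w\<close>; this is the projective map that sends the edge to infinity, so
that the cuts containing \<open>w\<close> and \<open>r\<close> become the sets of points that are lowest for a functional
\<open>(1 - t) * Y + t * X\<close> with \<open>0 < t < 1\<close>. Nine points without a 5-hole have a triangular convex hull.
For a nine-point cut containing \<open>w\<close> and \<open>r\<close> this means that among its other seven points one is largest
in both coordinates (\<open>dominated_cut\<close>). Now let \<open>t\<close> run from 0 to 1. Only the largest of the seven points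
can ever be exchanged, so the other six remain: the six points that are lowest in \<open>Y\<close> are also the six
lowest in \<open>X\<close> (\<open>X_less_if_lowest_six\<close>).

Call these six points \<open>L\<close>, and take the next two points in the \<open>Y\<close> order and the next two in the \<open>X\<close>
order. They give four nine-point cuts inside a set of at most twelve points. These four cuts cannot
all be free of 5-holes, whatever the positions of the four extra points, and this contradiction
finishes the proof (\<open>card_Q_less\<close>).

The triangular hull and the final contradiction are finite statements about the orientations of the
triples of at most twelve points. For points that are sorted by angle around a vertex of their hull,
the orientations of the four triples of any four points change sign at most once when the triples are
listed lexicographically; such sign patterns are known as signotopes. Each finite statement is proved from this condition alone, by a tree of case distinctions on orientations whose leaves
name four points that break the sign condition, an empty convex pentagon, or a violated hypothesis. A checker that is proved
sound (\<open>refutes_sound\<close>) accepts these trees by rewriting.\<close>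

section \<open>Holes as patterns of orientations\<close>

text \<open>The sequence of four signs changes at most once: it is enough to forbid that two equal signs enclose
the opposite one.\<close>
definition one_change :: "bool \<Rightarrow> bool \<Rightarrow> bool \<Rightarrow> bool \<Rightarrow> bool" where
  "one_change p q r s \<longleftrightarrow>
     (p = r \<longrightarrow> q = p) \<and> (p = s \<longrightarrow> q = p) \<and> (p = s \<longrightarrow> r = p) \<and> (q = s \<longrightarrow> r = q)"

definition signotope :: "('a \<Rightarrow> 'a \<Rightarrow> 'a \<Rightarrow> bool) \<Rightarrow> 'a list \<Rightarrow> bool" where
  "signotope s xs \<longleftrightarrow> (\<forall>a b c d. subseq [a, b, c, d] xs \<longrightarrow>
     one_change (s a b c) (s a b d) (s a c d) (s b c d))"

definition in_between :: "'a \<Rightarrow> 'a \<Rightarrow> 'a list \<Rightarrow> 'a list" where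
  "in_between a b xs = takeWhile (\<lambda>x. x \<noteq> b) (tl (dropWhile (\<lambda>x. x \<noteq> a) xs))"

text \<open>For \<open>a\<close>, \<open>b\<close>, \<open>c\<close> in the order of \<open>xs\<close>, only points between \<open>a\<close> and \<open>c\<close> can lie in the triangle
\<open>a b c\<close>. Such a point lies in it iff it is on the side of \<open>a c\<close> where \<open>b\<close> is, but not beyond \<open>a b\<close> or
\<open>b c\<close>. Each disjunction negates the two signs that decide this.\<close>
definition empty_triangle :: "('a \<Rightarrow> 'a \<Rightarrow> 'a \<Rightarrow> bool) \<Rightarrow> 'a list \<Rightarrow> 'a \<times> 'a \<times> 'a \<Rightarrow> bool" where
  "empty_triangle s xs = (\<lambda>(a, b, c).
     (\<forall>i\<in>set (in_between a b xs). s a i b = s a b c \<or> s a i c \<noteq> s a b c) \<and>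
     (\<forall>i\<in>set (in_between b c xs). s b i c = s a b c \<or> s a i c \<noteq> s a b c))"

text \<open>A convex pentagon \<open>a b c d e\<close>, listed in the order of \<open>xs\<close>, consists of an upper and a lower chain from
\<open>a\<close> to \<open>e\<close>. The shape tells which of \<open>b\<close>, \<open>c\<close>, \<open>d\<close> lie on which chain: all on the lower one (\<open>Cup\<close>), all
on the upper one (\<open>Cap\<close>), one on the upper chain (\<open>UpB\<close>, \<open>UpC\<close>, \<open>UpD\<close>) or one on the lower chain.\<close>
datatype shape = Cup | Cap | UpB | UpC | UpD | LowB | LowC | LowD

fun left_turns :: "shape \<Rightarrow> 'a \<Rightarrow> 'a \<Rightarrow> 'a \<Rightarrow> 'a \<Rightarrow> 'a \<Rightarrow> ('a \<times> 'a \<times> 'a) list" where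
  "left_turns Cup a b c d e = [(a, b, c), (b, c, d), (c, d, e)]"
| "left_turns Cap a b c d e = []"
| "left_turns UpB a b c d e = [(a, c, d), (c, d, e)]"
| "left_turns UpC a b c d e = [(a, b, d), (b, d, e)]"
| "left_turns UpD a b c d e = [(a, b, c), (b, c, e)]"
| "left_turns LowB a b c d e = [(a, b, e)]"
| "left_turns LowC a b c d e = [(a, c, e)]"
| "left_turns LowD a b c d e = [(a, d, e)]"

fun mirror :: "shape \<Rightarrow> shape" where
  "mirror Cup = Cap" | "mirror Cap = Cup"
| "mirror UpB = LowB" | "mirror UpC = LowC" | "mirror UpD = LowD"
| "mirror LowB = UpB" | "mirror LowC = UpC" | "mirror LowD = UpD"

definition right_turns where "right_turns sh = left_turns (mirror sh)"

text \<open>The triangulation of the pentagon by the two diagonals from \<open>a\<close>.\<close>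
fun fan :: "shape \<Rightarrow> 'a \<Rightarrow> 'a \<Rightarrow> 'a \<Rightarrow> 'a \<Rightarrow> 'a \<Rightarrow> ('a \<times> 'a \<times> 'a) list" where
  "fan Cup a b c d e = [(a, b, c), (a, c, d), (a, d, e)]"
| "fan Cap a b c d e = [(a, b, c), (a, c, d), (a, d, e)]"
| "fan UpB a b c d e = [(a, b, e), (a, c, d), (a, d, e)]"
| "fan LowB a b c d e = [(a, b, e), (a, c, d), (a, d, e)]"
| "fan UpC a b c d e = [(a, c, e), (a, b, d), (a, d, e)]"
| "fan LowC a b c d e = [(a, c, e), (a, b, d), (a, d, e)]"
| "fan UpD a b c d e = [(a, d, e), (a, b, c), (a, c, e)]"
| "fan LowD a b c d e = [(a, d, e), (a, b, c), (a, c, e)]"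

text \<open>The turns along the two chains; the remaining orientations of the five points follow from these by
\<open>one_change\<close>.\<close>
definition hole :: "('a \<Rightarrow> 'a \<Rightarrow> 'a \<Rightarrow> bool) \<Rightarrow> 'a list \<Rightarrow> shape \<Rightarrow> 'a \<Rightarrow> 'a \<Rightarrow> 'a \<Rightarrow> 'a \<Rightarrow> 'a \<Rightarrow> bool" where
  "hole s xs sh a b c d e \<longleftrightarrow> subseq [a, b, c, d, e] xs \<and>
     (\<forall>(x, y, z)\<in>set (left_turns sh a b c d e). s x y z) \<and>
     (\<forall>(x, y, z)\<in>set (right_turns sh a b c d e). \<not> s x y z) \<and>
     (\<forall>t\<in>set (fan sh a b c d e). empty_triangle s xs t)"

definition hole_free :: "('a \<Rightarrow> 'a \<Rightarrow> 'a \<Rightarrow> bool) \<Rightarrow> 'a list \<Rightarrow> bool" where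
  "hole_free s xs \<longleftrightarrow> (\<forall>sh a b c d e. \<not> hole s xs sh a b c d e)"

lemma subseq_subset: "subseq xs ys \<Longrightarrow> set xs \<subseteq> set ys"
  by (auto dest: list_emb_set)

text \<open>The trees below speak of labels instead of points. The lemmas \<open>signotope_map\<close> and \<open>hole_free_map\<close> carry
the hypotheses from points to labels.\<close>
lemma in_between_map:
  assumes "inj_on g (set xs)" "a \<in> set xs" "b \<in> set xs"
  shows "in_between (g a) (g b) (map g xs) = map g (in_between a b xs)"
proof -
  have "dropWhile (\<lambda>x. x \<noteq> g a) (map g xs) = map g (dropWhile (\<lambda>x. x \<noteq> a) xs)"
    unfolding dropWhile_map using assms
    by (intro arg_cong[where f = "map g"] dropWhile_cong) (auto simp: inj_on_eq_iff)
  moreover have "takeWhile (\<lambda>x. x \<noteq> g b) (map g ys) = map g (takeWhile (\<lambda>x. x \<noteq> b) ys)"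
    if "set ys \<subseteq> set xs" for ys
    unfolding takeWhile_map using assms that
    by (intro arg_cong[where f = "map g"] takeWhile_cong) (auto simp: inj_on_eq_iff subset_iff)
  moreover have "set (tl (dropWhile (\<lambda>x. x \<noteq> a) xs)) \<subseteq> set xs"
    by (metis list.sel(2) list.set_sel(2) set_dropWhileD subsetI)
  ultimately show ?thesis
    by (simp add: in_between_def map_tl[symmetric])
qed

lemma signotope_map:
  assumes "signotope s (map g xs)"
  shows "signotope (\<lambda>a b c. s (g a) (g b) (g c)) xs"
  unfolding signotope_def
proof (intro allI impI)
  fix a b c d assume "subseq [a, b, c, d] xs"
  then have "subseq [g a, g b, g c, g d] (map g xs)"
    using subseq_map[of "[a, b, c, d]" xs g] by simp
  then show "one_change (s (g a) (g b) (g c)) (s (g a) (g b) (g d)) (s (g a) (g c) (g d)) (s (g b) (g c) (g d))"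
    using assms unfolding signotope_def by blast
qed

lemma signotope_subseq: "signotope s xs \<Longrightarrow> subseq ys xs \<Longrightarrow> signotope s ys"
  unfolding signotope_def using subseq_order.trans by blast

lemma left_turns_map:
  "left_turns sh (g a) (g b) (g c) (g d) (g e) = map (\<lambda>(x, y, z). (g x, g y, g z)) (left_turns sh a b c d e)"
  by (cases sh) simp_all

lemma right_turns_map:
  "right_turns sh (g a) (g b) (g c) (g d) (g e) = map (\<lambda>(x, y, z). (g x, g y, g z)) (right_turns sh a b c d e)"
  by (simp add: right_turns_def left_turns_map)

lemma fan_map:
  "fan sh (g a) (g b) (g c) (g d) (g e) = map (\<lambda>(x, y, z). (g x, g y, g z)) (fan sh a b c d e)"
  by (cases sh) simp_all

lemma fan_vertices: "(x, y, z) \<in> set (fan sh a b c d e) \<Longrightarrow> {x, y, z} \<subseteq> {a, b, c, d, e}"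
  by (cases sh; simp only: fan.simps list.set insert_iff empty_iff prod.inject; elim disjE conjE FalseE; simp)

lemma hole_free_map:
  assumes "hole_free s (map g xs)" "inj_on g (set xs)"
  shows "hole_free (\<lambda>a b c. s (g a) (g b) (g c)) xs"
  unfolding hole_free_def
proof (intro allI notI)
  fix sh a b c d e
  let ?s = "\<lambda>a b c. s (g a) (g b) (g c)"
  assume h: "hole ?s xs sh a b c d e"
  then have sub: "subseq [a, b, c, d, e] xs"
    by (simp add: hole_def)
  have V: "{a, b, c, d, e} \<subseteq> set xs"
    using subseq_subset[OF sub] by simp
  have "empty_triangle s (map g xs) (g x, g y, g z)"
    if "(x, y, z) \<in> set (fan sh a b c d e)" for x y z
  proof -
    have "empty_triangle ?s xs (x, y, z)"
      using h that unfolding hole_def by blast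
    moreover have "x \<in> set xs" "y \<in> set xs" "z \<in> set xs"
      using subset_trans[OF fan_vertices[OF that] V] by simp_all
    ultimately show ?thesis
      by (simp add: empty_triangle_def in_between_map[OF assms(2)])
  qed
  moreover have "subseq [g a, g b, g c, g d, g e] (map g xs)"
    using subseq_map[OF sub, of g] by simp
  ultimately have "hole s (map g xs) sh (g a) (g b) (g c) (g d) (g e)"
    using h unfolding hole_def left_turns_map right_turns_map fan_map set_map ball_simps
    by (simp add: split_beta)
  then show False
    using assms(1) unfolding hole_free_def by blast
qed

section \<open>Orientations of points in the plane\<close>

definition orient :: "real^2 \<Rightarrow> real^2 \<Rightarrow> real^2 \<Rightarrow> real" where
  "orient a b c = (b $ 1 - a $ 1) * (c $ 2 - a $ 2) - (b $ 2 - a $ 2) * (c $ 1 - a $ 1)"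

abbreviation ccw :: "real^2 \<Rightarrow> real^2 \<Rightarrow> real^2 \<Rightarrow> bool" where
  "ccw a b c \<equiv> 0 < orient a b c"

lemma orient_rotate: "orient b c a = orient a b c"
  and orient_swap: "orient b a c = - orient a b c"
  and orient_swap': "orient a c b = - orient a b c"
  and orient_same [simp]: "orient a a c = 0" "orient a c a = 0" "orient c a a = 0"
  by (simp_all add: orient_def algebra_simps)

lemma orient_convex_comb:
  assumes "u + v = 1"
  shows "orient a b (u *\<^sub>R x + v *\<^sub>R y) = u * orient a b x + v * orient a b y"
proof -
  have v: "v = 1 - u" using assms by simp
  show ?thesis unfolding v orient_def by (simp add: algebra_simps)
qed

lemma orient_ge0_convex_hull:
  assumes "\<And>x. x \<in> A \<Longrightarrow> 0 \<le> orient a b x" "p \<in> convex hull A"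
  shows "0 \<le> orient a b p"
proof -
  have "convex {p. 0 \<le> orient a b p}"
    by (auto intro!: convexI simp: orient_convex_comb)
  then have "convex hull A \<subseteq> {p. 0 \<le> orient a b p}"
    using assms(1) by (intro hull_minimal) auto
  then show ?thesis using assms(2) by auto
qed

lemma orient_nonzero:
  assumes "general_position S" "a \<in> S" "b \<in> S" "c \<in> S" "a \<noteq> b" "a \<noteq> c" "b \<noteq> c"
  shows "orient a b c \<noteq> 0"
proof
  assume 0: "orient a b c = 0"
  have "\<exists>u. b = u *\<^sub>R a + (1 - u) *\<^sub>R c"
  proof (cases "a $ 1 = c $ 1")
    case True
    with \<open>a \<noteq> c\<close> have n: "a $ 2 - c $ 2 \<noteq> 0" by (auto simp: vec_eq_iff forall_2)
    have "b $ 1 = a $ 1" using 0 n True by (simp add: orient_def)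
    define u where "u = (b $ 2 - c $ 2) / (a $ 2 - c $ 2)"
    have "u * (a $ 2 - c $ 2) = b $ 2 - c $ 2" using n by (simp add: u_def)
    then show ?thesis
      using True \<open>b $ 1 = a $ 1\<close> by (intro exI[of _ u]) (simp add: vec_eq_iff forall_2 algebra_simps)
  next
    case False
    then have n: "a $ 1 - c $ 1 \<noteq> 0" by simp
    define u where "u = (b $ 1 - c $ 1) / (a $ 1 - c $ 1)"
    have u: "u * (a $ 1 - c $ 1) = b $ 1 - c $ 1" using n by (simp add: u_def)
    have "(a $ 1 - c $ 1) * (b $ 2 - c $ 2) = (a $ 2 - c $ 2) * (b $ 1 - c $ 1)"
      using 0 by (simp add: orient_def algebra_simps)
    also have "\<dots> = (a $ 1 - c $ 1) * (u * (a $ 2 - c $ 2))" by (simp add: u[symmetric])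
    finally have "b $ 2 - c $ 2 = u * (a $ 2 - c $ 2)" using n by simp
    then show ?thesis
      using u by (intro exI[of _ u]) (simp add: vec_eq_iff forall_2 algebra_simps)
  qed
  then have "collinear {a, b, c}"
    unfolding collinear_3_expand by blast
  moreover have "card {a, b, c} = 3" using assms by simp
  ultimately show False
    using assms(1)[unfolded general_position_def, rule_format, of "{a, b, c}"] assms(2-4) by simp
qed

lemma general_position_subset: "general_position S \<Longrightarrow> T \<subseteq> S \<Longrightarrow> general_position T"
  unfolding general_position_def using order_trans by metis

lemma not_ccw:
  assumes "general_position S" "a \<in> S" "b \<in> S" "c \<in> S" "a \<noteq> b" "a \<noteq> c" "b \<noteq> c"
  shows "\<not> ccw a b c \<longleftrightarrow> ccw a c b"
  using orient_nonzero[OF assms] orient_swap'[of a c b] by linarith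

text \<open>Emptiness need only be checked for the triangles of the fan from \<open>x0\<close>: in general position a point of
\<open>S\<close> in the interior of the pentagon is on no diagonal, so it lies inside one of these triangles.\<close>
lemma five_hole_if_ccw:
  assumes gp: "general_position S" and sub: "{x0, x1, x2, x3, x4} \<subseteq> S"
    and c: "ccw x0 x1 x2" "ccw x0 x1 x3" "ccw x0 x1 x4" "ccw x0 x2 x3" "ccw x0 x2 x4"
      "ccw x0 x3 x4" "ccw x1 x2 x3" "ccw x1 x2 x4" "ccw x1 x3 x4" "ccw x2 x3 x4"
    and e: "\<And>p. p \<in> S \<Longrightarrow> \<not> (ccw x0 x1 p \<and> ccw x1 x2 p \<and> ccw x2 x0 p)"
      "\<And>p. p \<in> S \<Longrightarrow> \<not> (ccw x0 x2 p \<and> ccw x2 x3 p \<and> ccw x3 x0 p)"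
      "\<And>p. p \<in> S \<Longrightarrow> \<not> (ccw x0 x3 p \<and> ccw x3 x4 p \<and> ccw x4 x0 p)"
  shows "five_hole S {x0, x1, x2, x3, x4}"
proof -
  let ?H = "{x0, x1, x2, x3, x4}"
  have d: "distinct [x0, x1, x2, x3, x4]"
    using c by auto
  then have card: "card ?H = 5" by simp
  have c': "ccw y z x" "ccw z x y" if "ccw x y z" for x y z
    using that orient_rotate[of x y z] orient_rotate[of y z x] by simp_all
  note c1 = c c[THEN c'(1)] c[THEN c'(2)]
  have c2: "orient x z y < 0" if "ccw x y z" for x y z
    using that by (simp add: orient_swap'[of x z y])
  have out: "x \<notin> convex hull A" if "\<And>y. y \<in> A \<Longrightarrow> 0 \<le> orient a b y" "orient a b x < 0" for x A a b
    using orient_ge0_convex_hull[OF that(1), where p = x] that(2) by force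
  have "x \<notin> convex hull (?H - {x})" if "x \<in> ?H" for x
  proof -
    have "x0 \<notin> convex hull {x1, x2, x3, x4}"
      by (rule out[of _ x4 x1]) (use c1 in \<open>auto simp: less_imp_le c2\<close>)
    moreover have "x1 \<notin> convex hull {x0, x2, x3, x4}"
      by (rule out[of _ x0 x2]) (use c1 in \<open>auto simp: less_imp_le c2\<close>)
    moreover have "x2 \<notin> convex hull {x0, x1, x3, x4}"
      by (rule out[of _ x1 x3]) (use c1 in \<open>auto simp: less_imp_le c2\<close>)
    moreover have "x3 \<notin> convex hull {x0, x1, x2, x4}"
      by (rule out[of _ x2 x4]) (use c1 in \<open>auto simp: less_imp_le c2\<close>)
    moreover have "x4 \<notin> convex hull {x0, x1, x2, x3}"
      by (rule out[of _ x3 x0]) (use c1 in \<open>auto simp: less_imp_le c2\<close>)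
    moreover have "?H - {x0} = {x1, x2, x3, x4}" "?H - {x1} = {x0, x2, x3, x4}"
      "?H - {x2} = {x0, x1, x3, x4}" "?H - {x3} = {x0, x1, x2, x4}" "?H - {x4} = {x0, x1, x2, x3}"
      using d by auto
    ultimately show ?thesis
      using that by (elim insertE emptyE) simp_all
  qed
  then have ext: "x extreme_point_of (convex hull ?H) \<longleftrightarrow> x \<in> ?H" for x
    by (intro extreme_point_of_convex_hull_convex_independent) (auto intro: finite_imp_compact)
  have "interior (convex hull ?H) \<inter> S = {}"
  proof (rule ccontr)
    assume "interior (convex hull ?H) \<inter> S \<noteq> {}"
    then obtain p where p: "p \<in> interior (convex hull ?H)" "p \<in> S" by auto
    then have "p \<notin> ?H"
      using ext extreme_point_not_in_interior by blast
    with sub p(2) have mem: "x0 \<in> S" "x2 \<in> S" "x3 \<in> S" "p \<in> S" "x0 \<noteq> p" "x2 \<noteq> p" "x3 \<noteq> p"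
      by auto
    have ne: "x0 \<noteq> x1" "x1 \<noteq> x2" "x2 \<noteq> x3" "x3 \<noteq> x4" "x4 \<noteq> x0"
      using d by auto
    have hull: "p \<in> convex hull ?H"
      using p interior_subset by blast
    have edge: "ccw a b p" if "a \<in> ?H" "b \<in> ?H" "a \<noteq> b" "\<forall>y\<in>?H. 0 \<le> orient a b y" for a b
    proof -
      have "orient a b p \<noteq> 0"
      proof (rule orient_nonzero[OF gp])
        show "a \<in> S" "b \<in> S" "p \<in> S" "a \<noteq> b"
          using that(1-3) sub p(2) by (auto simp only: subset_iff)
        show "a \<noteq> p" "b \<noteq> p"
          using that(1,2) \<open>p \<notin> ?H\<close> by metis+
      qed
      then show ?thesis
        using orient_ge0_convex_hull[OF _ hull, of a b] that(4) by force
    qed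
    have "\<forall>y\<in>?H. 0 \<le> orient x0 x1 y"
      unfolding ball_simps using c1 by (simp add: less_imp_le)
    then have 1: "ccw x0 x1 p"
      using ne by (intro edge) simp_all
    have "\<forall>y\<in>?H. 0 \<le> orient x1 x2 y"
      unfolding ball_simps using c1 by (simp add: less_imp_le)
    then have 2: "ccw x1 x2 p"
      using ne by (intro edge) simp_all
    have "\<forall>y\<in>?H. 0 \<le> orient x2 x3 y"
      unfolding ball_simps using c1 by (simp add: less_imp_le)
    then have 3: "ccw x2 x3 p"
      using ne by (intro edge) simp_all
    have "\<forall>y\<in>?H. 0 \<le> orient x3 x4 y"
      unfolding ball_simps using c1 by (simp add: less_imp_le)
    then have 4: "ccw x3 x4 p"
      using ne by (intro edge) simp_all
    have "\<forall>y\<in>?H. 0 \<le> orient x4 x0 y"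
      unfolding ball_simps using c1 by (simp add: less_imp_le)
    then have 5: "ccw x4 x0 p"
      using ne by (intro edge) simp_all
    have "orient x0 x2 p \<noteq> 0"
      using mem d by (intro orient_nonzero[OF gp]) simp_all
    then have 6: "ccw x0 x2 p \<or> ccw x2 x0 p"
      using orient_swap[of x0 x2 p] by linarith
    have "orient x0 x3 p \<noteq> 0"
      using mem d by (intro orient_nonzero[OF gp]) simp_all
    then have 7: "ccw x0 x3 p \<or> ccw x3 x0 p"
      using orient_swap[of x0 x3 p] by linarith
    show False
      using 1 2 3 4 5 6 7 e[OF p(2)] by blast
  qed
  moreover have "{x. x extreme_point_of (convex hull ?H)} = ?H"
    using ext by blast
  ultimately show ?thesis
    using sub card unfolding five_hole_def by blast
qed

lemma sorted_wrt_subseq: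
  assumes "subseq xs ys" "sorted_wrt R ys"
  shows "sorted_wrt R xs"
  using assms by (induction rule: list_emb.induct) (auto dest: list_emb_set)

lemma distinct_subseq:
  assumes "subseq xs ys" "distinct ys"
  shows "distinct xs"
  using assms by (induction rule: list_emb.induct) (auto dest: list_emb_set)

text \<open>The three-term Grassmann-Pluecker relation. With \<open>w\<close> a point around which the others are sorted, it
expresses a positive multiple of one orientation as a positive combination of two others, which is
where the sign condition \<open>one_change\<close> comes from.\<close>
lemma pluecker:
  "orient a b c * orient w a d - orient a b d * orient w a c + orient a c d * orient w a b = 0"
  by (simp add: orient_def algebra_simps)

lemma sum_sign:
  fixes x y z \<alpha> \<beta> \<gamma> :: real
  assumes "x * \<alpha> - y * \<beta> + z * \<gamma> = 0" "0 < \<alpha>" "0 < \<beta>" "0 < \<gamma>" "x \<noteq> 0" "z \<noteq> 0"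
    and "0 < x \<longleftrightarrow> 0 < z"
  shows "0 < y \<longleftrightarrow> 0 < x"
proof (cases "0 < x")
  case True
  then have "0 < x * \<alpha>" "0 < z * \<gamma>" using assms by simp_all
  then have "0 < y * \<beta>" using assms(1) by linarith
  then show ?thesis using True assms(3) by (simp add: zero_less_mult_iff)
next
  case False
  then have "x < 0" "z < 0" using assms by linarith+
  then have "x * \<alpha> < 0" "z * \<gamma> < 0" using assms by (simp_all add: mult_less_0_iff)
  then have "y * \<beta> < 0" using assms(1) by linarith
  then show ?thesis using False assms(3) by (simp add: mult_less_0_iff)
qed

lemma one_change_radial:
  assumes "ccw w a b" "ccw w a c" "ccw w a d" "ccw w b c" "ccw w b d" "ccw w c d"
    and "orient a b c \<noteq> 0" "orient a b d \<noteq> 0" "orient a c d \<noteq> 0" "orient b c d \<noteq> 0"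
  shows "one_change (ccw a b c) (ccw a b d) (ccw a c d) (ccw b c d)"
proof -
  have "ccw a b d \<longleftrightarrow> ccw a b c" if "ccw a b c \<longleftrightarrow> ccw a c d"
    by (rule sum_sign[of _ "orient w a d" _ "orient w a c" "orient a c d" "orient w a b"])
      (use assms that pluecker[of a b c w d] in auto)
  moreover have "ccw a b d \<longleftrightarrow> ccw a b c" if "ccw a b c \<longleftrightarrow> ccw b c d"
    by (rule sum_sign[of _ "orient w b d" _ "orient w b c" "orient b c d" "orient w a b"])
      (use assms that in \<open>auto simp: orient_def algebra_simps\<close>)
  moreover have "ccw a c d \<longleftrightarrow> ccw a b c" if "ccw a b c \<longleftrightarrow> ccw b c d"
    by (rule sum_sign[of _ "orient w c d" _ "orient w b c" "orient b c d" "orient w a c"])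
      (use assms that in \<open>auto simp: orient_def algebra_simps\<close>)
  moreover have "ccw a c d \<longleftrightarrow> ccw a b d" if "ccw a b d \<longleftrightarrow> ccw b c d"
    by (rule sum_sign[of _ "orient w c d" _ "orient w b d" "orient b c d" "orient w a d"])
      (use assms that in \<open>auto simp: orient_def algebra_simps\<close>)
  ultimately show ?thesis
    unfolding one_change_def by blast
qed

lemma signotope_radial:
  assumes gp: "general_position (set xs)" and d: "distinct xs" and r: "sorted_wrt (ccw w) xs"
  shows "signotope ccw xs"
  unfolding signotope_def
proof (intro allI impI)
  fix a b c d' assume s: "subseq [a, b, c, d'] xs"
  have "sorted_wrt (ccw w) [a, b, c, d']"
    using s r by (rule sorted_wrt_subseq)
  moreover have "distinct [a, b, c, d']"
    using s d by (rule distinct_subseq)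
  moreover have "set [a, b, c, d'] \<subseteq> set xs"
    using s by (rule subseq_subset)
  ultimately show "one_change (ccw a b c) (ccw a b d') (ccw a c d') (ccw b c d')"
    by (intro one_change_radial[of w] orient_nonzero[OF gp]) simp_all
qed

lemma signotope_radial_Cons:
  assumes gp: "general_position (set xs)" and d: "distinct xs" and r: "sorted_wrt (ccw w) xs"
  shows "signotope ccw (w # xs)"
  unfolding signotope_def
proof (intro allI impI)
  fix a b c d' assume s: "subseq [a, b, c, d'] (w # xs)"
  show "one_change (ccw a b c) (ccw a b d') (ccw a c d') (ccw b c d')"
  proof (cases "a = w")
    case True
    then have "subseq [b, c, d'] xs" using s by simp
    then have "sorted_wrt (ccw w) [b, c, d']" using r by (rule sorted_wrt_subseq)
    then show ?thesis using True by (simp add: one_change_def)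
  next
    case False
    then have "subseq [a, b, c, d'] xs" using s by simp
    then show ?thesis
      using signotope_radial[OF assms] unfolding signotope_def by blast
  qed
qed

lemma in_between_eq:
  assumes "distinct xs" "xs = u1 @ a # u2 @ b # u3"
  shows "in_between a b xs = u2"
proof -
  have "dropWhile (\<lambda>x. x \<noteq> a) xs = a # u2 @ b # u3"
    unfolding assms(2) by (subst dropWhile_append2) (use assms in auto)
  moreover have "takeWhile (\<lambda>x. x \<noteq> b) (u2 @ b # u3) = u2"
    using assms by (subst takeWhile_append2) auto
  ultimately show ?thesis
    by (simp add: in_between_def)
qed

text \<open>A point that comes before \<open>a\<close> or after \<open>c\<close> in the list cannot lie inside the triangle, since it would give
the signs \<open>+ - +\<close> or \<open>- + -\<close> for three of its triples.\<close>
lemma empty_triangleD: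
  assumes s: "signotope ccw xs" and d: "distinct xs" and gp: "general_position (set xs)"
    and sub: "subseq [a, b, c] xs" and e: "empty_triangle ccw xs (a, b, c)" and p: "p \<in> set xs"
  shows "ccw a b c \<Longrightarrow> \<not> (ccw a b p \<and> ccw b c p \<and> ccw c a p)"
    and "\<not> ccw a b c \<Longrightarrow> \<not> (ccw a c p \<and> ccw c b p \<and> ccw b a p)"
proof -
  obtain u1 v where 1: "xs = u1 @ a # v" "subseq [b, c] v"
    using list_emb_ConsD[OF sub] by blast
  then obtain u2 v' where 2: "v = u2 @ b # v'" "subseq [c] v'"
    using list_emb_ConsD[OF 1(2)] by blast
  then obtain u3 u4 where 3: "v' = u3 @ c # u4"
    using list_emb_ConsD[OF 2(2)] by blast
  have xs: "xs = u1 @ a # u2 @ b # u3 @ c # u4"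
    using 1 2 3 by simp
  have b1: "in_between a b xs = u2"
    using d by (rule in_between_eq) (simp add: xs)
  have b2: "in_between b c xs = u3"
    using d by (rule in_between_eq[of _ "u1 @ a # u2"]) (simp add: xs)
  have oc: "one_change (ccw x y z) (ccw x y t) (ccw x z t) (ccw y z t)" if "subseq [x, y, z, t] xs" for x y z t
    using s that unfolding signotope_def by blast
  have D: "distinct [a, b, c]" "{a, b, c} \<subseteq> set xs"
    using distinct_subseq[OF sub d] subseq_subset[OF sub] by simp_all
  have e2: "\<forall>i\<in>set u2. ccw a i b = ccw a b c \<or> ccw a i c \<noteq> ccw a b c"
    and e3: "\<forall>i\<in>set u3. ccw b i c = ccw a b c \<or> ccw a i c \<noteq> ccw a b c"
    using e by (simp_all add: empty_triangle_def b1 b2)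
  have *: "(ccw a b c \<longrightarrow> \<not> (ccw a b p \<and> ccw b c p \<and> ccw c a p)) \<and>
    (\<not> ccw a b c \<longrightarrow> \<not> (ccw a c p \<and> ccw c b p \<and> ccw b a p))"
  proof (cases "p \<in> {a, b, c}")
    case True
    then consider "p = a" | "p = b" | "p = c" by blast
    then show ?thesis by cases simp_all
  next
    case False
    have n: "ccw x z y \<longleftrightarrow> \<not> ccw x y z" if "{x, y, z} \<subseteq> {a, b, c, p}" "distinct [x, y, z]" for x y z
    proof -
      have "{x, y, z} \<subseteq> set xs"
        using that(1) D(2) p by blast
      then show ?thesis
        using not_ccw[OF gp, of x y z] that(2) by simp
    qed
    have dp: "a \<noteq> b" "a \<noteq> c" "b \<noteq> c" "p \<noteq> a" "p \<noteq> b" "p \<noteq> c" using D False by auto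
    have rot: "ccw a b p = ccw p a b" "ccw b c p = ccw p b c" "ccw a c p = ccw p a c"
      "ccw c a p = ccw p c a" "ccw c b p = ccw p c b" "ccw b a p = ccw p b a"
      "ccw a p b = ccw p b a" "ccw b p c = ccw p c b" "ccw a p c = ccw p c a"
      by (metis orient_rotate)+
    have flip: "ccw p c a \<longleftrightarrow> \<not> ccw p a c" "ccw p c b \<longleftrightarrow> \<not> ccw p b c" "ccw p b a \<longleftrightarrow> \<not> ccw p a b"
      using n[of p a c] n[of p b c] n[of p a b] dp by simp_all
    consider "p \<in> set u1" | "p \<in> set u2" | "p \<in> set u3" | "p \<in> set u4"
      using p False xs by auto
    then show ?thesis
    proof cases
      case 1
      then have "subseq [p] u1" by (simp add: subseq_singleton_left)
      then have "subseq ([p] @ [a, b, c]) (u1 @ (a # u2 @ b # u3 @ c # u4))"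
        by (rule list_emb_append_mono) (simp, (rule list_emb_append2, simp)+)
      then show ?thesis
        using oc[of p a b c] unfolding rot flip one_change_def xs by auto
    next
      case 2
      then show ?thesis
        using bspec[OF e2 2] unfolding rot flip by blast
    next
      case 3
      then show ?thesis
        using bspec[OF e3 3] unfolding rot flip by blast
    next
      case 4
      then have "subseq [p] u4" by (simp add: subseq_singleton_left)
      then have "subseq ([a, b, c] @ [p]) ((u1 @ a # u2 @ b # u3 @ [c]) @ u4)"
        by (intro list_emb_append_mono) (rule list_emb_append2, simp)+
      then show ?thesis
        using oc[of a b c p] unfolding rot flip one_change_def xs by auto
    qed
  qed
  then show "ccw a b c \<Longrightarrow> \<not> (ccw a b p \<and> ccw b c p \<and> ccw c a p)"
    and "\<not> ccw a b c \<Longrightarrow> \<not> (ccw a c p \<and> ccw c b p \<and> ccw b a p)"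
    by blast+
qed

lemma subseqs_of_five:
  shows "subseq [a, b, c] [a, b, c, d, e]"
    "subseq [a, b, d] [a, b, c, d, e]"
    "subseq [a, b, e] [a, b, c, d, e]"
    "subseq [a, c, d] [a, b, c, d, e]"
    "subseq [a, c, e] [a, b, c, d, e]"
    "subseq [a, d, e] [a, b, c, d, e]"
    "subseq [b, c, d] [a, b, c, d, e]"
    "subseq [b, c, e] [a, b, c, d, e]"
    "subseq [b, d, e] [a, b, c, d, e]"
    "subseq [c, d, e] [a, b, c, d, e]"
    "subseq [a, b, c, d] [a, b, c, d, e]"
    "subseq [a, b, c, e] [a, b, c, d, e]"
    "subseq [a, b, d, e] [a, b, c, d, e]"
    "subseq [a, c, d, e] [a, b, c, d, e]"
    "subseq [b, c, d, e] [a, b, c, d, e]"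
  by simp_all

lemma fan_subseq: "(x, y, z) \<in> set (fan sh a b c d e) \<Longrightarrow> subseq [x, y, z] [a, b, c, d, e]"
  by (cases sh; simp only: fan.simps list.set insert_iff empty_iff prod.inject; elim disjE conjE FalseE; simp)

text \<open>For every shape, \<open>one_change\<close> on the five quadruples yields all ten orientations, and \<open>five_hole_if_ccw\<close>
applies to the vertices in their counterclockwise order from \<open>a\<close>.\<close>
lemma five_hole_if_hole:
  assumes s: "signotope ccw xs" and d: "distinct xs" and gp: "general_position (set xs)"
    and h: "hole ccw xs sh a b c d' e"
  shows "five_hole (set xs) {a, b, c, d', e}"
proof -
  have sub: "subseq [a, b, c, d', e] xs"
    using h by (simp add: hole_def)
  have S: "{a, b, c, d', e} \<subseteq> set xs" and D: "distinct [a, b, c, d', e]"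
    using distinct_subseq[OF sub d] subseq_subset[OF sub] by simp_all
  have 3: "subseq [x, y, z] xs" if "subseq [x, y, z] [a, b, c, d', e]" for x y z
    using that sub by (rule subseq_order.trans)
  have oc: "one_change (ccw x y z) (ccw x y t) (ccw x z t) (ccw y z t)"
    if "subseq [x, y, z, t] [a, b, c, d', e]" for x y z t
    using s subseq_order.trans[OF that sub] unfolding signotope_def by blast
  note oc5 = oc[OF subseqs_of_five(11)] oc[OF subseqs_of_five(12)] oc[OF subseqs_of_five(13)] oc[OF subseqs_of_five(14)] oc[OF subseqs_of_five(15)]
  have E: "ccw x y z \<Longrightarrow> \<not> (ccw x y p \<and> ccw y z p \<and> ccw z x p)"
    "\<not> ccw x y z \<Longrightarrow> \<not> (ccw x z p \<and> ccw z y p \<and> ccw y x p)"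
    if "(x, y, z) \<in> set (fan sh a b c d' e)" "p \<in> set xs" for x y z p
    using empty_triangleD[OF s d gp 3[OF fan_subseq[OF that(1)]] _ that(2)] h that(1)
    unfolding hole_def by blast+
  have N: "ccw y z x \<longleftrightarrow> ccw x y z" "ccw z x y \<longleftrightarrow> ccw x y z" "ccw x z y \<longleftrightarrow> \<not> ccw x y z"
      "ccw z y x \<longleftrightarrow> \<not> ccw x y z" "ccw y x z \<longleftrightarrow> \<not> ccw x y z"
    if "subseq [x, y, z] [a, b, c, d', e]" for x y z
  proof -
    have "set [x, y, z] \<subseteq> set xs" "distinct [x, y, z]"
      using subseq_subset[OF 3[OF that]] distinct_subseq[OF that D] by simp_all
    then have "ccw x z y \<longleftrightarrow> \<not> ccw x y z"
      using not_ccw[OF gp, of x y z] by simp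
    then show "ccw y z x \<longleftrightarrow> ccw x y z" "ccw z x y \<longleftrightarrow> ccw x y z" "ccw x z y \<longleftrightarrow> \<not> ccw x y z"
      "ccw z y x \<longleftrightarrow> \<not> ccw x y z" "ccw y x z \<longleftrightarrow> \<not> ccw x y z"
      by (metis orient_rotate)+
  qed
  note N10 = N[OF subseqs_of_five(1)] N[OF subseqs_of_five(2)] N[OF subseqs_of_five(3)] N[OF subseqs_of_five(4)] N[OF subseqs_of_five(5)] N[OF subseqs_of_five(6)] N[OF subseqs_of_five(7)] N[OF subseqs_of_five(8)] N[OF subseqs_of_five(9)] N[OF subseqs_of_five(10)]
  show ?thesis
  proof (cases sh)
    case Cup
    have "ccw a b c \<and> ccw b c d' \<and> ccw c d' e"
      using h Cup unfolding hole_def right_turns_def by simp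
    then have T: "ccw a b c \<and> ccw a b d' \<and> ccw a b e \<and> ccw a c d' \<and> ccw a c e \<and> ccw a d' e \<and> ccw b c d' \<and> ccw b c e \<and> ccw b d' e \<and> ccw c d' e"
      using oc5 unfolding one_change_def by sat
    show ?thesis
      using five_hole_if_ccw[OF gp, of a b c d' e] S T E[of a b c] E[of a c d'] E[of a d' e]
      by (simp add: N10 insert_commute Cup)
  next
    case Cap
    have "\<not> ccw a b c \<and> \<not> ccw b c d' \<and> \<not> ccw c d' e"
      using h Cap unfolding hole_def right_turns_def by simp
    then have T: "\<not> ccw a b c \<and> \<not> ccw a b d' \<and> \<not> ccw a b e \<and> \<not> ccw a c d' \<and> \<not> ccw a c e \<and> \<not> ccw a d' e \<and> \<not> ccw b c d' \<and> \<not> ccw b c e \<and> \<not> ccw b d' e \<and> \<not> ccw c d' e"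
      using oc5 unfolding one_change_def by sat
    show ?thesis
      using five_hole_if_ccw[OF gp, of a e d' c b] S T E[of a d' e] E[of a c d'] E[of a b c]
      by (simp add: N10 insert_commute Cap)
  next
    case UpB
    have "\<not> ccw a b e \<and> ccw a c d' \<and> ccw c d' e"
      using h UpB unfolding hole_def right_turns_def by simp
    then have T: "\<not> ccw a b c \<and> \<not> ccw a b d' \<and> \<not> ccw a b e \<and> ccw a c d' \<and> ccw a c e \<and> ccw a d' e \<and> ccw b c d' \<and> ccw b c e \<and> ccw b d' e \<and> ccw c d' e"
      using oc5 unfolding one_change_def by sat
    show ?thesis
      using five_hole_if_ccw[OF gp, of a c d' e b] S T E[of a c d'] E[of a d' e] E[of a b e]
      by (simp add: N10 insert_commute UpB)
  next
    case UpC
    have "\<not> ccw a c e \<and> ccw a b d' \<and> ccw b d' e"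
      using h UpC unfolding hole_def right_turns_def by simp
    then have T: "ccw a b c \<and> ccw a b d' \<and> ccw a b e \<and> \<not> ccw a c d' \<and> \<not> ccw a c e \<and> ccw a d' e \<and> \<not> ccw b c d' \<and> \<not> ccw b c e \<and> ccw b d' e \<and> ccw c d' e"
      using oc5 unfolding one_change_def by sat
    show ?thesis
      using five_hole_if_ccw[OF gp, of a b d' e c] S T E[of a b d'] E[of a d' e] E[of a c e]
      by (simp add: N10 insert_commute UpC)
  next
    case UpD
    have "\<not> ccw a d' e \<and> ccw a b c \<and> ccw b c e"
      using h UpD unfolding hole_def right_turns_def by simp
    then have T: "ccw a b c \<and> ccw a b d' \<and> ccw a b e \<and> ccw a c d' \<and> ccw a c e \<and> \<not> ccw a d' e \<and> ccw b c d' \<and> ccw b c e \<and> \<not> ccw b d' e \<and> \<not> ccw c d' e"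
      using oc5 unfolding one_change_def by sat
    show ?thesis
      using five_hole_if_ccw[OF gp, of a b c e d'] S T E[of a b c] E[of a c e] E[of a d' e]
      by (simp add: N10 insert_commute UpD)
  next
    case LowB
    have "ccw a b e \<and> \<not> ccw a c d' \<and> \<not> ccw c d' e"
      using h LowB unfolding hole_def right_turns_def by simp
    then have T: "ccw a b c \<and> ccw a b d' \<and> ccw a b e \<and> \<not> ccw a c d' \<and> \<not> ccw a c e \<and> \<not> ccw a d' e \<and> \<not> ccw b c d' \<and> \<not> ccw b c e \<and> \<not> ccw b d' e \<and> \<not> ccw c d' e"
      using oc5 unfolding one_change_def by sat
    show ?thesis
      using five_hole_if_ccw[OF gp, of a b e d' c] S T E[of a b e] E[of a d' e] E[of a c d']
      by (simp add: N10 insert_commute LowB)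
  next
    case LowC
    have "ccw a c e \<and> \<not> ccw a b d' \<and> \<not> ccw b d' e"
      using h LowC unfolding hole_def right_turns_def by simp
    then have T: "\<not> ccw a b c \<and> \<not> ccw a b d' \<and> \<not> ccw a b e \<and> ccw a c d' \<and> ccw a c e \<and> \<not> ccw a d' e \<and> ccw b c d' \<and> ccw b c e \<and> \<not> ccw b d' e \<and> \<not> ccw c d' e"
      using oc5 unfolding one_change_def by sat
    show ?thesis
      using five_hole_if_ccw[OF gp, of a c e d' b] S T E[of a c e] E[of a d' e] E[of a b d']
      by (simp add: N10 insert_commute LowC)
  next
    case LowD
    have "ccw a d' e \<and> \<not> ccw a b c \<and> \<not> ccw b c e"
      using h LowD unfolding hole_def right_turns_def by simp
    then have T: "\<not> ccw a b c \<and> \<not> ccw a b d' \<and> \<not> ccw a b e \<and> \<not> ccw a c d' \<and> \<not> ccw a c e \<and> ccw a d' e \<and> \<not> ccw b c d' \<and> \<not> ccw b c e \<and> ccw b d' e \<and> ccw c d' e"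
      using oc5 unfolding one_change_def by sat
    show ?thesis
      using five_hole_if_ccw[OF gp, of a d' e c b] S T E[of a d' e] E[of a c e] E[of a b c]
      by (simp add: N10 insert_commute LowD)

  qed
qed

section \<open>Nine-point cuts along a hull edge\<close>

text \<open>For finite \<open>T\<close> this says that a line separates \<open>Z\<close> from the rest of \<open>T\<close>.\<close>
definition cut :: "(real^2) set \<Rightarrow> (real^2) set \<Rightarrow> bool" where
  "cut T Z \<longleftrightarrow> Z \<subseteq> T \<and> convex hull Z \<inter> convex hull (T - Z) = {}"

lemma five_hole_cut:
  assumes "cut T Z" "five_hole Z H"
  shows "five_hole T H"
proof -
  have "convex hull H \<subseteq> convex hull Z"
    using assms(2) by (intro hull_mono) (simp add: five_hole_def)
  then have "interior (convex hull H) \<subseteq> convex hull Z"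
    using interior_subset by blast
  moreover have "T - Z \<subseteq> convex hull (T - Z)"
    by (rule hull_subset)
  ultimately have "interior (convex hull H) \<inter> (T - Z) = {}"
    using assms(1) unfolding cut_def by blast
  then show ?thesis
    using assms unfolding cut_def five_hole_def by blast
qed

lemma cut_halfplane:
  assumes "Z \<subseteq> T" "\<And>p. p \<in> Z \<Longrightarrow> n \<bullet> p < k" "\<And>p. p \<in> T - Z \<Longrightarrow> k < n \<bullet> p"
  shows "cut T Z"
proof -
  have "convex hull Z \<subseteq> {p. n \<bullet> p < k}"
    using assms by (intro hull_minimal convex_halfspace_lt) auto
  moreover have "convex hull (T - Z) \<subseteq> {p. k < n \<bullet> p}"
    using assms by (intro hull_minimal convex_halfspace_gt) auto
  ultimately have "convex hull Z \<inter> convex hull (T - Z) = {}"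
    by (force simp: subset_iff)
  then show ?thesis
    using assms(1) by (simp add: cut_def)
qed

lemma separating_value:
  fixes A B :: "real set"
  assumes "finite A" "finite B" "\<And>a b. a \<in> A \<Longrightarrow> b \<in> B \<Longrightarrow> a < b"
  shows "\<exists>c. (\<forall>a\<in>A. a < c) \<and> (\<forall>b\<in>B. c < b)"
proof (cases "A = {} \<or> B = {}")
  case True
  then show ?thesis
    using finite_less_ub lt_ex gt_ex assms(1,2)
    by (metis (no_types, opaque_lifting) Max_ge Min_le empty_iff less_le_trans le_less_trans)
next
  case False
  then have "Max A < Min B"
    using assms by simp
  then obtain c where "Max A < c" "c < Min B"
    using dense by blast
  then show ?thesis
    using assms False by (intro exI[of _ c]) auto
qed

lemma sorted_list_by_key:
  fixes h :: "'a \<Rightarrow> real"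
  assumes "finite A" "inj_on h A"
  shows "\<exists>xs. set xs = A \<and> distinct xs \<and> sorted_wrt (\<lambda>p q. h p < h q) xs"
proof -
  obtain zs where zs: "set zs = A" "distinct zs"
    using finite_distinct_list[OF assms(1)] by blast
  have "distinct (map h (sort_key h zs))"
    using zs assms(2) by (simp add: distinct_map)
  then have "sorted_wrt (<) (map h (sort_key h zs))"
    by (simp add: strict_sorted_iff)
  then show ?thesis
    using zs by (intro exI[of _ "sort_key h zs"]) (simp add: sorted_wrt_map)
qed

locale hull_edge =
  fixes T :: "(real^2) set" and w r :: "real^2"
  assumes finite_T: "finite T" and gp: "general_position T"
    and w_in: "w \<in> T" and r_in: "r \<in> T" and w_neq_r: "w \<noteq> r"
    and edge: "\<And>p. p \<in> T - {w, r} \<Longrightarrow> ccw w r p"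
begin

definition Q where "Q = T - {w, r}"

text \<open>Up to scaling, \<open>height\<close> is the distance from the line \<open>w r\<close>. Dividing by it makes \<open>Y\<close> and \<open>X\<close> the
cotangents, up to sign, of the angles at \<open>w\<close> and \<open>r\<close>. Their level lines are the lines through \<open>w\<close> and
through \<open>r\<close>; the level lines of \<open>mix t\<close> meet in one point of the line \<open>w r\<close>, or are parallel to it if \<open>t = 1 / 2\<close>.\<close>
definition height where "height p = orient w r p"
definition Y where "Y p = - ((p - w) \<bullet> (r - w)) / height p"
definition X where "X p = ((p - r) \<bullet> (r - w)) / height p"
definition mix where "mix t p = (1 - t) * Y p + t * X p"

lemma finite_Q: "finite Q"
  using finite_T by (simp add: Q_def)

lemma height_pos: "p \<in> Q \<Longrightarrow> 0 < height p"
  using edge by (simp add: Q_def height_def)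

lemma dd_pos: "0 < (r - w) \<bullet> (r - w)"
  using w_neq_r by simp

lemma frac_less: "0 < b \<Longrightarrow> 0 < d \<Longrightarrow> a / b < c / d \<longleftrightarrow> a * d < c * (b::real)"
  by (simp add: divide_simps mult.commute)

lemma Y_less_iff:
  assumes "p \<in> Q" "q \<in> Q"
  shows "Y p < Y q \<longleftrightarrow> ccw w p q"
proof -
  have "orient w p q * ((r - w) \<bullet> (r - w))
      = ((p - w) \<bullet> (r - w)) * height q - ((q - w) \<bullet> (r - w)) * height p"
    by (simp add: orient_def height_def inner_vec_def sum_2 algebra_simps)
  moreover have "Y p < Y q \<longleftrightarrow> ((q - w) \<bullet> (r - w)) * height p < ((p - w) \<bullet> (r - w)) * height q"
    using assms by (simp add: Y_def frac_less height_pos)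
  ultimately show ?thesis
    using dd_pos by (metis diff_gt_0_iff_gt zero_less_mult_pos2 mult_pos_pos)
qed

lemma X_less_iff:
  assumes "p \<in> Q" "q \<in> Q"
  shows "X p < X q \<longleftrightarrow> ccw r q p"
proof -
  have "orient r q p * ((r - w) \<bullet> (r - w))
      = ((q - r) \<bullet> (r - w)) * height p - ((p - r) \<bullet> (r - w)) * height q"
    by (simp add: orient_def height_def inner_vec_def sum_2 algebra_simps)
  moreover have "X p < X q \<longleftrightarrow> ((p - r) \<bullet> (r - w)) * height q < ((q - r) \<bullet> (r - w)) * height p"
    using assms by (simp add: X_def frac_less height_pos)
  ultimately show ?thesis
    using dd_pos by (metis diff_gt_0_iff_gt zero_less_mult_pos2 mult_pos_pos)
qed

lemma inj_Y: "inj_on Y Q"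
proof (rule inj_onI, rule ccontr)
  fix p q assume "p \<in> Q" "q \<in> Q" "Y p = Y q" "p \<noteq> q"
  then have "\<not> ccw w p q" "\<not> ccw w q p"
    using Y_less_iff[of p q] Y_less_iff[of q p] by auto
  moreover have "\<not> ccw w p q \<longleftrightarrow> ccw w q p"
    using \<open>p \<in> Q\<close> \<open>q \<in> Q\<close> \<open>p \<noteq> q\<close> w_in by (intro not_ccw[OF gp]) (auto simp: Q_def)
  ultimately show False by blast
qed

lemma inj_X: "inj_on X Q"
proof (rule inj_onI, rule ccontr)
  fix p q assume "p \<in> Q" "q \<in> Q" "X p = X q" "p \<noteq> q"
  then have "\<not> ccw r p q" "\<not> ccw r q p"
    using X_less_iff[of p q] X_less_iff[of q p] by auto
  moreover have "\<not> ccw r p q \<longleftrightarrow> ccw r q p"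
    using \<open>p \<in> Q\<close> \<open>q \<in> Q\<close> \<open>p \<noteq> q\<close> r_in by (intro not_ccw[OF gp]) (auto simp: Q_def)
  ultimately show False by blast
qed

text \<open>Multiplying \<open>mix t p - c\<close> by \<open>height p\<close> gives an affine function of \<open>p\<close>. It is defined at \<open>w\<close> and \<open>r\<close> too,
and its signs there are those of \<open>- t\<close> and \<open>t - 1\<close>; so \<open>t\<close> decides on which side the two points are. For
\<open>t\<close> slightly outside the unit interval, exactly one of them is dropped from the cut.\<close>
lemma cut_level:
  assumes "t \<noteq> 0" "t \<noteq> 1" "A \<subseteq> Q"
    and "\<And>p q. p \<in> A \<Longrightarrow> q \<in> Q - A \<Longrightarrow> mix t p < mix t q"
  shows "cut T ((if 0 < t then {w} else {}) \<union> (if t < 1 then {r} else {}) \<union> A)"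
proof -
  have "finite A"
    using assms(3) finite_Q by (rule finite_subset)
  then have "\<exists>c. (\<forall>a\<in>mix t ` A. a < c) \<and> (\<forall>b\<in>mix t ` (Q - A). c < b)"
    using assms(4) finite_Q by (intro separating_value) auto
  then obtain c where c: "\<And>p. p \<in> A \<Longrightarrow> mix t p < c" "\<And>q. q \<in> Q - A \<Longrightarrow> c < mix t q"
    by blast
  define d where "d = r - w"
  define m :: "real^2" where "m = vector [- (r $ 2 - w $ 2), r $ 1 - w $ 1]"
  \<comment> \<open>With these, \<open>n \<bullet> p - k\<close> is the affine extension of \<open>height p * (mix t p - c)\<close>.\<close>
  define n where "n = (2 * t - 1) *\<^sub>R d - c *\<^sub>R m"
  define k where "k = t * (r \<bullet> d) - (1 - t) * (w \<bullet> d) - c * (m \<bullet> w)"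
  have h: "height p = m \<bullet> (p - w)" for p
    by (simp add: height_def orient_def m_def inner_vec_def sum_2 algebra_simps)
  have g: "n \<bullet> p - k = t * ((p - r) \<bullet> d) - (1 - t) * ((p - w) \<bullet> d) - c * height p" for p
    by (simp add: n_def k_def h inner_diff_left inner_diff_right algebra_simps inner_commute)
  have gQ: "n \<bullet> p - k = height p * (mix t p - c)" if "p \<in> Q" for p
  proof -
    have YX: "height p * Y p = - ((p - w) \<bullet> d)" "height p * X p = (p - r) \<bullet> d"
      using height_pos[OF that] by (simp_all add: X_def Y_def d_def)
    have "height p * (mix t p - c) = (1 - t) * (height p * Y p) + t * (height p * X p) - c * height p"
      by (simp add: mix_def algebra_simps)
    then show ?thesis
      unfolding g YX by simp
  qed
  have dd: "0 < d \<bullet> d" using dd_pos by (simp add: d_def)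
  have gw: "n \<bullet> w - k = - t * (d \<bullet> d)"
    unfolding g by (simp add: h d_def inner_diff_left inner_diff_right algebra_simps)
  have gr: "n \<bullet> r - k = - (1 - t) * (d \<bullet> d)"
    unfolding g by (simp add: d_def height_def algebra_simps)
  have T: "T = {w, r} \<union> Q" using w_in r_in by (auto simp: Q_def)
  have nQ: "w \<notin> Q" "r \<notin> Q" by (simp_all add: Q_def)
  show ?thesis
  proof (rule cut_halfplane[of _ _ n k])
    show "(if 0 < t then {w} else {}) \<union> (if t < 1 then {r} else {}) \<union> A \<subseteq> T"
      using assms(3) T by auto
    fix p assume "p \<in> (if 0 < t then {w} else {}) \<union> (if t < 1 then {r} else {}) \<union> A"
    then consider "p = w" "0 < t" | "p = r" "t < 1" | "p \<in> A"
      by (auto split: if_splits)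
    then have "n \<bullet> p - k < 0"
    proof cases
      case 1 then show ?thesis using dd mult_pos_pos[of t "d \<bullet> d"] by (simp add: gw)
    next
      case 2 then show ?thesis using dd mult_neg_pos[of "t - 1" "d \<bullet> d"] gr by simp
    next
      case 3
      then have "p \<in> Q" using assms(3) by blast
      then show ?thesis
        unfolding gQ[OF \<open>p \<in> Q\<close>] using c(1)[OF 3] by (intro mult_pos_neg height_pos) simp_all
    qed
    then show "n \<bullet> p < k" by simp
  next
    fix p assume p: "p \<in> T - ((if 0 < t then {w} else {}) \<union> (if t < 1 then {r} else {}) \<union> A)"
    then consider "p = w" "t < 0" | "p = r" "1 < t" | "p \<in> Q - A"
      using T assms(1,2) by (auto split: if_splits)
    then have "0 < n \<bullet> p - k"
    proof cases
      case 1 then show ?thesis using dd mult_neg_pos[of t "d \<bullet> d"] by (simp add: gw)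
    next
      case 2 then show ?thesis using dd mult_pos_pos[of "t - 1" "d \<bullet> d"] gr by simp
    next
      case 3
      then have "p \<in> Q" by blast
      then show ?thesis
        unfolding gQ[OF \<open>p \<in> Q\<close>] using c(2)[OF 3] by (intro mult_pos_pos height_pos) simp_all
    qed
    then show "k < n \<bullet> p" by simp
  qed
qed

lemma mix_stable:
  "\<exists>\<epsilon>>0. \<forall>t. \<bar>t - t0\<bar> < \<epsilon> \<longrightarrow> (\<forall>p\<in>Q. \<forall>q\<in>Q. mix t0 p < mix t0 q \<longrightarrow> mix t p < mix t q)"
proof -
  have "eventually (\<lambda>t. mix t0 p < mix t0 q \<longrightarrow> mix t p < mix t q) (nhds t0)" for p q
  proof (cases "mix t0 p < mix t0 q")
    case True
    have "((\<lambda>t. mix t q - mix t p) \<longlongrightarrow> mix t0 q - mix t0 p) (nhds t0)"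
      unfolding mix_def by (intro tendsto_intros filterlim_ident)
    then have "eventually (\<lambda>t. 0 < mix t q - mix t p) (nhds t0)"
      by (rule order_tendstoD) (use True in simp)
    then show ?thesis by (rule eventually_mono) simp
  qed simp
  then have "eventually (\<lambda>t. \<forall>p\<in>Q. \<forall>q\<in>Q. mix t0 p < mix t0 q \<longrightarrow> mix t p < mix t q) (nhds t0)"
    using finite_Q by (intro eventually_ball_finite ballI) auto
  then show ?thesis
    by (simp add: eventually_nhds_metric dist_real_def)
qed

text \<open>Two points tie for at most one value of \<open>t\<close>, because they differ in \<open>Y\<close>.\<close>
lemma mix_injective_dense:
  assumes "a < b"
  shows "\<exists>t. a < t \<and> t < b \<and> inj_on (mix t) Q"
proof -
  have "finite {t. mix t p = mix t q}" if "p \<in> Q" "q \<in> Q" "p \<noteq> q" for p q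
  proof -
    have "Y p - Y q \<noteq> 0"
      using inj_Y that by (auto simp: inj_on_eq_iff)
    have "t = (Y p - Y q) / ((Y p - Y q) - (X p - X q))" if "mix t p = mix t q" for t
    proof -
      have *: "t * ((Y p - Y q) - (X p - X q)) = Y p - Y q"
        using that by (simp add: mix_def algebra_simps)
      with \<open>Y p - Y q \<noteq> 0\<close> have "(Y p - Y q) - (X p - X q) \<noteq> 0" by auto
      with * show ?thesis by (simp add: field_simps)
    qed
    then have "{t. mix t p = mix t q} \<subseteq> {(Y p - Y q) / ((Y p - Y q) - (X p - X q))}"
      by blast
    then show ?thesis using finite_subset by blast
  qed
  then have "finite (\<Union>p\<in>Q. \<Union>q\<in>Q - {p}. {t. mix t p = mix t q})"
    using finite_Q by (intro finite_UN_I) auto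
  moreover have "infinite {a<..<b}" using assms by simp
  ultimately have "\<not> {a<..<b} \<subseteq> (\<Union>p\<in>Q. \<Union>q\<in>Q - {p}. {t. mix t p = mix t q})"
    using finite_subset by blast
  then obtain t where "t \<in> {a<..<b}" "t \<notin> (\<Union>p\<in>Q. \<Union>q\<in>Q - {p}. {t. mix t p = mix t q})"
    by blast
  then have t: "a < t" "t < b" "\<forall>p\<in>Q. \<forall>q\<in>Q - {p}. mix t p \<noteq> mix t q"
    by simp_all
  then have "inj_on (mix t) Q"
    unfolding inj_on_def by blast
  then show ?thesis
    using t(1,2) by blast
qed

lemma cut_first_Y:
  assumes "A \<subseteq> Q" "\<And>p q. p \<in> A \<Longrightarrow> q \<in> Q - A \<Longrightarrow> Y p < Y q"
  shows "cut T ({w, r} \<union> A)" "cut T ({r} \<union> A)"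
proof -
  obtain \<epsilon> where e: "\<epsilon> > 0"
    "\<forall>t. \<bar>t - 0\<bar> < \<epsilon> \<longrightarrow> (\<forall>p\<in>Q. \<forall>q\<in>Q. mix 0 p < mix 0 q \<longrightarrow> mix t p < mix t q)"
    using mix_stable[of 0] by blast
  define t where "t = min \<epsilon> 1 / 2"
  have t: "0 < t" "t < 1" "t < \<epsilon>" using e(1) by (auto simp: t_def)
  have m: "mix s p < mix s q" if "\<bar>s\<bar> < \<epsilon>" "p \<in> A" "q \<in> Q - A" for s p q
  proof -
    have "p \<in> Q" "q \<in> Q" "mix 0 p < mix 0 q"
      using assms that by (auto simp: mix_def)
    then show ?thesis using e(2) that(1) by simp
  qed
  show "cut T ({w, r} \<union> A)"
    using cut_level[of t A] t m assms(1) by (simp add: insert_commute)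
  show "cut T ({r} \<union> A)"
    using cut_level[of "- t" A] t m assms(1) by simp
qed

lemma cut_first_X:
  assumes "A \<subseteq> Q" "\<And>p q. p \<in> A \<Longrightarrow> q \<in> Q - A \<Longrightarrow> X p < X q"
  shows "cut T ({w, r} \<union> A)" "cut T ({w} \<union> A)"
proof -
  obtain \<epsilon> where e: "\<epsilon> > 0"
    "\<forall>t. \<bar>t - 1\<bar> < \<epsilon> \<longrightarrow> (\<forall>p\<in>Q. \<forall>q\<in>Q. mix 1 p < mix 1 q \<longrightarrow> mix t p < mix t q)"
    using mix_stable[of 1] by blast
  define t where "t = min \<epsilon> 1 / 2"
  have t: "0 < t" "t < 1" "t < \<epsilon>" using e(1) by (auto simp: t_def)
  have m: "mix s p < mix s q" if "\<bar>s - 1\<bar> < \<epsilon>" "p \<in> A" "q \<in> Q - A" for s p q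
  proof -
    have "p \<in> Q" "q \<in> Q" "mix 1 p < mix 1 q"
      using assms that by (auto simp: mix_def)
    then show ?thesis using e(2) that(1) by simp
  qed
  show "cut T ({w, r} \<union> A)"
    using cut_level[of "1 - t" A] t m assms(1) by (simp add: insert_commute)
  show "cut T ({w} \<union> A)"
    using cut_level[of "1 + t" A] t m assms(1) by simp
qed

end

section \<open>A checker for refutation trees\<close>

text \<open>The labels are constructors, so that equality of labels is decided by a single rewrite step.\<close>
datatype label = p0 | p1 | p2 | p3 | p4 | p5 | p6 | p7 | p8 | p9 | p10 | p11

text \<open>A finite map from labels, stored such that a look-up or an update is one rewrite step. Three nested rows
make up the table of the orientations that are known in a branch of a tree.\<close>
datatype 'a row = Row "'a option" "'a option" "'a option" "'a option" "'a option" "'a option" "'a option" "'a option" "'a option" "'a option" "'a option" "'a option"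

fun sel :: "label \<Rightarrow> 'a row \<Rightarrow> 'a option" where
  "sel p0 (Row a b c d e f g h i j k l) = a"
| "sel p1 (Row a b c d e f g h i j k l) = b"
| "sel p2 (Row a b c d e f g h i j k l) = c"
| "sel p3 (Row a b c d e f g h i j k l) = d"
| "sel p4 (Row a b c d e f g h i j k l) = e"
| "sel p5 (Row a b c d e f g h i j k l) = f"
| "sel p6 (Row a b c d e f g h i j k l) = g"
| "sel p7 (Row a b c d e f g h i j k l) = h"
| "sel p8 (Row a b c d e f g h i j k l) = i"
| "sel p9 (Row a b c d e f g h i j k l) = j"
| "sel p10 (Row a b c d e f g h i j k l) = k"
| "sel p11 (Row a b c d e f g h i j k l) = l"

fun upd :: "label \<Rightarrow> 'a \<Rightarrow> 'a row \<Rightarrow> 'a row" where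
  "upd p0 x (Row a b c d e f g h i j k l) = Row (Some x) b c d e f g h i j k l"
| "upd p1 x (Row a b c d e f g h i j k l) = Row a (Some x) c d e f g h i j k l"
| "upd p2 x (Row a b c d e f g h i j k l) = Row a b (Some x) d e f g h i j k l"
| "upd p3 x (Row a b c d e f g h i j k l) = Row a b c (Some x) e f g h i j k l"
| "upd p4 x (Row a b c d e f g h i j k l) = Row a b c d (Some x) f g h i j k l"
| "upd p5 x (Row a b c d e f g h i j k l) = Row a b c d e (Some x) g h i j k l"
| "upd p6 x (Row a b c d e f g h i j k l) = Row a b c d e f (Some x) h i j k l"
| "upd p7 x (Row a b c d e f g h i j k l) = Row a b c d e f g (Some x) i j k l"
| "upd p8 x (Row a b c d e f g h i j k l) = Row a b c d e f g h (Some x) j k l"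
| "upd p9 x (Row a b c d e f g h i j k l) = Row a b c d e f g h i (Some x) k l"
| "upd p10 x (Row a b c d e f g h i j k l) = Row a b c d e f g h i j (Some x) l"
| "upd p11 x (Row a b c d e f g h i j k l) = Row a b c d e f g h i j k (Some x)"

definition blank :: "'a row" where
  "blank = Row None None None None None None None None None None None None"

lemma sel_upd [simp]: "sel x (upd y v r) = (if x = y then Some v else sel x r)"
  by (cases r; cases x; cases y; simp)

lemma sel_blank [simp]: "sel x blank = None"
  by (cases x) (simp_all add: blank_def)

fun entry :: "label \<Rightarrow> 'a row option \<Rightarrow> 'a option" where
  "entry x None = None"
| "entry x (Some r) = sel x r"

fun put :: "label \<Rightarrow> 'a \<Rightarrow> 'a row option \<Rightarrow> 'a row" where
  "put x v None = upd x v blank"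
| "put x v (Some r) = upd x v r"

lemma sel_put [simp]: "sel x (put y v r) = (if x = y then Some v else entry x r)"
  by (cases r) simp_all

type_synonym table = "bool row row row option"

definition look :: "table \<Rightarrow> label \<Rightarrow> label \<Rightarrow> label \<Rightarrow> bool option" where
  "look m a b c = entry c (entry b (entry a m))"

fun assign :: "label \<times> label \<times> label \<Rightarrow> bool \<Rightarrow> table \<Rightarrow> table" where
  "assign (a, b, c) v m =
     Some (put a (put b (put c v (entry b (entry a m))) (entry a m)) m)"

declare assign.simps [simp del]

lemma look_assign: "look (assign (a, b, c) v m) x y z =
   (if (x, y, z) = (a, b, c) then Some v else look m x y z)"
  by (auto simp: look_def assign.simps)

definition agrees :: "(label \<Rightarrow> label \<Rightarrow> label \<Rightarrow> bool) \<Rightarrow> table \<Rightarrow> bool" where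
  "agrees s m \<longleftrightarrow> (\<forall>a b c v. look m a b c = Some v \<longrightarrow> s a b c = v)"

lemma agrees_blank: "agrees s None"
  by (simp add: agrees_def look_def)

lemma agrees_assign: "agrees s m \<Longrightarrow> s a b c = v \<Longrightarrow> agrees s (assign (a, b, c) v m)"
  by (auto simp: agrees_def look_assign)

fun alternates :: "bool option \<Rightarrow> bool option \<Rightarrow> bool option \<Rightarrow> bool" where
  "alternates (Some x) (Some y) (Some z) = (x = z \<and> x \<noteq> y)"
| "alternates _ _ _ = False"

text \<open>These tests are recursive functions without abstractions over the table: when rewriting contracts a
redex, the whole table that it contains would be normalized again.\<close>
fun all_known :: "table \<Rightarrow> bool \<Rightarrow> (label \<times> label \<times> label) list \<Rightarrow> bool" where
  "all_known m v [] \<longleftrightarrow> True"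
| "all_known m v ((a, b, c) # ts) \<longleftrightarrow> look m a b c = Some v \<and> all_known m v ts"

fun known_outside :: "table \<Rightarrow> bool \<Rightarrow> label \<Rightarrow> label \<Rightarrow> label \<Rightarrow> label \<Rightarrow> label list \<Rightarrow> bool" where
  "known_outside m t x y a c [] \<longleftrightarrow> True"
| "known_outside m t x y a c (i # is) \<longleftrightarrow>
     (look m a i c = Some (\<not> t) \<or> look m x i y = Some t) \<and> known_outside m t x y a c is"

fun known_empty_from :: "table \<Rightarrow> label list \<Rightarrow> label \<Rightarrow> label \<Rightarrow> label \<Rightarrow> bool option \<Rightarrow> bool" where
  "known_empty_from m xs a b c None \<longleftrightarrow> in_between a b xs = [] \<and> in_between b c xs = []"
| "known_empty_from m xs a b c (Some t) \<longleftrightarrow>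
     known_outside m t a b a c (in_between a b xs) \<and> known_outside m t b c a c (in_between b c xs)"

fun all_known_empty :: "table \<Rightarrow> label list \<Rightarrow> (label \<times> label \<times> label) list \<Rightarrow> bool" where
  "all_known_empty m xs [] \<longleftrightarrow> True"
| "all_known_empty m xs ((a, b, c) # ts) \<longleftrightarrow>
     known_empty_from m xs a b c (look m a b c) \<and> all_known_empty m xs ts"

fun known_violation :: "bool option \<Rightarrow> bool option \<Rightarrow> bool option \<Rightarrow> bool option \<Rightarrow> bool" where
  "known_violation p q r s \<longleftrightarrow> alternates p q r \<or> alternates p q s \<or> alternates p r s \<or> alternates q r s"

lemma agreesD: "agrees s m \<Longrightarrow> look m a b c = Some v \<Longrightarrow> s a b c = v"
  by (simp add: agrees_def)

text \<open>Unit propagation for one quadruple: an orientation is known as soon as all sign sequences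
that fit the known ones agree on it.\<close>
definition one_change_patterns :: "(bool \<times> bool \<times> bool \<times> bool) list" where
  "one_change_patterns =
     [(True, True, True, True), (True, True, True, False), (True, True, False, False), (True, False, False, False),
      (False, False, False, False), (False, False, False, True), (False, False, True, True), (False, True, True, True)]"

lemma one_change_iff_pattern: "one_change p q r s \<longleftrightarrow> (p, q, r, s) \<in> set one_change_patterns"
  by (cases p; cases q; cases r; cases s) (simp_all add: one_change_def one_change_patterns_def)

fun fits :: "bool option \<Rightarrow> bool \<Rightarrow> bool" where
  "fits None v = True"
| "fits (Some u) v = (u = v)"

definition fitting :: "bool option \<Rightarrow> bool option \<Rightarrow> bool option \<Rightarrow> bool option \<Rightarrow> (bool \<times> bool \<times> bool \<times> bool) list" where
  "fitting p q r s = filter (\<lambda>(x, y, z, t). fits p x \<and> fits q y \<and> fits r z \<and> fits s t) one_change_patterns"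

fun common :: "bool list \<Rightarrow> bool option" where
  "common [] = None"
| "common (v # vs) = (if list_all ((=) v) vs then Some v else None)"

fun store :: "label \<times> label \<times> label \<Rightarrow> bool option \<Rightarrow> bool option \<Rightarrow> table \<Rightarrow> table" where
  "store x None (Some v) m = assign x v m"
| "store x _ _ m = m"

definition store_common where
  "store_common a b c d ps m =
     store (a, b, c) (look m a b c) (common (map (\<lambda>(x, y, z, t). x) ps))
    (store (a, b, d) (look m a b d) (common (map (\<lambda>(x, y, z, t). y) ps))
    (store (a, c, d) (look m a c d) (common (map (\<lambda>(x, y, z, t). z) ps))
    (store (b, c, d) (look m b c d) (common (map (\<lambda>(x, y, z, t). t) ps)) m)))"

definition propagate :: "label \<Rightarrow> label \<Rightarrow> label \<Rightarrow> label \<Rightarrow> table \<Rightarrow> table" where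
  "propagate a b c d m = store_common a b c d
     (fitting (look m a b c) (look m a b d) (look m a c d) (look m b c d)) m"

lemma common_sound: "common vs = Some v \<Longrightarrow> u \<in> set vs \<Longrightarrow> u = v"
  by (cases vs) (auto simp: list_all_iff split: if_splits)

lemma agrees_store:
  assumes "agrees s m" "\<And>v. w = Some v \<Longrightarrow> s a b c = v"
  shows "agrees s (store (a, b, c) u w m)"
  using assms by (cases u; cases w) (simp_all add: agrees_assign)

lemma agrees_propagate:
  assumes m: "agrees s m" and o: "one_change (s a b c) (s a b d) (s a c d) (s b c d)"
  shows "agrees s (propagate a b c d m)"
proof -
  define ps where "ps = fitting (look m a b c) (look m a b d) (look m a c d) (look m b c d)"
  have fits: "fits (look m x y z) (s x y z)" for x y z
    using m by (cases "look m x y z") (simp_all add: agreesD)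
  have "(s a b c, s a b d, s a c d, s b c d) \<in> set ps"
    unfolding ps_def fitting_def using o fits by (simp add: one_change_iff_pattern)
  then have c: "common (map f ps) = Some v \<Longrightarrow> f (s a b c, s a b d, s a c d, s b c d) = v" for f v
    using common_sound[of "map f ps" v "f (s a b c, s a b d, s a c d, s b c d)"] by simp
  show ?thesis
    unfolding propagate_def store_common_def ps_def[symmetric]
    by (intro agrees_store m) (drule c; simp)+
qed

text \<open>A branching on the orientation of three labels; a propagation on four labels; and three kinds of leaves:
a quadruple with two sign changes, a pentagon that is empty with respect to the \<open>k\<close>-th list, and the
\<open>k\<close>-th of the additional clauses, all of whose literals are false.\<close>
datatype refutation =
    Br label label label refutation refutation
  | Pr label label label label refutation
  | Sg label label label label
  | Ho nat shape label label label label label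
  | Cl nat

type_synonym literal = "(label \<times> label \<times> label) \<times> bool"

fun all_false :: "table \<Rightarrow> literal list \<Rightarrow> bool" where
  "all_false m [] \<longleftrightarrow> True"
| "all_false m (((a, b, c), v) # ls) \<longleftrightarrow> look m a b c = Some (\<not> v) \<and> all_false m ls"

primrec refutes :: "label list list \<Rightarrow> label list list \<Rightarrow> literal list list \<Rightarrow> table \<Rightarrow> refutation \<Rightarrow> bool" where
  "refutes xss yss css m (Br a b c t u) =
     (refutes xss yss css (assign (a, b, c) True m) t \<and> refutes xss yss css (assign (a, b, c) False m) u)"
| "refutes xss yss css m (Pr a b c d t) =
     (list_ex (subseq [a, b, c, d]) xss \<and> refutes xss yss css (propagate a b c d m) t)"
| "refutes xss yss css m (Sg a b c d) =
     (list_ex (subseq [a, b, c, d]) xss \<and>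
      known_violation (look m a b c) (look m a b d) (look m a c d) (look m b c d))"
| "refutes xss yss css m (Ho k sh a b c d e) =
     (k < length yss \<and> subseq [a, b, c, d, e] (yss ! k) \<and>
      all_known m True (left_turns sh a b c d e) \<and>
      all_known m False (right_turns sh a b c d e) \<and>
      all_known_empty m (yss ! k) (fan sh a b c d e))"
| "refutes xss yss css m (Cl k) = (k < length css \<and> all_false m (css ! k))"

lemma alternates_iff: "alternates x y z \<longleftrightarrow> (\<exists>u. x = Some u \<and> y = Some (\<not> u) \<and> z = Some u)"
  by (cases "(x, y, z)" rule: alternates.cases) auto

lemma all_known_sound:
  assumes "agrees s m" "all_known m v ts"
  shows "\<forall>(a, b, c)\<in>set ts. s a b c = v"
  using assms by (induction m v ts rule: all_known.induct) (auto dest: agreesD)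

lemma known_outside_sound:
  assumes "agrees s m" "known_outside m t x y a c is"
  shows "\<forall>i\<in>set is. s x i y = t \<or> s a i c \<noteq> t"
  using assms by (induction m t x y a c "is" rule: known_outside.induct) (auto dest: agreesD)

lemma known_empty_from_sound:
  assumes "agrees s m" "known_empty_from m xs a b c (look m a b c)"
  shows "empty_triangle s xs (a, b, c)"
proof (cases "look m a b c")
  case None
  then show ?thesis
    using assms(2) by (simp add: empty_triangle_def)
next
  case (Some t)
  then have "known_outside m t a b a c (in_between a b xs)" "known_outside m t b c a c (in_between b c xs)"
    using assms(2) by simp_all
  moreover have "s a b c = t"
    using Some assms(1) by (simp add: agreesD)
  ultimately show ?thesis
    using known_outside_sound[OF assms(1)] unfolding empty_triangle_def by fast
qed

lemma all_known_empty_sound: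
  assumes "agrees s m" "all_known_empty m xs ts"
  shows "\<forall>t\<in>set ts. empty_triangle s xs t"
  using assms by (induction m xs ts rule: all_known_empty.induct) (auto dest: known_empty_from_sound)

lemma all_false_sound:
  assumes "agrees s m" "all_false m ls"
  shows "\<forall>((a, b, c), v)\<in>set ls. s a b c = (\<not> v)"
  using assms by (induction m ls rule: all_false.induct) (auto dest: agreesD)

theorem refutes_sound:
  assumes "refutes xss yss css m t" and "agrees s m"
    and "\<And>xs. xs \<in> set xss \<Longrightarrow> signotope s xs"
    and "\<And>ys. ys \<in> set yss \<Longrightarrow> hole_free s ys"
    and "\<And>cs. cs \<in> set css \<Longrightarrow> \<exists>((a, b, c), v)\<in>set cs. s a b c = v"
  shows False
  using assms(1,2)
proof (induction t arbitrary: m)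
  case (Br a b c t u)
  have "agrees s (assign (a, b, c) (s a b c) m)"
    using Br.prems(2) by (rule agrees_assign) simp
  then show ?case
    using Br by (cases "s a b c") auto
next
  case (Pr a b c d t)
  then obtain xs where xs: "xs \<in> set xss" "subseq [a, b, c, d] xs"
    unfolding refutes.simps list_ex_iff by blast
  then have "one_change (s a b c) (s a b d) (s a c d) (s b c d)"
    using assms(3) unfolding signotope_def by blast
  then have "agrees s (propagate a b c d m)"
    using Pr.prems(2) by (intro agrees_propagate)
  then show ?case
    using Pr by auto
next
  case (Sg a b c d)
  then obtain xs where xs: "xs \<in> set xss" "subseq [a, b, c, d] xs"
    unfolding refutes.simps list_ex_iff by blast
  then have "one_change (s a b c) (s a b d) (s a c d) (s b c d)"
    using assms(3) unfolding signotope_def by blast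
  moreover from Sg have "known_violation (look m a b c) (look m a b d) (look m a c d) (look m b c d)"
    unfolding refutes.simps by blast
  ultimately show ?case
    by (auto simp: alternates_iff one_change_def dest!: agreesD[OF Sg.prems(2)])
next
  case (Ho k sh a b c d e)
  note h = Ho.prems(1)[unfolded refutes.simps]
  have "\<forall>(x, y, z)\<in>set (left_turns sh a b c d e). s x y z = True"
    using h by (intro all_known_sound[OF Ho.prems(2)]) blast
  moreover have "\<forall>(x, y, z)\<in>set (right_turns sh a b c d e). s x y z = False"
    using h by (intro all_known_sound[OF Ho.prems(2)]) blast
  moreover have "\<forall>t\<in>set (fan sh a b c d e). empty_triangle s (yss ! k) t"
    using h by (intro all_known_empty_sound[OF Ho.prems(2)]) blast
  ultimately have "hole s (yss ! k) sh a b c d e"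
    using h unfolding hole_def by simp
  moreover have "hole_free s (yss ! k)"
    using h by (intro assms(4) nth_mem) blast
  ultimately show ?case
    unfolding hole_free_def by blast
next
  case (Cl k)
  have "\<exists>((a, b, c), v)\<in>set (css ! k). s a b c = v"
    using Cl by (intro assms(5) nth_mem) simp
  moreover have "\<forall>((a, b, c), v)\<in>set (css ! k). s a b c = (\<not> v)"
    using Cl by (intro all_false_sound[OF Cl.prems(2)]) auto
  ultimately show ?case by fastforce
qed

fun table_of :: "literal list \<Rightarrow> table" where
  "table_of [] = None"
| "table_of ((x, v) # ls) = assign x v (table_of ls)"

lemma agrees_table_of:
  assumes "\<forall>((a, b, c), v)\<in>set ls. s a b c = v"
  shows "agrees s (table_of ls)"
  using assms by (induction ls rule: table_of.induct) (auto simp: agrees_blank intro!: agrees_assign)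

fun pairs :: "'a list \<Rightarrow> ('a \<times> 'a) list" where
  "pairs [] = []"
| "pairs (x # xs) = map (Pair x) xs @ pairs xs"

text \<open>What is known at the root of a tree: the first point of a list sees the others in their order, and a
pair \<open>(a, b)\<close> says that \<open>a\<close> precedes \<open>b\<close> in the \<open>X\<close> order, the order of angles at \<open>p1\<close>.\<close>
definition radial_facts :: "label list \<Rightarrow> literal list" where
  "radial_facts xs = map (\<lambda>(a, b). ((hd xs, a, b), True)) (pairs (tl xs))"

definition order_facts :: "(label \<times> label) list \<Rightarrow> literal list" where
  "order_facts ps = concat (map (\<lambda>(a, b). [((p1, a, b), False), ((p1, b, a), True)]) ps)"

lemma set_pairs: "(a, b) \<in> set (pairs xs) \<Longrightarrow> subseq [a, b] xs"
proof (induction xs)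
  case (Cons x xs)
  show ?case
  proof (cases "(a, b) \<in> set (pairs xs)")
    case True
    then show ?thesis using Cons.IH by (intro list_emb_Cons)
  next
    case False
    then show ?thesis using Cons.prems by (auto simp: subseq_singleton_left)
  qed
qed simp

definition start_table :: "label list list \<Rightarrow> (label \<times> label) list \<Rightarrow> table" where
  "start_table xss ps = table_of (concat (map radial_facts xss) @ order_facts ps)"

section \<open>Refutations apply to hole-free cuts\<close>

fun idx :: "label \<Rightarrow> nat" where
  "idx p0 = 0" | "idx p1 = 1" | "idx p2 = 2" | "idx p3 = 3" | "idx p4 = 4" | "idx p5 = 5"
| "idx p6 = 6" | "idx p7 = 7" | "idx p8 = 8" | "idx p9 = 9" | "idx p10 = 10" | "idx p11 = 11"

definition tag :: "'a list \<Rightarrow> label \<Rightarrow> 'a" where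
  "tag xs l = xs ! idx l"

lemma hole_free_if_no_five_hole:
  assumes "signotope ccw xs" "distinct xs" "general_position (set xs)" "\<And>H. \<not> five_hole (set xs) H"
  shows "hole_free ccw xs"
  unfolding hole_free_def using five_hole_if_hole[OF assms(1-3)] assms(4) by blast

locale hole_free_cuts = hull_edge +
  assumes no_hole: "\<And>Z H. cut T Z \<Longrightarrow> card Z = 9 \<Longrightarrow> \<not> five_hole Z H"
begin

text \<open>Seen from the hull vertex \<open>w\<close>, the points come in the order \<open>r\<close>, then by increasing \<open>Y\<close>.\<close>
lemma radial_list:
  assumes "set zs \<subseteq> Q" "sorted_wrt (\<lambda>p q. Y p < Y q) zs"
  shows "distinct (w # r # zs)" "sorted_wrt (ccw w) (r # zs)" "signotope ccw (w # r # zs)"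
    "set (w # r # zs) \<subseteq> T"
proof -
  have "sorted_wrt (\<noteq>) zs"
    using assms(2) by (rule sorted_wrt_mono_rel[rotated]) auto
  then have "distinct zs"
    by (induction zs) auto
  then show d: "distinct (w # r # zs)"
    using assms(1) w_neq_r by (auto simp: Q_def)
  have "sorted_wrt (ccw w) zs"
    using assms(2) by (rule sorted_wrt_mono_rel[rotated]) (use assms(1) Y_less_iff in blast)
  then show s: "sorted_wrt (ccw w) (r # zs)"
    using assms(1) edge by (auto simp: Q_def)
  show T: "set (w # r # zs) \<subseteq> T"
    using assms(1) w_in r_in by (auto simp: Q_def)
  have "general_position (set (r # zs))"
    using T by (intro general_position_subset[OF gp]) simp
  then show "signotope ccw (w # r # zs)"
    using d s by (intro signotope_radial_Cons) simp_all
qed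

text \<open>Labels stand for distinct points within each list of \<open>xss\<close>, but labels of different lists may stand for
the same point. A tree for points in unknown mutual position thus covers the cases where some coincide.\<close>
lemma no_refutation:
  fixes g :: "label \<Rightarrow> real^2"
  assumes g: "g p0 = w" "g p1 = r"
    and xss: "\<forall>xs\<in>set xss. take 2 xs = [p0, p1] \<and> g ` set (drop 2 xs) \<subseteq> Q \<and>
      sorted_wrt (\<lambda>p q. Y p < Y q) (map g (drop 2 xs))"
    and yss: "\<forall>ys\<in>set yss. length ys = 9 \<and> (\<exists>xs\<in>set xss. subseq ys xs) \<and> cut T (g ` set ys)"
    and css: "\<forall>cs\<in>set css. \<exists>((a, b, c), v)\<in>set cs. ccw (g a) (g b) (g c) = v"
    and ps: "\<forall>(a, b)\<in>set ps. g a \<in> Q \<and> g b \<in> Q \<and> X (g a) < X (g b)"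
    and R: "refutes xss yss css (start_table xss ps) t"
  shows False
proof -
  let ?s = "\<lambda>a b c. ccw (g a) (g b) (g c)"
  have list: "distinct (map g xs) \<and> sorted_wrt (ccw w) (map g (tl xs)) \<and> signotope ccw (map g xs) \<and>
      set (map g xs) \<subseteq> T \<and> hd xs = p0" if xs: "xs \<in> set xss" for xs
  proof -
    define zs where "zs = drop 2 xs"
    have zs: "xs = p0 # p1 # zs" "g ` set zs \<subseteq> Q" "sorted_wrt (\<lambda>p q. Y p < Y q) (map g zs)"
      using bspec[OF xss xs] append_take_drop_id[of 2 xs] by (simp_all add: zs_def)
    have "set (map g zs) \<subseteq> Q"
      using zs(2) by simp
    note rl = radial_list[OF this zs(3)]
    have "map g xs = w # r # map g zs"
      unfolding zs(1) by (simp add: g)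
    moreover have "map g (tl xs) = r # map g zs" "hd xs = p0"
      unfolding zs(1) by (simp_all add: g)
    ultimately show ?thesis
      using rl by (simp only:)
  qed
  show False
  proof (rule refutes_sound[OF R, where s = ?s])
    show "signotope ?s xs" if "xs \<in> set xss" for xs
      using list[OF that] signotope_map[of ccw g xs] by simp
    show "hole_free ?s ys" if ys: "ys \<in> set yss" for ys
    proof -
      obtain xs where xs: "xs \<in> set xss" "subseq ys xs"
        using bspec[OF yss ys] by blast
      have sub: "subseq (map g ys) (map g xs)"
        using xs(2) by (rule subseq_map)
      have d: "distinct (map g ys)"
        using sub list[OF xs(1)] by (intro distinct_subseq[OF sub]) blast
      have "card (set (map g ys)) = 9"
        using d bspec[OF yss ys] by (simp only: distinct_card length_map)
      then have "\<not> five_hole (set (map g ys)) H" for H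
        using bspec[OF yss ys] by (intro no_hole) simp_all
      moreover have "general_position (set (map g ys))"
        using subseq_subset[OF sub] list[OF xs(1)] by (intro general_position_subset[OF gp]) blast
      moreover have "signotope ccw (map g ys)"
        using list[OF xs(1)] by (intro signotope_subseq[OF _ sub]) blast
      ultimately have "hole_free ccw (map g ys)"
        using d by (intro hole_free_if_no_five_hole)
      then show ?thesis
        using d hole_free_map[of ccw g ys] by (simp add: distinct_map)
    qed
    show "\<exists>((a, b, c), v)\<in>set cs. ?s a b c = v" if "cs \<in> set css" for cs
      using bspec[OF css that] .
    have "?s a b c = v" if "((a, b, c), v) \<in> set (radial_facts xs)" "xs \<in> set xss" for a b c v xs
    proof -
      have 1: "a = hd xs" "v" "subseq [b, c] (tl xs)"
        using that(1) by (auto simp: radial_facts_def dest: set_pairs)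
      have "sorted_wrt (ccw w) (map g [b, c])"
        using list[OF that(2)] subseq_map[OF 1(3), of g] sorted_wrt_subseq by blast
      then show ?thesis
        using 1 list[OF that(2)] g by simp
    qed
    moreover have "?s a b c = v" if fact: "((a, b, c), v) \<in> set (order_facts ps)" for a b c v
    proof -
      consider "a = p1" "(b, c) \<in> set ps" "\<not> v" | "a = p1" "(c, b) \<in> set ps" "v"
        using fact by (auto simp: order_facts_def)
      then show ?thesis
      proof cases
        case 1
        then show ?thesis
          using bspec[OF ps 1(2)] X_less_iff[of "g b" "g c"] X_less_iff[of "g c" "g b"] g by auto
      next
        case 2
        then show ?thesis
          using bspec[OF ps 2(2)] X_less_iff[of "g c" "g b"] g by auto
      qed
    qed
    ultimately show "agrees ?s (start_table xss ps)"
      unfolding start_table_def by (intro agrees_table_of) auto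
  qed
qed

end

section \<open>The refutation trees\<close>

text \<open>The trees were found by a search that branches on the triple whose two orientations force most others.
In a tree the labels \<open>p0\<close>, \<dots>, \<open>p11\<close> are written \<open>A\<close>, \<dots>, \<open>L\<close>; the nodes \<open>Br\<close>, \<open>Pr\<close>, \<open>Sg\<close>, \<open>Ho\<close>,
\<open>Cl 0\<close> are \<open>b\<close>, \<open>p\<close>, \<open>s\<close>, \<open>h\<close>, \<open>z\<close>; the four point sets assumed free of holes are \<open>t\<close> to \<open>w\<close>; and
\<open>i\<close> to \<open>r\<close> are the shapes of a pentagon. The bound variables of a spelled-out tree keep these one-letter
names local.\<close>
definition spell where
  "spell f = f Br Pr Sg Ho (Cl 0) (0::nat) (1::nat) (2::nat) (3::nat)
     Cup Cap UpB UpC UpD LowB LowC LowD p0 p1 p2 p3 p4 p5 p6 p7 p8 p9 p10 p11"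

definition tree_dominated :: refutation where
  "tree_dominated = spell (\<lambda>b p s h z t u v w i j k l m n q r A B C D E F G H I J K L.
b D E F(b C D E(h t i A C D E F)(b E F G(h t i A D E F G)(b B D E(p B C D E(h t i A B D E F))(b E F I(p E F G
I(b F H I(h t i A D E F I)(p E F H I(p F G H I(h t i A D E F H)))))(b E F H(p E F G H(h t i A D E F H))(b C E
F(b B E F(b D E G(b D E H(b D E I(b F G H(b D F G(h t i A D F G H)(b G H I(h t i A F G H I)(b D G H(b C F G(p
C D F G(h t i A C F G H))(b B F G(p B C F G(p B D F G(h t i A B F G H)))(b E H I(p E F H I(p E G H I(b D F H(h
t i A D F H I)(h t l D E F G H))))(b E G I(p E G H I(b F H I(b D F H(h t i A D F H I)(h t l D E F G H))(h t q
E F G H I)))(b B E G(b B E H(b B C E(p B C D E(p B C E F(b C D F(h t i A B C D F)(p C D F G(b C E G(h t q C D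
E F G)(p C E G I(p C E H I(b B D F(b D F H(h t i A B D F H)(p C D F H(b E G H(h t l D E F G H)(p C E G H(h t j
C E G H I)))))(h t l B C D E F)))))))))(p B C E G(p B C E H(b C D F(b B C D(h t i A B C D F)(b D F H(h t i A C
D F H)(b C D G(p C D G H(b C F H(b B C F(h t i A B C F H)(b F H I(h t i A C F H I)(p B C F G(p D F H I(b B E
I(b D G I(h t q D F G H I)(b B D G(p B D F G(h t q B C D F G))(p B D G I(p B C D I(p B D F I(p B D H I(h t q B
D E G I)))))))(p B C E I(p B D E I(p B E F I(p B E G I(p B E H I z))))))))))(h t l C D F G H)))(p B C D G(h t
r B C D E G)))))(p C D F G(h t q C D E F G))))))(p B D E H(p B E F H(p B E G H(p B E H I(p B G H I(p B D E I(p
B E F I(b B C I(p B C H I(h t n B C E H I)) z)))))))))(p B D E G(p B E G I(p B D E I(p B E F I(p B E H I(b B C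
I(p B C G I(h t n B C E G I)) z)))))))))))(p D F G H(p D G H I(p D F G I(h t n D E G H I)))))))(p E F G H(b D
F G(b C D F(h t i A C D F G)(b E H I(p E G H I(b F G I(h t i A D F G I)(p E F G I(h t r E F G H I))))(p E G H
I(b G H I(b D G H(h t i A D G H I)(b F G I(h t i A D F G I)(b B C D(b C D G(h t i A B C D G)(p C D G H(b B D
F(h t i A B D F G)(b B E I(p B E G I(p B E H I(b B C E(p B C E F(h t l B C D E F))(p B C E G(p B C E H(p B C E
I(b C F H(p C F G H(h t q C D F G H))(b D F H(b F H I(p D F H I(b D G I(b B D G(h t i A B D G I)(p B D G H(b B
F H(p B C F H(p B F G H(p B C G H(h t q B D F G H))))(b C F G(b B C F(p B C F G(h t l B C D F G))(p B C F H(h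
t q B C E F H)))(h t n C E F G H)))))(h t l D F G H I)))(p C F H I(p C D F I(p C F G I(h t n C E F H I)))))(h
t q C D E F H)))))))))(p B D E I(p B E F I(p B E G I(p B E H I(b B C I(p B C E I(p B C F I(h t l B C D E F)))
z)))))))))(p B C D F(h t r B C D E F)))))(h t j E F G H I)))))(p D F G H(h t n D E F G H)))))(p B D E I(p D E
G I(p D E H I(p B E F I(p B D G I(p B D H I(b B C I(p B C E I(h t n B C D E I)) z))))))))(p B D E H(p D E G
H(p B E F H(p B D G H(b B H I(p B D H I(p B E H I(p B F H I(p B G H I(b B C H(p B C E H(h t n B C D E H))(p B
C H I(b B C D(b C D F(h t i A B C D F)(b F G I(b D F G(h t i A D F G I)(p C D F G(b B F G(p B C F G(p B D F
G(h t i A B F G I)))(b C D I(p C D E I(p C D F I(p C D G I(h t i A B C D I))))(b D E I(b C E G(h t q C D E F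
G)(b E G I(p D E G I(b D F I(b B D F(h t i A B D F I)(p B D F G(b B C E(p B C E F(h t l B C D E F))(p B C E
G(h t j B C E G H)))))(h t l D E F G I)))(p C E G I(p C E F I(h t r C E G H I)))))(p C D E I(p D E G I(p C E F
I(p C D G I(h t r C D E H I))))))))))(p E F G I(h t r E F G H I))))(p B C D E(h t j B C D E H)))))))))(p B D H
I(p B E H I(p B F H I(p B G H I(b B C I(p B C E I(p B C H I(h t n B C D E H))) z)))))))))))(p B D E G(p C D E
G(p D E F G(p B E F G(p C E F G(b D G H(p D E G H(p D F G H(b G H I(h t i A F G H I)(b B G I(p B D G I(p B E G
I(p B F G I(p B G H I(b B C G(p B C E G(h t n B C D E G))(p B C G H(p B C G I(b B C D(b C D F(h t i A B C D
F)(b F H I(b D F H(h t i A D F H I)(p C D F H(b C E H(h t q C D E F H)(b D E H(b E H I(p D E H I(b D F I(b B D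
F(h t i A B D F I)(p B D F H(b B C E(p B C E F(h t l B C D E F))(p B C E H(h t r B C E G H)))))(h t l D E F H
I)))(p C E H I(p C D E I(p C E F I(h t q C E G H I)))))(h t r C D E G H)))))(p E F H I(h t q E F G H I))))(p B
C D E(h t j B C D E G))))))))))(p B D G I(p B E G I(p B F G I(p B G H I(b B C I(p B C E I(p B C G I(h t n B C
D E G))) z)))))))))(p C D G H(p C E G H(p C F G H(b E G H(p E F G H(b G H I(h t i A F G H I)(p C G H I(h t j C
D G H I))))(h t j C D E G H))))))))))))(p B C E F(p B D E F(p B E F G(p B E F H(p B E F I(p B C E G(p B D E
G(p B C E H(p B D E H(p B C E I(p B D E I(b B G H(h t r B E F G H)(b F G H(b G H I(h t i A F G H I)(p B G H I
z))(h t j B E F G H)))))))))))))))(p C D E F(p C E F G(p C E F H(p C E F I(p C D E G(p C D E H(p C D E I(b C G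
H(h t r C E F G H)(b F G H(b D F G(h t i A D F G H)(b G H I(h t i A F G H I)(p C G H I(b E G H(b B C I(p B C D
I(p B C E I(p B C F I(p B C G I(b D E G(p D E G H(b D F H(b B D F(h t i A B D F H)(b F H I(h t i A D F H I)(p
B D F G(p E F H I(b E G I(h t q E F G H I)(b B E G(p B E F G(h t q B D E F G))(p B E G I(p B D E I(p B E F I(p
B E H I(h t n B C E G I)))))))))))(h t l D E F G H)))(p B D E G(p B D F G(h t n B C D E G))))))))(p B C D I(p
B C E I(p B C F I(p B C G I(p B C H I z))))))(h t j C E G H I)))))(h t j C E F G H))))))))))))))))(b D E G(p D
E F G(b F G H(h t i A E F G H)(b C D E(h t i A C D E G)(b E G H(h t i A D E G H)(p C D E F(b B C D(b C D G(h t
i A B C D G)(b B D E(h t i A B D E G)(p B D E F(b E G I(p E G H I(h t i A D E G I))(p E F G I(b C D I(p C D E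
I(p C D F I(p C D G I(b D H I(h t i A B C D I)(p C D H I(p D E H I(p D F H I(p D G H I(h t i A B C D
H)))))))))(b B C F(p B C E F(h t n B C D E F))(b C F I(p C D F I(p C E F I(p C F G I(b G H I(b D G H(h t i A D
G H I)(p C D G H(b C F H(p C D F H(p C E F H(b B F I(p B F G I(b F H I(p E F H I(h t l E F G H I))(p B F H I(b
C E H(p C E G H(h t q C D E G H))(b D E H(b E H I(p D E H I(b D G I(b B D G(h t i A B D G I)(p B D G H(b B C
E(b B E G(p B C E G(b C E G(h t l B C D E G)(h t q C E F G H)))(p B C E G(h t q C E F G H)))(p B C E H(h t r B
C E F H)))))(h t l D E G H I)))(p C E H I(p C E G I(h t q C E F H I))))(h t r C D E F H))))))(p B C F I(p B D
F I(p B E F I(p B F G I(b B H I(p B E H I(p B F H I(h t l E F G H I))) z))))))))(p C E F H(p C F H I(p C E H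
I(b E F H(h t l E F G H I)(h t j C D E F H))))))))(p E G H I(p E F H I(h t n E F G H I)))))))(p B C F I(p B C
D I(p B E F I(p B F G I(b B H I(h t r B C F H I) z)))))))))))))(p B C D E(p B C E F(h t j B C D E F)))))))))(b
C D E(b B C D(h t i A B C D E)(b D E H(p D E F H(p D E G H(h t i A C D E H)))(b D E I(p D E F I(p D E G I(p D
E H I(h t i A C D E I))))(b B D E(b E F G(b C E F(h t i A C E F G)(b F G H(h t i A E F G H)(b B E F(p B C E
F(h t i A B E F G))(b F G I(p F G H I(h t i A E F G I))(b E G H(p E F G H(b C E G(h t i A C E G H)(b G H I(h t
i A E G H I)(p F G H I(b D F G(b C D F(p C D F G(h t l C D E F G))(p B C D F(b B F I(p B C F I(p B D F I(p B F
G I(p C F G I(p C F H I(p D F H I(b B E G(p B C E G(h t i A B E G H))(b C D G(b D G H(p C D G H(b C E H(b B C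
E(h t i A B C E H)(b E H I(h t i A C E H I)(p B C E G(p D E H I(b D G I(h t q D E G H I)(b B D G(h t q B C D E
G)(p B D G I(p B C D I(p B D E I(p B D H I(h t q B D F G I)))))))))))(h t l C D E G H)))(p D G H I(h t n D F G
H I)))(p B C D G(h t r B C D F G))))))))))(p B C F I(p B D F I(p B E F I(p B F G I(p B F H I z))))))))(p D F G
H(p D F H I(h t j D F G H I))))))))(p D E G H(b D F H(p D F G H(h t q D E F G H))(b C D F(b C D G(b D G I(p C
D G I(p D E G I(p D F G I(p D G H I(p C F G I(b C E G(h t i A C E G I)(h t l C D E F G)))))))(b C D I(b D F
I(p C D F I(p D F G I(p D F H I(p C F G I(p D G H I(b E G I(b C E G(h t i A C E G I)(h t l C D E F G))(h t q D
E F G I)))))))(b B D F(b B C E(b C E G(h t i A B C E G)(p C E G H(b D F G(p C D F G(h t l C D E F G))(b D H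
I(h t r D F G H I)(p C D H I(b G H I(b B D I(p B D G I(p B D H I(b C F H(p C F G H(h t q C E F G H))(b E F H(b
F H I(p E F H I(b E G I(b B E G(h t i A B E G I)(p B E G H(b B F H(p B C F H(p B F G H(p B C G H(h t q B E F G
H))))(b C F G(b B C F(p B C F G(h t l B C E F G))(p B C F H(h t q B C D F H)))(h t n C D F G H)))))(h t l E F
G H I)))(p C F H I(p C E F I(p C F G I(h t n C D F H I)))))(h t n C D E F H)))))(p B C D I(p B D E I(p B D F
I(p B D G I(p B D H I z))))))(h t j D F G H I)))))))(p B C E F(h t q B C D E F)))(p B C D F(p B D F I(p B C D
I(p B D E I(p B D G I(b B H I(h t r B D F H I) z))))))))(p B C D I(p C D F I(p B D E I(p B D G I(p B C F I(b B
H I(h t r B C D H I) z))))))))(p B C D G(p C D F G(p B D E G(p B D G H(p B C F G(h t j B C D G H)))))))(p B C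
D F(p B D F H(h t j B C D F H)))))))))))(p D E F G(b E G H(p E F G H(b G H I(h t i A F G H I)(b B F G(p B D F
G(p B E F G(p B C D F(b B C F(h t i A B F G H)(p B C E F(p B C F G(h t i A C F G H)))))))(b F G I(b C D F(b C
F G(p C E F G(h t i A C F G H))(b C D H(b C D I(b C G H(b D G I(p D G H I(b D F H(p C D F H(p D E F H(b C E
F(h t i A C E F H)(b F H I(h t i A E F H I)(b C E H(b B C E(h t i A B C E H)(b E H I(h t i A C E H I)(p B C E
F(p D E H I(b D F I(h t q D E F H I)(b B D F(h t q B C D E F)(p B D F I(p B C D I(p B D E I(p B D H I(b B G
I(h t r B D F G I) z)))))))))))(h t l C D E F H))))))(b E F H(b F H I(h t i A E F H I)(p D F H I(h t q D F G H
I)))(h t r D E F G H))))(p C D G I(p D F G I(p D G H I(b B D I(p B D F I(p B D G I(b C E F(b B C E(h t i A B C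
E F)(b E F H(h t i A C E F H)(b C E G(p C E G H(b C F H(b B C F(h t i A B C F H)(b F H I(h t i A C F H I)(p B
C F G(p E F H I(b E G I(h t q E F G H I)(b B E G(p B E F G(h t q B C E F G))(p B E G I(p B C E I(p B E F I(p B
E H I(h t n B D E G I)))))))))))(h t l C E F G H)))(p B C E G(h t q B C D E G)))))(p C E F G(h t n C D E F
G)))))(p B C D I(p B D E I(p B D F I(p B D G I(p B D H I z))))))))))(p C E G H(p C F G H(p C G H I(p C E G I(p
C F G I(h t n C D G H I)))))))(p B C D I(p C D F I(p C D H I(p B D E I(p B C F I(p B C H I(b B G I(h t r B C D
G I) z))))))))(p B C D H(p C D F H(p B D E H(p B C F H(p B E G H(b B G H(h t r B C D G H)(p B G H I(p B E G
I(p B F G I(p B C H I(p B D H I z)))))))))))))(p B C D F(p B D E F(h t j B C D F G))))(p D F G I(h t j D E F G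
I))))))(p D E G H(p D F G H(b F G H(b G H I(h t i A F G H I)(p D G H I(h t j D E G H I)))(h t j D E F G
H)))))))(p B C D E(p B D E F(p B D E G(p B D E I(p B C D F(p B C D G(p B C D I(b B F G(h t r B D E F G)(b E F
G(b F G H(h t i A E F G H)(p B F G H(b B G I(p B F G I(p B G H I(h t i A E F G I)))(p B F G I(b B H I(p B G H
I(b F G I(h t i A E F G I)(h t r B F G H I))) z)))))(h t j B D E F G))))))))))))))(p C D E F(p C D E G(b C F
G(h t r C D E F G)(b E F G(b F G H(h t i A E F G H)(p C F G H(p C D F H(p C E F H(b E F H(b D F G(b F H I(p E
F H I(p F G H I(b E G H(h t i A E G H I)(p D E G H(b F G I(h t i A E F G I)(p C F G I(p C D F I(p C E F I(b B
C I(p B C D I(p B C E I(p B C F I(p B C G I(b B E G(p B D E G(b E G I(h t i A B E G I)(h t l E F G H I)))(p B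
E F G(p B E G H(b C H I(h t r C F G H I)(p B C H I(b D F H(h t q D E F G H)(b B D F(p B D F G(h t l B D E F
G))(p B D F H(h t n B C D F H)))))))))))))(p B C D I(p B C E I(p B C F I(p B C G I(b B H I(p B C H I(h t r C F
G H I)) z))))))))))))))(p C F H I(b D F H(b G H I(b E G H(h t i A E G H I)(p D E G H(h t q D E F G H)))(h t j
C F G H I))(h t j C D F H I))))(h t j C D F G H))(h t j C D E F H))))))(h t j C D E F G))))))))"

text \<open>Nine points around the hull vertex \<open>p0\<close>: without a hole, all of \<open>p2\<close>, \<dots>, \<open>p7\<close> lie in the triangle of
\<open>p0\<close>, \<open>p1\<close> and \<open>p8\<close>. The clause assumes the contrary.\<close>
lemma refutes_dominated:
  "refutes [[p0, p1, p2, p3, p4, p5, p6, p7, p8]]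
    [[p0, p1, p2, p3, p4, p5, p6, p7, p8]]
    [[((p1, p2, p8), True), ((p1, p3, p8), True), ((p1, p4, p8), True), ((p1, p5, p8), True), ((p1, p6, p8), True), ((p1, p7, p8), True)]]
    (start_table [[p0, p1, p2, p3, p4, p5, p6, p7, p8]]
      ([])) tree_dominated"
  by code_simp

definition tree_common_successors :: refutation where
  "tree_common_successors = spell (\<lambda>b p s h z t u v w i j k l m n q r A B C D E F G H I J K L.
b E F G(b D E F(h t i A D E F G)(b F G H(h t i A E F G H)(b C E F(p C D E F(h t i A C E F G))(b F G J(p F G H
J(b G I J(h w i A E F G J)(p F G I J(p G H I J(h t i A E F G I)))))(b F G I(p F G H I(h t i A E F G I))(b B E
F(p B C E F(p B D E F(h t i A B E F G)))(b C D E(b B C D(h t i A B C D E)(b D E G(h t i A C D E G)(b D E I(p D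
E F I(p D E G I(b E H I(h t i A C D E I)(p D E H I(p E F H I(p E G H I(h t i A C D E H)))))))(b D E H(p D E F
H(p D E G H(h t i A C D E H)))(b D E J(p D E F J(p D E G J(p D E H J(p D E I J(h w i A C D E J)))))(b C F H(p
C E F H(p C F G H(b B C F(p B C D F(p B C E F(p B C F H(p B D F I(p C D F G(b C E G(h t i A B C E G)(p B C D
H(p B F H I(p D F G I(p B D H I(b D F G(h t l C D E F G)(p D F G H(b G H I(b H I J(h w i A G H I J)(p D H I
J(h u j D F H I J)))(h t j D F G H I))))))))))))))(b D F H(p D F G H(b E G H(b C E G(h t i A C E G H)(b G H
I(h t i A E G H I)(p F G H I(b F I J(p F H I J(b G H J(h w i A E G H J)(p F G H J(h u r F G H I J))))(p F H I
J(b H I J(b E H I(h w i A E H I J)(p D E H I(b G H J(h w i A E G H J)(b C D F(p C D F G(h t l C D E F G))(p B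
C D F(b D F I(b C F I(b D F J(p D E F I(p D E F J(b D G I(p D G H I(h t q D E G H I))(b E G I(b G I J(p E G I
J(b E H J(b C E H(h w i A C E H J)(p C E H I(b C G I(p C D G I(p C G H I(p C D H I(h t q C E G H I))))(b D G
H(b C D G(p C D G H(h t l C D E G H))(p C D G I(h t q C D F G I)))(h t n D F G H I)))))(h u l E G H I J)))(p D
G I J(p D G H J(h u n D F G I J))))(h t q D E F G I)))))(h u j B C D F J))(h u j B C F I J))(h t j B C D F
I)))))))(h u j F G H I J)))))))(p D E G H(h t q D E F G H))))(p C D F H(p D F G H(p C D F G(b E G H(b C E G(h
t i A C E G H)(b G H I(h t i A E G H I)(p D G H I(b D F G(h t l C D E F G)(h t j D F G H I)))))(b C E G(b B C
E(h t i A B C E G)(b B D F(p B D E F(h t q B C D E F))(p B D F H(p B C D H(p B D E H(p B D G H(b F H I(p E F H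
I(p F G H I(b E G I(h t i A C E G I)(h t l E F G H I))))(h t j B D F H I))))))))(p C E G H(h t q C E F G
H)))))))))))(p C E F H(p C F G H(b C D F(p C D F H(p D F G H(b D G I(p D E G I(p D F G I(p D G H I(p C D F G(b
C E G(h t i A C E G I)(h t l C D E F G))))))(b D F I(p C D F I(p D F G I(p D F H I(p C D G I(p C F G I(p D G H
I(b E G I(b C E G(h t i A C E G I)(h t l C D E F G))(h t q D E F G I))))))))(b D G J(p D E G J(p D F G J(p D G
H J(p D G I J(p C D F G(b C E G(h w i A C E G J)(h t l C D E F G)))))))(b C D G(b D F J(p C D F J(p D F G J(p
D F H J(p D F I J(p C F G J(p D G H J(p D G I J(b E G J(b C E G(h w i A C E G J)(h t l C D E F G))(h u q D E F
G J)))))))))(b F H I(p B F H I(p F G H I(p B E F H(p B F G H(b E G H(h t i A E G H I)(b H I J(h w i A G H I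
J)(b E H I(b C F J(p C D F J(p C E F J(p C F G J(p C F H J(p C E H J(p C G H J(b G I J(b E G I(h w i A E G I
J)(b D H J(p D H I J(b E F I(b F I J(p E F I J(b C E G(b E G J(h w i A C E G J)(h u l E F G I J))(b D F G(h t
l C D E F G)(h t r D F G H I))))(p D F I J(h u q D F H I J)))(h t r D E F H I)))(p C D H J(b E F H(p E F H I(h
t l E F G H I))(h t n C D E F H)))))(p F G I J(h u q F G H I J)))))))))(p C E F J(b C D H(b E F H(p E F H I(b
E G I(p B E G I(b C E G(h t i A C E G I)(b C F G(b D F G(h t l C D E F G)(b B D H(p B D F H(p B D G H(b B C
F(p B C F G(h t l B C E F G))(p B C F H(h t q B C D F H)))))(p B C D H(b D H I(h t r D F G H I)(h u j B D H I
J)))))(h t n C D F G H))))(h t l E F G H I)))(h t n C D E F H))(p B C D H(b D H I(b D H J(p D E H J(b E F I(b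
F I J(p E F I J(p F G I J(b E G I(h w i A E G I J)(b E G J(p C E G J(b C F G(b D F G(h t l C D E F G)(h t r D
F G H I))(p C D F G(h t r D F G H I))))(h u l E F G I J)))))(p D F I J(h u q D F H I J)))(h t r D E F H I)))(h
u j B C D H J))(h t j B C D H I))))))(p D E H I(p E F H I(p D H I J(h u j D E H I J)))))))))))(p C F H I(p D F
H I(p C E F I(p C F G I(b E F H(b C D I(p C D H I(h t n C D F H I))(b D I J(p D E I J(p D G I J(p D H I J(b G
H I(h w i A G H I J)(b F H J(p E F H J(p F G H J(b E G H(h w i A E G H J)(b E G J(b C E G(h w i A C E G J)(b C
F G(b D F G(h t l C D E F G)(h t j D F G H I))(p C D F G(h t j D F G H I))))(h u l E F G H J)))))(p D F H J(h
u r D F H I J)))))))(h u j B C D I J)))(h t j D E F H I))))))))(p B C D G(p C D F G(p B C G H(p B D E G(p B C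
F G(h t j B C D G H))))))))))))(p B C D F(p C D F H(p B C F H(p B C D H(p B C E H(p B C G H(b D F H(b F H I(p
D F G H(p F G H I(b E G H(h t i A E G H I)(p D E G H(h t q D E F G H)))))(h t j B C F H I))(h t j B C D F
H)))))))))))))))))(p C D E F(b B C D(p B C D I(b C D H(p C D E H(p C D F H(p D F G H(b D G H(h t i A B C D
H)(p C D G H(p D E G H(h t i A B C D G)))))))(b E F I(b C D G(p C D E G(p C D F G(h t i A B C D G)))(b E F H(b
E F J(b D F G(b B C F(p B C E F(p B C F I(p B C E I(p C F G I(b B D E(p B D E I(b D E G(h t i A B D E G)(p C D
E G(b C F G(h t r C D E F G)(p C F G H(p C E F H(b F H I(p E F H I(p F G H I(p D E H I(b E G H(h t i A E G H
I)(b H I J(h w i A G H I J)(p D E G H(b G I J(b E G I(h w i A E G I J)(h t l E F G H I))(p F G I J(b F H J(h u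
q F G H I J)(p C F H J(b D F H(h t q D E F G H)(h u j C D F H J))))))))))))(p C F H I(b G H I(b H I J(h w i A
G H I J)(p C H I J(h u j C F H I J)))(h t j C F G H I))))))))))(p B D E F(h t n B C D E F)))))))(p B C D F(b C
F G(b D E G(b B D E(h t i A B D E G)(b E G H(h t i A D E G H)(b E H I(p B E H I(p E G H I(p B D E H(p B E G
H(b D G H(h t i A D G H I)(b H I J(h w i A G H I J)(p C D G H(b E G I(h t i A D E G I)(b F H I(h t l E F G H
I)(p F H I J(b C F I(p C D F I(p C F H I(p D F H I(b C E H(p C E G H(h t q C D E G H))(b D E H(p D E H I(b D G
I(p B D G I(b B F H(p B F G H(b B C E(b B E G(p B C E G(b C E G(h t l B C D E G)(h t q C E F G H)))(p B C E
G(h t q C E F G H)))(p B C E H(h t r B C E F H))))(p B C F H(h u j B F H I J))))(h t l D E G H I)))(h t r C D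
E F H))))))(h u j B C F I J))))))))))))(p E G H I(b G H I(b H I J(h w i A G H I J)(p E H I J(p E G H J(h u n E
F H I J))))(h t n E F G H I))))))(p C D E G(h t r C D E F G)))(p B C F G(p B C D G(p B E F G(p B F G H(h t j B
C F G H))))))))(p C D F G(p C E F G(p C F G H(h t j C D F G H)))))(p C E F J(p E F H J(p E F I J(h u j C D E F
J)))))(p C E F H(h t j C D E F H))))(p C E F I(b F H I(p C F H I(p E F H I(h t j C D E F H)))(h t j C D E F
I))))))(p B C D E(h t j B C D E F)))))))))))(b E F H(p E F G H(b G H I(h t i A F G H I)(b D E F(h t i A D E F
H)(b F H I(h t i A E F H I)(p D E F G(b C D E(b B C D(h t i A B C D E)(b D E H(h t i A C D E H)(b C E F(h t i
A C E F H)(p C E F G(b C D G(p C D F G(h t n C D E F G))(p B C D G(p B C E G(p B C F G(b D G I(p D E G I(p D F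
G I(p D G H I(b H I J(b E H I(h w i A E H I J)(p D E H I(b F H J(h w i A E F H J)(b G H J(h w i A F G H J)(b G
I J(p F G I J(h u l F G H I J))(b C G I(p C G H I(b D G J(p D E G J(b D F I(p D F H I(h t q D E F H I))(b E F
I(p B E F I(b F I J(p E F I J(b E H J(b C E H(h w i A C E H J)(b D F H(b B D F(p B C D F(p C D F H(h t l C D E
F H)))(p B C D F(b C D F(p C D F H(h t l C D E F H))(h t j B C D F G))))(h t q D F G H I)))(h u l E F H I
J)))(p D F I J(p D E F J(p D F H J(h u q D F G I J))))))(h t r D E F G I))))(h u j B C D G J)))(h u j B C G I
J)))))))(p F H I J(p G H I J(b D G J(p D F G J(h u n F G H I J))(h u j B C D G J))))))))(h t j B C D G
I))))))))))(p C D E F(p C D F G(h t j C D E F G)))))))))(b E F I(p E F G I(p E F H I(b D E F(h t i A D E F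
I)(b F I J(h w i A E F I J)(p D E F G(p D E F H(p F G I J(p F H I J(b D G H(h t r D E F G H)(b F G H(b G H I(h
t i A F G H I)(p D G H I(p D E G I(p D F G I(p D G I J(h u j D G H I J))))))(h t j D E F G H)))))))))))(b D E
F(b C D E(h t i A C D E F)(b E F J(p E F G J(p E F H J(p E F I J(h w i A D E F J))))(b B D E(p B C D E(h t i A
B D E F))(b C E F(b B E H(p B D E H(p B E F H(p B E H I(p B E H J(b B E G(p B D E G(p B E G I(p B E G J(b F G
H(b D F G(h t i A D F G H)(b G H I(h t i A F G H I)(b C F G(p C D F G(h t i A C F G H))(b B F G(p B C F G(p B
D F G(h t i A B F G H)))(b G H J(p G H I J(h w i A F G H J))(b B C D(b C D F(h t i A B C D F)(p C D F G(b C E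
G(h t q C D E F G)(p B C E G(p C E G I(p B C E F(p C E H I(b B D F(b D F H(h t i A B D F H)(p C D F H(b C G
H(p C D G H(p C E G H(h t l D E F G H)))(p C E G H(b E G H(p D E G H(h t l D E F G H))(h t j C E G H I))))))(h
t l B C D E F)))))))))(p B C D E(p B C E G(p B C E H(b D E I(b B D F(p B C D F(p B D F I(p B D F J(b D F H(h t
i A C D F H)(b D G H(b E G H(h t l D E F G H)(b C D G(p C D G H(b E I J(h u r E G H I J)(b D E J(b H I J(b F H
I(h w i A F H I J)(p D F H I(b C F H(b F H J(h w i A C F H J)(p D F H J(b D G I(h t q D F G H I)(b F G I(b D I
J(p D F I J(p D G I J(p F G I J(h u l F G H I J))))(p D G I J(b G I J(p F G I J(h u l F G H I J))(h u n D E G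
I J))))(h t n D E F G I)))))(h t l C D F G H))))(h u j E G H I J))(h u j B C D E J))))(p B C D G(h t r B C D E
G))))(p D G H I(h t n D E G H I)))))))(p B C D F(p B D F G(p B C F G(h t q B D E F G)))))(h t j B C D E
I)))))))))))(p E F G H(b G H I(p B G H I(b H I J(h w i A G H I J)(p E H I J(b F H I(p B F H I(b D F G(b C D
F(h t i A C D F G)(b D G H(h t i A D G H I)(b B C D(b C D G(h t i A B C D G)(p C D G H(b B D F(h t i A B D F
G)(p B D F H(b B C F(p B C F H(b B C E(h t l B C D E F)(p B C E G(p B C E H(b C E I(b D F H(p C D E I(p D F H
I(b D G I(p B D G I(b B F G(p B C F G(b C F G(h t l B C D F G)(h t n C E F G H)))(p B C F G(h t n C E F G
H))))(h t l D F G H I))))(h t q C D E F H))(h u j B C E I J))))))(p B C E F(p B C F H(p B C E G(p B C E H(b C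
F H(p C F G H(h t q C D F G H))(h t q B C E F H)))))))))))(p B C D F(h t r B C D E F)))))(p D F G H(h t n D E
F G H))))(h u j E F H I J)))))(h t j E F G H I)))))))(p B D E G(p B E F G(p B E G H(p B D G H(p B F G H(p B G
H I(p B G H J(b D F G(h t i A D F G H)(b C D F(b B C D(h t i A B C D F)(b D F H(h t i A C D F H)(p B C D E(b D
E G(h t l D E F G H)(h t j B C D E G)))))(p C D F G(b B C D(b C E G(h t q C D E F G)(b B C E(p B C E F(b B D
F(b D F H(h t i A B D F H)(b E G I(b F H I(b H I J(h w i A F H I J)(p E H I J(p G H I J(b E G J(h u n E G H I
J)(p C E G J(b D E G(h t l D E F G H)(h u j C D E G J)))))))(h t q E F G H I))(p C E G I(b D E G(h t l D E F G
H)(h t j C D E G I)))))(h t l B C D E F)))(p B C E G(p B C E H(p B C G H(b E G I(b F H I(b D F H(h t i A D F H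
I)(p C D F H(h t q C D E F H)))(h t q E F G H I))(h t j B C E G I)))))))(p B C D F(h t r B C D E
F))))))))))))))))))(p B D E H(p B E F H(b B C E(p B C D E(p B C E F(p B C E H(p B C E I(p B C D H(p B C D I(b
C D F(h t i A B C D F)(p B C F H(p B C F I(b B D F(p B D F H(p B D F I(b D F G(h t i A B D F G)(p C D F G(b C
E G(h t q C D E F G)(b E G H(p B E G H(p E F G H(p B D E G(p B E F G(b G H I(h t i A F G H I)(b E G I(b F H
I(b H I J(h w i A F H I J)(p G H I J(b B C G(b D E G(p D E G H(h t l D E F G H))(h t n B C D E G))(b C G I(p C
D G I(p C G H I(p D G H I(b D E H(b C H I(p C D H I(p C E H I(p D E H I(h t l D E F H I))))(b E H I(p D E H
I(h t l D E F H I))(h t q C E G H I)))(h t r C D E G H)))))(h u j B C G I J)))))(p E F H I(h t q E F G H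
I)))(p C E G I(b D E G(p D E G H(h t l D E F G H))(h t j C D E G I)))))))))(p B E G H(p C E G H(b D E G(b E H
I(p E G H I(b F G H(h t i A F G H I)(b H I J(h w i A G H I J)(p D F G H(b E G I(p D E G I(p D E H I(h t l D E
F G I)))(p C E G I(b B C H(b D E H(h t n D E F G H)(h t n B C D E H))(b C H I(h t r C E G H I)(h u j B C H I
J)))))))))(p C E H I(p C G H I(b G H I(b H I J(h w i A G H I J)(p C H I J(h u j C E H I J)))(h t j C E G H
I)))))(h t j C D E G H))))))))))(h t l B C D E F)))))))))))(p B C E H(b F G H(p B F G H(b D F G(h t i A D F G
H)(b G H I(h t i A F G H I)(b C F G(p C D F G(h t i A C F G H))(b G H J(p G H I J(h w i A F G H J))(b B E G(p
B C E G(p B D E G(p B E G H(p B E G I(p B E G J(p E G H I(p E G H J(b C E H(b H I J(p C D E H(b F H I(h w i A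
F H I J)(b C D F(b B C D(h t i A B C D F)(b D F H(h t i A C D F H)(p D F H I(b D E I(b D G H(p B D G H(p B C D
G(b C D G(p C D G H(b C F H(b F H J(h w i A C F H J)(p D F H J(b E I J(h u r E G H I J)(b D E J(b D G I(h t q
D F G H I)(b F G I(b D I J(p D F I J(p D G I J(p F G I J(h u l F G H I J))))(p D G I J(b G I J(p F G I J(h u l
F G H I J))(h u n D E G I J))))(h t n D E F G I)))(h u j B C D E J)))))(h t l C D F G H)))(h t r B C D E
G))))(p D G H I(h t n D E G H I)))(h t j B C D E I)))))(p C D F G(h t q C D E F G)))))(h u j B E H I J))(h t j
B C E H I)))))))))(p B C E G(p B D E G(b D G H(b C D F(b B C D(h t i A B C D F)(b D F H(h t i A C D F H)(b D E
G(p D E G H(b E G H(h t l D E F G H)(p B E G H(h t j B E G H I))))(h t j B C D E G))))(p C D F G(b C E G(h t q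
C D E F G)(b E G I(p E G H I(b F H I(b D F H(h t i A D F H I)(b H I J(h w i A F H I J)(p C D F H(p G H I J(b C
G I(p C G H I(b B G H(b C E H(h t q C D E F H)(h t r B C E G H))(h u j B G H I J)))(h u j B C G I J))))))(p E
F H I(h t q E F G H I))))(h t j B C E G I)))))(p B D G H(b E G H(p D E G H(p C D E G(p C D G H(h t j B C G H
I))))(h t j B E G H I))))))))))))(p B F G H(p E F G H(b G H I(b H I J(h w i A G H I J)(b E H I(b F G I(p B F G
I(b D F G(h t i A D F G I)(p D F G H(b C D F(b B C D(h t i A B C D F)(b D E H(p D E G H(h t n D E F G H))(h t
j B C D E H)))(p C D F G(b B E G(p B C E G(h t q C D E F G))(p B C E G(p B D E G(b C E G(h t q C D E F G)(h t
j B C E G H))))))))))(p E F G I(h t r E F G H I)))(h u j B E H I J)))(p E G H I(h t j E F G H I)))))))))))(p C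
D E F(p C E F G(p C E F H(p C E F I(p C D E G(p C D E H(p C D E I(b C G H(h t r C E F G H)(b F G H(b D F G(h t
i A D F G H)(b G H I(h t i A F G H I)(p C G H I(b F G I(b E G H(b G I J(p F G I J(p G H I J(b F H I(h w i A F
H I J)(p E F H I(b E G I(h t q E F G H I)(b D E G(p D E G H(b D F H(b F H J(h w i A D F H J)(h u l F G H I
J))(h t l D E F G H)))(h t j C D E G I)))))))(p C G I J(b E G I(b H I J(b F H I(h w i A F H I J)(p E F H I(h t
q E F G H I)))(h u j C G H I J))(h u j C E G I J))))(h t j C E G H I))(h t j C E F G I)))))(h t j C E F G
H))))))))))))))(p D E F G(p D E F H(p D E F I(b D G H(h t r D E F G H)(b F G H(b G H I(h t i A F G H I)(p D G
H I(b F G I(b E G H(p B F G I(b G I J(p F G I J(p G H I J(b F H I(h w i A F H I J)(b G H J(h w i A F G H J)(p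
D G H J(p D E G J(p D F G J(b C F H(p C D F H(p C E F H(b F H J(h w i A C F H J)(h u l F G H I J))))(p C F G
H(p C F H I(b C D G(p C D E G(p C D F G(b B C D(h t i A B C D E)(b B D G(p B D E G(b C D I(p C D H I(b C E F(b
B C E(h t i A B C E F)(b B E G(p B C E G(p C E G H(h t l C E F G H)))(p B C E G(b C E G(p C E G H(h t l C E F
G H))(h t q B C D E G)))))(p C E F G(h t n C D E F G))))(b D I J(h u r D G H I J)(h u j B C D I J))))(p B C D
G(p B D E G(p B D G H(p B C D H(p B D E H(p B D F H(h t j B D G H I)))))))))))(p C D E G(p C D G H(p C D E H(h
t j C D G H I)))))))))))))))(p D G I J(b E G I(b H I J(b F H I(h w i A F H I J)(p E F H I(h t q E F G H I)))(h
u j D G H I J))(h u j D E G I J)))))(h t j D E G H I))(h t j D E F G I))))(h t j D E F G H))))))))))"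

text \<open>Here \<open>p2\<close>, \<dots>, \<open>p7\<close> are the six lowest points, \<open>p8\<close> is the next one and \<open>p9\<close> the one after it, in both orders.\<close>
lemma refutes_common_successors:
  "refutes [[p0, p1, p2, p3, p4, p5, p6, p7, p8, p9]]
    [[p0, p1, p2, p3, p4, p5, p6, p7, p8],
     [p1, p2, p3, p4, p5, p6, p7, p8, p9],
     [p0, p1, p2, p3, p4, p5, p6, p7, p8],
     [p0, p2, p3, p4, p5, p6, p7, p8, p9]]
    []
    (start_table [[p0, p1, p2, p3, p4, p5, p6, p7, p8, p9]]
      (List.product [p2, p3, p4, p5, p6, p7] [p8, p9] @ [(p8, p9)])) tree_common_successors"
  by code_simp

definition tree_common_apex :: refutation where
  "tree_common_apex = spell (\<lambda>b p s h z t u v w i j k l m n q r A B C D E F G H I J K L.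
p B C J K(p B D J K(p B E J K(p B F J K(p B G J K(p B H J K(b B C D(p B C D I(b C D E(h t i A B C D E)(b C D
G(p C D E G(b D F G(h t i A B C D G)(p C D F G(p D E F G(h t i A B C D F)))))(b C D H(p C D E H(p C D G H(b D
F H(h t i A B C D H)(p C D F H(p D E F H(h t i A B C D F))))))(b C D F(p C D E F(h t i A B C D F))(b B D E(p B
C D E(b D E F(h t i A B D E F)(p B C E I(p C D E F(b C F G(p C E F G(b D E G(h t i A B D E G)(p C D E G(h t r
C D E F G))))(p C E F G(b E F G(b F G H(h t i A E F G H)(p C F G H(b D E G(h t i A B D E G)(p C E F H(b E F
H(b D F G(b C H I(p C G H I(b F G I(h t i A E F G I)(p C F G I(h t r C F G H I))))(p C F H I(p C G H I(b G H
I(b E G H(h t i A E G H I)(b H I K(h w i A G H I K)(p D E G H(p C H I K(p H I J K(b F G I(h t i A E F G I)(p C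
H J K(b F H I(p E F H I(b E G I(b G I K(h w i A E G I K)(p F G I K(p G I J K(p F G J K(p F I J K(b D F H(h t q
D E F G H)(b F H J(h u q F G H I J)(h u j C D F H J))))))))(h t l E F G H I)))(h w j C F H I K)))))))))(h t j
C F G H I)))))(h t j C D F G H))(h t j C D E F H))))))(h t j C D E F G))))))))(b B D F(p B C D F(p B D E F(p B
D F I(p B C F I(p B E F I(b E F G(h t i A D E F G)(b D F G(h t i A B D F G)(p C D F G(b D F H(p D F G H(h t i
A B D F H))(p C D F H(p D E F H(b C E G(p C E F G(h t q C D E F G))(b C E H(p C E F H(p C E G H(h t q C D E F
H)))(b C E I(p C E F I(p C E G I(p C E H I(h t q C D E F I))))(b B E G(p B C E G(p B D E G(p B E G I(p B C G
I(b D G H(p D E G H(p D F G H(b G H I(h t i A F G H I)(p C G H I(b E G H(h t l D E F G H)(p C E G H(h t j C E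
G H I)))))))(p C D G H(p D E G H(b C H I(h t r C E G H I)(b G H I(p B G H I(b F G H(h t i A F G H I)(b H I K(h
w i A G H I K)(p C H I K(p H I J K(b E H I(p B E H I(p B D E H(p B E F H(b B C H(b D E H(h t n D E F G H)(h t
n B C D E H))(h u j B C H I J)))))(h w j C E H I K)))))))(h t j C E G H I))))))))))(p B D E G(p B E F G(b B E
H(p B C E H(p B D E H(p B E G H(p B E H I(p B C H I(p B D G H(p B F G H(p B G H I(b E G I(b F H I(b H I K(h w
i A F H I K)(p G H I K(p G I J K(b B C G(b D E G(h t l D E F G H)(h t n B C D E G))(p B C G H(b C G I(h t q C
E G H I)(h u j B C G I J)))))))(h t q E F G H I))(p C E G I(b D E G(h t l D E F G H)(h t j C D E G
I))))))))))))(p B D E H(p B E F H(b E G H(p E F G H(b G H I(h t i A F G H I)(b E G I(b F H I(b H I K(h w i A F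
H I K)(p G H I K(p G I J K(b B C G(p B C E G(b D E G(p D E G H(h t l D E F G H))(h t n B C D E G)))(b C G I(p
C D G I(p C G H I(p D G H I(b D E H(b C H I(p C D H I(p C E H I(p D E H I(h t l D E F H I))))(b E H I(p D E H
I(h t l D E F H I))(h t q C E G H I)))(h t r C D E G H)))))(h u j B C G I J))))))(p E F H I(h t q E F G H
I)))(p C E G I(b D E G(p D E G H(h t l D E F G H))(h t j C D E G I))))))(p B E G H(p C E G H(b D E G(b E H I(p
E G H I(b H I K(h w i A G H I K)(p H I J K(b E G I(p D E G I(p D E H I(h t l D E F G I)))(p C E G I(b B C H(p
B C G H(h t n B C E G H))(b C H I(h t r C E G H I)(h u j B C H I J))))))))(p C E H I(p C G H I(b G H I(b H I
K(h w i A G H I K)(p C H I K(h w j C E H I K)))(h t j C E G H I)))))(h t j C D E G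
H)))))))))))))))))))))))))(b B D G(p B C D G(p B D E G(p B D F G(p B D G I(p B C G I(p B E G I(p B E G J(p B E
G K(p B F G I(p B F G J(p B F G K(b D G H(h t i A B D G H)(p C D G H(p D E G H(p D F G H(b B D H(p B C D H(p B
D E H(p B D F H(p B C H I(p B E H I(p B E H K(p B F H I(p B F H K(b D E F(b E F G(h t i A D E F G)(p E F G H(p
E F G I(b G H I(b H I K(h w i A G H I K)(p E H I K(h w j E F H I K)))(h t j E F G H I)))))(p C D E F(p D E F
H(b C F I(p C F G I(p C F H I(b C E H(p C E G H(h t q C D E G H))(p C E H I(h t q C E F H I)))))(b E F I(b G H
I(b H I K(h w i A G H I K)(p C H I K(p E H I K(p F H I K(p C F I K(b E F K(h w n E F H I K)(h w j C D E F
K)))))))(h t n E F G H I))(h t j C D E F I))))))))))))))(p B D G H(b D E F(b E F G(h t i A D E F G)(p B E F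
G(p E F G H(p E F G I(b E H I(h t r E F G H I)(b G H I(b H I K(h w i A G H I K)(p E H I K(p E I J K(b F H I(b
B C E(p B C E F(b C E F(h t l B C D E F)(p C E F G(h t j C E F G H))))(p B C E F(p B C E G(b C E I(p C D E I(p
C E H I(p D E H I(b C F H(p C F G H(h t q C D F G H))(b D F H(p D F H I(h t l D F G H I))(h t q C D E F
H))))))(h u j B C E I J)))))(h w j E F H I K)))))(h t j E F G H I)))))))(p B D E F(p C D E F(b B C F(p B C E
F(h t n B C D E F))(p B C F G(b C F H(p C D F H(p C E F H(b C F I(p C D F I(p C E F I(b G H I(b H I K(h w i A
G H I K)(p H I J K(b B F H(p B F H I(p B F H J(p F H I J(b E F J(b E H I(p B E H I(b B C E(p B C E H(b D E H(p
D E H I(h t l D E G H I))(h t r C D E F H)))(p B C E G(p B C E H(b C E H(h t q C D E G H)(h t r B C E F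
H))))))(p E H I J(h u n E F H I J)))(p C E F J(h u j C D E F J))))))(p B C F H(p B E F H(b F H I(p E F H I(h t
l E F G H I))(h u j B F H I J)))))))(p E G H I(h t n E F G H I)))))(p C F H I(b F I J(b E F I(p F H I J(p H I
J K(b G H I(h w i A G H I K)(p E G H I(h t n E F G H I)))))(h t j C D E F I))(h u j B C F I J))))))(p B C F
H(p B E F H(b E F H(b F H I(p E F H I(h t l E F G H I))(h t j B C F H I))(h t j C D E F
H)))))))))))))))))))))))))))(b B D H(p B C D H(p B D E H(p B D F H(p B D G H(p B C H I(p B E H I(p B F H I(p B
F H J(p B F H K(p B G H I(p B G H K(b B F G(p B D F G(p B F G I(p B F G K(b B E F(p B D E F(b E F G(h t i A D
E F G)(b F G H(h t i A D F G H)(p E F G H(h t j E F G H I)))))(p B E F G(p B E F H(b D E F(h t i A D E F G)(b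
F G H(h t i A E F G H)(p C D E F(b F I K(h w r F G H I K)(p F I J K(b B C F(p B C E F(h t n B C D E F))(p B C
F G(b C F I(p C E F I(b B E G(p B D E G(p B E G I(b E G H(h t i A D E G H)(h t n E F G H I))))(p B E G H(b D E
G(h t i A D E G H)(p C D E G(h t r C D E F G))))))(h u j B C F I J)))))))))))))))(p B F G H(b E F G(h t i A E
F G H)(b D E F(b E F H(h t i A D E F H)(p B E F H(p E F H I(b D F G(h t i A D F G H)(p C D F G(b C E G(p C E F
G(h t q C D E F G))(b B C E(p B C E F(p B C E I(p B C F I(b C E F(h t l B C D E F)(p C E F H(b C G H(h t r C E
F G H)(p C G H I(b E G H(b F G I(b F I J(p F G I J(b G I J(h u l F G H I J)(p C G I J(b E G I(h t q E F G H
I)(h u j C E G I J)))))(p C F I J(p F G I J(b E G I(h t q E F G H I)(h u j C E G I J)))))(h t j C E F G I))(h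
t j C E G H I)))))))))(p B C E G(p B E G H(b E G I(h t q E F G H I)(h t j B C E G I)))))))))))(p C D E F(p C E
F G(h t j C D E F G))))))))))))))))))(b B E F(p B D E F(p B E F I(b E F G(h t i A D E F G)(b E F H(p E F G H(h
t i A D E F H))(b B C E(p B C E F(p B C E I(p B C F I(b C E F(h t l B C D E F)(p C E F G(p C E F H(b C G H(h t
r C E F G H)(b F G H(b D F G(h t i A D F G H)(b G H I(h t i A F G H I)(p C G H I(b F G I(b E G H(b G I J(p F G
I J(p G H I J(p H I J K(b F H I(h w i A F H I K)(p E F H I(b F H J(p F H J K(b D F H(h w i A D F H K)(b D E
G(p D E G H(h t l D E F G H))(b E G I(h t q E F G H I)(h t j C D E G I)))))(h u l F G H I J)))))))(p C G I J(b
E G I(b H I J(p H I J K(b F H I(h w i A F H I K)(p E F H I(h t q E F G H I))))(h u j C G H I J))(h u j C E G I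
J))))(h t j C E G H I))(h t j C E F G I)))))(h t j C E F G H)))))))))(p B C E F(b B E G(p B C E G(p B D E G(p
B E G I(b D F G(b F G H(h t i A D F G H)(p E F G H(b E H I(p E G H I(b F G I(h t i A D F G I)(h t r E F G H
I)))(b G H I(p B G H I(b D G H(h t i A D G H I)(b H I K(h w i A G H I K)(p C D G H(p E H I K(p H I J K(p E I J
K(b C E I(p C E H I(b F H I(p B F H I(b C F H(p C F G H(h t q C D F G H))(b B E H(b B C F(b B F G(p B C F G(b
C F G(h t l B C D F G)(h t n C E F G H)))(p B C F G(h t n C E F G H)))(p B C F H(h t q B C E F H)))(p B C E
H(h u j B E H I J)))))(h w j E F H I K)))(h u j B C E I J)))))))))(h t j E F G H I)))))(p C D F G(h t q C D E
F G))))))(p B C E G(p B E F G(b D F G(b F G H(h t i A D F G H)(p B F G H(p E F G H(p B C G H(p B E G H(b G H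
I(b H I K(h w i A G H I K)(p H I J K(b F G I(h t i A D F G I)(b E H I(p E F G I(h t r E F G H I))(h u j B E H
I J)))))(h t j B E G H I)))))))(p C D F G(b E G H(p E F G H(b G H I(h t i A F G H I)(b C E G(h t q C D E F
G)(b E G I(b F H I(p B F H I(b D F H(h t i A D F H I)(b H I K(h w i A F H I K)(p C D F H(p G H I K(p H I J K(p
G I J K(b C G I(p C G H I(b C E H(h t q C D E F H)(p B C E H(b B G H(h t r B C E G H)(h u j B G H I J)))))(h u
j B C G I J)))))))))(p E F H I(h t q E F G H I)))(h t j B C E G I)))))(p B E G H(b C E G(h t q C D E F G)(h t
j B C E G H)))))))))))))))(b B F G(p B D F G(p B E F G(p B F G I(b D E F(h t i A D E F G)(b F G H(h t i A E F
G H)(p C D E F(b B C F(p B C E F(h t n B C D E F))(p B C F G(b D E G(b E G H(h t i A D E G H)(b C F H(p C E F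
H(b C F I(p C E F I(b G H I(p B G H I(b D G H(h t i A D G H I)(b H I K(h w i A G H I K)(p C D G H(p H I J K(b
E G I(h t i A D E G I)(b B F H(b C E H(p C E G H(h t q C D E G H))(b B C E(b B E G(p B C E G(b C E G(h t l B C
D E G)(h t q C E F G H)))(p B C E G(h t q C E F G H)))(p B C E H(h t r B C E F H))))(p B C F H(p B E F H(b F H
I(p E F H I(h t l E F G H I))(h u j B F H I J)))))))))))(p E G H I(h t n E F G H I))))(p C F H I(b F I J(b E F
I(p F H I J(p H I J K(b G H I(h w i A G H I K)(p E G H I(h t n E F G H I)))))(h t j C D E F I))(h u j B C F I
J)))))(p B C F H(p B E F H(p B F G H(b E F H(b F H I(p E F H I(p F G H I(b E G I(h t i A D E G I)(h t l E F G
H I))))(h t j B C F H I))(h t j C D E F H)))))))(p C D E G(h t r C D E F G)))))))))))(p B E F G(b B F H(p B E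
F H(p B F G H(b E F G(h t i A E F G H)(b D E F(h t i A D E F H)(p C D E F(p C E F G(h t j C D E F G)))))))(p B
E F H(b B C G(p B C E G(p B C F G(b E F G(b D E F(h t i A D E F G)(h t n B C D E F))(h t n B C E F G))))(b B C
H(p B C E H(p B C F H(p B C G H(p B F G H(b D E F(b E F H(h t i A D E F H)(h t n B C E F H))(h t n B C D E
F))))))(b B C F(p B C E F(p B C F G(p B C F H(p B C E G(p B C E H(b D E F(b E F G(h t i A D E F G)(b C G H(p C
F G H(b E F H(h t i A D E F H)(h t r C E F G H)))(p B C G H(b F G H(b G H I(h t i A F G H I)(h t j B C G H
I))(h t j C E F G H)))))(h t n B C D E F)))))))(b F G H(b E F G(h t i A E F G H)(b G H I(h t i A F G H I)(b D
E F(b E F H(h t i A D E F H)(b D F G(h t i A D F G H)(p C D F G(b B G H(b B C E(p B C E F(p C E F H(h t r B C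
F G H)))(h t r B E F G H))(b H I J(p H I J K(b F H I(h w i A F H I K)(p E F H I(b C E F(p B C E F(b E G H(b C
E G(h t q C D E F G)(b E G I(h t q E F G H I)(h t j B C E G I)))(h t j B E G H I)))(p C E F G(p C E F H(b C G
H(h t r C E F G H)(h t j B C G H I))))))))(h u j B G H I J))))))(p C D E F(p C E F G(h t j C D E F G))))))(p B
F G H(b G H I(b H I K(h w i A G H I K)(p H I J K(b F H I(b E F G(b D E F(h t i A D E F G)(p C D E F(b E G H(h
t i A E G H I)(b C F G(b C E G(p B C E G(p C D E G(b E G I(h t i A D E G I)(b E F H(p E F H I(h t l E F G H
I))(h t j B C E F H)))))(p C E G H(b D E G(b E G I(h t i A D E G I)(b C F H(h t q C E F G H)(b C H I(b E F H(p
C E H I(p E F H I(h t l E F G H I)))(h t j C D E F H))(h u j B C H I J))))(h t r C D E F G))))(h t j B C F G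
H)))))(b B C E(p B C E F(p C E F G(h t j B C F G H)))(h t j B E F G H)))(h u j B F H I J))))(h t j B F G H
I)))))))))))))))))))))(b B D E(p B C D E(p B D E I(p B D E J(p B D E K(b D E F(h t i A C D E F)(b D E H(p D E
F H(b E G H(h t i A C D E H)(p D E G H(p E F G H(h t i A C D E G)))))(b D E G(p D E F G(h t i A C D E G))(b B
D F(p B C D F(p B D F I(p B D F J(p B D F K(b B D G(p B C D G(p B D G I(p B D G J(p B D G K(b B D H(p B C D
H(p B D H I(p B D H J(p B D H K(b D I J(p D F I J(p D G I J(p D H I J(p D I J K(p F I J K(p G I J K(p H I J
K(b G H I(h w i A G H I K)(b F H I(p F G H I(h w i A F H I K))(b E F G(b C E F(h t i A C E F G)(b F G H(h t i
A E F G H)(b D F H(p D F G H(p D F H J(p D F H K(p D F G J(p D F G K(b G H J(b G H K(p D G H J(b E G H(h w i A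
E G H K)(h t q D E F G H)))(h w r F G H I K))(h u r F G H I J)))))))(p D F G H(b E F H(b F H J(p B F H J(p B E
F H(b B C E(b C E G(h t i A B C E G)(b C F G(b D F G(h t l C D E F G)(h t j D F G H I))(p C D F G(h t j D F G
H I))))(p B C E F(h t q B C D E F)))))(h u r D F H I J))(h t j D E F H I))))))(p D E F G(b F G I(p B F G I(p F
G H I(p F G I K(b G H K(h w i A F G H K)(b E G K(p B E G K(p E G H K(b B C E(p B C E G(b C E F(h t i A B C E
F)(p C E F G(h t n C D E F G))))(p B C E G(b C E G(p C E F G(p C E G H(b C F G(h t i A C F G H)(b C F H(b F H
K(h w i A C F H K)(h w l F G H I K))(h t l C E F G H)))))(h t q B C D E G))))))(h w r D E G I K))))))(h t j D
E F G I)))))))))))))(b B F G(p B F G I(b E F G(b C E F(h t i A C E F G)(b F G H(h t i A E F G H)(b B C E(b C E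
G(h t i A B C E G)(b B E F(h t i A B E F G)(b C F G(b D F G(h t l C D E F G)(p D F G H(b G H I(p B G H I(b E G
H(h t i A E G H I)(b H I K(h w i A G H I K)(p C E G H(p H I J K(b F H I(p B F H I(p B E F H(b B C F(p B C F
G(p B C F H(b E F H(p E F H I(b B E G(p B E G I(h t l E F G H I))(h t l B C E F G)))(h t n C D E F H))))(p B C
F H(b C F H(h t q C E F G H)(h t q B C D F H))))))(h u j D F H I J)))))))(h t j D F G H I))))(p C F G H(p C E
F H(h t n C D F G H))))))(p B C E F(h t q B C D E F)))))(p D E F G(b G H I(p D G H I(p F G H I(h t j D E F G
H)))(h t j D E F G I)))))(p B D F G(b D F H(p D E F H(p D F G H(b E F G(h t i A E F G H)(b C E F(h t i A C E F
H)(p C E F G(h t n C D E F G))))))(b D G H(p D F G H(b E F G(h t i A E F G H)(b E F H(b C E F(h t i A C E F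
H)(p C E F G(h t n C D E F G)))(h t r D E F G H))))(b H I J(p H I J K(b G H I(h w i A G H I K)(b F G H(b E F
G(h t i A E F G H)(b F G I(b F H I(h w i A F H I K)(b E G H(b C E F(b B C E(h t i A B C E F)(b E F H(h t i A C
E F H)(p E F H I(b C F G(h t i A C F G H)(b E G I(h t q E F G H I)(b G I J(p F G I J(b F H J(p F H J K(b C F
H(h w i A C F H K)(b B E G(p B C E G(p C E G H(h t l C E F G H)))(p B C E G(b C E G(p C E G H(h t l C E F G
H))(h t q B C D E G))))))(h u l F G H I J)))(h u j D E G I J)))))))(p C E F G(h t n C D E F G)))(h t j D E G H
I)))(h t j D E F G I)))(h t j D F G H I))))(b G H I(p B G H I(b F G H(h t i A F G H I)(p B F G H(b E F G(p B E
F G(b C E F(h t i A C E F G)(p B E F H(b B C F(p B C E F(p B C F G(p B C F H(p B C E G(p B C E H(p C F G H(h t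
n C D F G H)))))))(p B C F G(p B C F H(h t n B D F G H)))))))(h t j D E F G H)))))(h u j D G H I
J))))))))))))(p B C D H(p B D E H(p B D F H(p B D G H(b E F G(b C E F(h t i A C E F G)(b F G H(h t i A E F G
H)(b B C E(b C E G(h t i A B C E G)(b D F G(p C D F G(h t l C D E F G))(b D H I(p D G H I(b F G I(h t i A E F
G I)(h t r D F G H I)))(b H I J(p H I J K(b G H I(h w i A G H I K)(h t j D F G H I)))(h u j B D H I J)))))(p B
C E F(h t q B C D E F)))))(p D E F G(b F G H(p B F G H(b G H I(h t i A F G H I)(p D G H I(b C D H(b H I J(p H
I J K(b F G I(b E G H(b F H I(h w i A F H I K)(p B E G H(b B C E(p B C E G(b C E F(h t i A B C E F)(p C E F
G(h t n C D E F G))))(p B C E G(b C E G(p C E F G(p C E G H(b E F H(h t i A C E F H)(p E F H I(b C F G(h t i A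
C F G H)(b C F H(b F H K(h w i A C F H K)(p F H J K(b F I J(p F G I J(b G I J(h u l F G H I J)(p D G I J(b E G
I(h t q E F G H I)(h u j D E G I J)))))(p D F I J(p F G I J(b E G I(h t q E F G H I)(h u j D E G I J)))))))(h
t l C E F G H)))))))(h t q B C D E G))))))(h t j D E G H I))(h t j D E F G I)))(h u j B D H I J))(h t j B C D
H I)))))(h t j D E F G H)))))))))))))(p B C D G(p B D E G(p B D F G(b D G H(p D E G H(p D F G H(b E F G(h t i
A E F G H)(b G H I(h t i A F G H I)(b E F H(b C E F(h t i A C E F H)(b F H I(h t i A E F H I)(p C E F G(p D F
H I(b B C E(b C E H(h t i A B C E H)(b C D G(h t n C D E F G)(b D G I(b C F H(p C D F H(p C F G H(b D F H(h t
l C D E F H)(h t q D F G H I))))(p C D F H(h t q D F G H I)))(h t j B C D G I))))(p B C E F(h t q B C D E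
F)))))))(p D E F H(h t r D E F G H)))))))(p B D G H(p D F G H(p B C D H(p B D E H(p B D F H(b G H I(b F G H(h
t i A F G H I)(b H I K(h w i A G H I K)(b E F G(p H I J K(b F G I(h t i A E F G I)(b D H I(p D F G I(h t r D F
G H I))(h u j B D H I J))))(h t j D E F G H))))(h t j B D G H I))))))))))))))))(p B C D F(p B D E F(b B F G(p
B C F G(p B D F G(p B E F G(p B F G I(p B F G J(p B F G K(b C E F(h t i A C E F G)(b F G H(h t i A E F G H)(b
C D G(b D F H(p D E F H(b E G H(b C E G(h t i A C E G H)(b G H I(h t i A E G H I)(p F G H I(b F I J(p F H I
J(p F I J K(p H I J K(b G H K(h w i A E G H K)(p F G H K(h w r F G H I K))))))(p F H I J(b D F I(p D E F I(b H
I J(p H I J K(b E H I(h w i A E H I K)(p D E H I(b G H K(h w i A E G H K)(p G H J K(b C D F(h t l C D E F G)(b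
D F J(p D E F J(b C F I(p C F H I(b D G I(p D G H I(h t q D E G H I))(b E G I(b G I J(p E G I J(b E H J(p E H
J K(b C E H(h w i A C E H K)(b C G H(p C D G H(b D G H(h t l C D E G H)(h t n D F G H I)))(p C D G H(h t n D F
G H I)))))(h u l E G H I J)))(p D G I J(p D G H J(h u n D F G I J))))(h t q D E F G I))))(h u j B C F I J)))(h
u j B C D F J))))))))(h u j F G H I J)))(h u j B D F I J)))))))(p D E G H(h t q D E F G H))))(p B D F H(p D F
G H(p B C D H(p B D E H(p B F G H(b C D F(b F H I(p F G H I(b E G H(h t i A E G H I)(b H I K(h w i A G H I
K)(p H I J K(b D H I(p D E H I(b F H J(p F G H J(p G H J K(b C E G(b E G I(h t i A C E G I)(p D E G I(b C G
H(h t i A C G H I)(b G I J(p G I J K(b E G K(h w i A C E G K)(p D E G K(p E G J K(p D G J K(b E F H(p E F H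
I(h t l E F G H I))(p C E F H(b C D H(h t n C D E F H)(b D H J(p D E H J(b D F I(h t q D E F G I)(b E F I(b D
I J(p D E I J(p D F I J(p E F I J(h u l E F G I J))))(p D F I J(b F I J(p E F I J(h u l E F G I J))(h u q D F
H I J))))(h t r D E F H I))))(h u j B C D H J))))))))))(p F G I J(h u q F G H I J))))))(h t l C D E F G))))(h
u j B D F H J)))(h u j B D H I J))))))(h t j B D F H I))(h t j B C D F H))))))))(p B C D G(p B D E G(h t r B C
D F G))))))))))))(p B C F G(p B D F G(p B E F G(b C D F(b F G H(b E F G(h t i A E F G H)(b G H I(h t i A F G H
I)(p D E F G(b F G I(b D G H(p D E G H(b E F H(b C E F(h t i A C E F H)(b F H I(h t i A E F H I)(p C E F G(b H
I K(b E H I(h w i A E H I K)(p D E H I(b F H K(h w i A E F H K)(b G H K(h w i A F G H K)(p G H J K(b G I K(p F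
G I K(h w l F G H I K))(p G I J K(b D G I(p D E G I(b C D G(h t n C D E F G)(b D G J(p D E G J(b C G I(p C G H
I(b D F H(p C D F H(b C E H(b E H K(h w i A C E H K)(p D E H K(p E H J K(p D H J K(b D F I(h t q D E F H I)(b
E F I(b D I J(p D E I J(p D F I J(p E F I J(h u l E F H I J))))(p D F I J(b F I J(p E F I J(h u l E F H I
J))(h u q D F G I J))))(h t r D E F G I)))))))(h t l C D E F H)))(p D F H I(h t q D F G H I))))(h u j B C G I
J)))(h u j B C D G J))))(h u j B D G I J)))))))))(p F H I K(p G H I K(p H I J K(p F H J K(p F I J K(p G H J
K(p G I J K(b F G J(h u n F G H I J)(h u j B D F G J)))))))))))))(p D E F H(h t r D E F G H))))(p B D G H(p B
C D H(p B D E H(p B F G H(h t j B D G H I))))))(h t j B D F G I)))))(p B F G H(p B C F H(p B D F H(p B E F H(b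
D F G(b G H I(p C D F G(p D E F G(b H I K(h w i A G H I K)(b C E F(h t i A C E F G)(p H I J K(b F G I(h t i A
E F G I)(b F H I(b E G H(h t i A E G H I)(p D E G H(b G H J(p G H J K(b D F H(h t q D E F G H)(b F H J(b D H
I(p D E H I(b C E G(b E G I(h t i A C E G I)(p D E G I(b C G H(h t i A C G H I)(b G I J(p G I J K(b E G K(h w
i A C E G K)(p D E G K(p E G J K(p D G J K(b E F H(p E F H I(h t l E F G H I))(p C E F H(b C D H(h t n C D E F
H)(b D H J(p D E H J(b D F I(h t q D E F G I)(b E F I(b D I J(p D E I J(p D F I J(p E F I J(h u l E F G I
J))))(p D F I J(b F I J(p E F I J(h u l E F G I J))(h u q D F H I J))))(h t r D E F H I))))(h u j B C D H
J))))))))))(p F G I J(h u q F G H I J))))))(h t l C D E F G)))(h u j B D H I J))(h u j B D F H J))))(h u j B F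
G H J))))(h u j B F H I J))))))))(h t j B F G H I))(h t j B D F G H)))))))(b D F G(p D E F G(b F G H(h t i A E
F G H)(p B F G H(p B C F H(p B D F H(p B E F H(b D F H(b G H I(b E G H(h t i A E G H I)(p D E G H(h t q D E F
G H)))(h t j B F G H I))(h t j B C D F H))))))))(h t j B C D F G)))))))))))))))))(p B C D E(b B D F(p B C D
F(p B D E F(p B D F I(p B D F J(p B C E F(p B E F I(p B E F J(p B E F K(b C D E(h t i A C D E F)(b E F G(h t i
A D E F G)(b D F G(h t i A C D F G)(b D F H(p D F G H(h t i A C D F H))(p D E F H(b D E H(b D G H(p D F G H(b
C F G(h t i A C F G H)(b G H I(h t i A F G H I)(b B E G(p B C E G(p B D E G(p B E G I(p B E G J(p B E G K(p E
G H I(b E G H(h t l D E F G H)(b D E I(b E I J(p E H I J(p E I J K(p H I J K(b G H K(h w i A F G H K)(p E G H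
K(h w r E G H I K))))))(p E H I J(b C E I(p C E H I(b H I J(b D E J(p H I J K(b F H I(h w i A F H I K)(p D F H
I(b C D G(p C D G H(b C F H(b F H K(h w i A C F H K)(p D F H K(p F H J K(p D H J K(b D G I(h t q D F G H I)(b
F G I(b D I J(p D F I J(p D G I J(p F G I J(h u l F G H I J))))(p D G I J(b G I J(p F G I J(h u l F G H I
J))(h u n D E G I J))))(h t n D E F G I)))))))(h t l C D F G H)))(p B C D G(p B C F G(h t r B C D E G)))))))(h
u j B C D E J))(h u j E G H I J)))(h u j B C E I J))))(h t j B C D E I)))))))))(p B C E G(p B D E G(p B E F
G(b D E G(b E G H(h t l D E F G H)(p B E G H(p B C E H(p B D E H(p B E F H(h t j B E G H I))))))(h t j B C D E
G)))))))))(p D E G H(b F G H(b G H I(h t i A F G H I)(p D G H I(p E G H I(b D E I(h t n D E G H I)(h t j B C D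
E I)))))(h t n D E F G H))))(p B D E H(b E G H(p B E G H(p D E G H(h t j B C D E G)))(h t j B C D E
H)))))))))))))))))(p B C D F(b B D H(p B D E H(p B D F H(b D E F(b E F G(h t i A D E F G)(b B E F(b C D F(b D
F G(h t i A C D F G)(p D F G H(h t i A C D F H)))(h t r B C D E F))(p B E F G(p B E F H(p B F G H(h t i A D E
F H))))))(p B D E F(p D E F H(b C D E(b E G H(h t i A C D E H)(p D E G H(p E F G H(h t i A C D E G))))(h t j B
C D E F)))))))(p B C D H(b B D G(p B D E G(p B D F G(b B E F(p B D E F(b C D F(h t i A C D F G)(h t r B C D E
F)))(p B E F G(b D E F(h t i A D E F G)(b C D E(h t i A C D E G)(h t j B C D E F)))))))(p B C D G(b B E F(p B
D E F(b C D E(h t i A C D E F)(b E F G(h t i A D E F G)(b C D F(b D F G(h t i A C D F G)(p B D F G(b D F H(p D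
F G H(h t i A C D F H))(p B D F H(p D E F H(b B E G(h t q B D E F G)(b D E G(b D G H(p D E G H(p D F G H(b G H
I(h t i A F G H I)(b E G H(h t l D E F G H)(p B E G H(h t j B E G H I))))))(p B D G H(p D E G H(p B E G H(b D
E H(b G H I(b F G H(h t i A F G H I)(h t n D E F G H))(h t j B E G H I))(h t j B C D E H))))))(h t j B C D E
G))))))))(h t r B C D E F)))))(b B F G(p B E F G(b D E F(h t i A D E F G)(b C D E(b D E G(h t i A C D E G)(p B
D E G(h t r B D E F G)))(h t j B C D E F))))(p B E F G(b B G H(p B F G H(b E F G(h t i A E F G H)(b D E F(b E
F H(h t i A D E F H)(p B E F H(h t r B E F G H)))(h t j B D E F G))))(p B E G H(p B F G H(b H I J(p H I J K(b
G H I(h w i A G H I K)(b F G H(b E F G(h t i A E F G H)(b D E F(b F H I(h w i A F H I K)(b C D E(h t i A C D E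
F)(b E F H(h t i A D E F H)(b E G H(b D E G(p E F H I(b D F G(h t i A D F G H)(p D E G H(b C E F(b E G I(h t q
E F G H I)(b C E G(b C D F(b D F H(h t i A C D F H)(h t l D E F G H))(p C D F G(h t q C D E F G)))(h t j B C E
G I)))(h t j B C E F G)))))(h t j B C D E G))(h t j B E G H I)))))(h t j B D E F G)))(h t j B F G H I))))(b G
H I(b F G H(h t i A F G H I)(b E F G(b D E F(h t i A D E F G)(b F H I(b C D E(b E F H(b E G H(h t i A E G H
I)(b D E G(h t i A C D E G)(p E F H I(b D F G(p D E G H(b C E F(h t i A C E F G)(b E G I(b C E G(h t i A C E G
I)(b C D F(p C D F G(h t l C D E F G))(b D F H(h t q D E F G H)(h t j B C D F H))))(h t l E F G H I))))(h t j
B D F G H)))))(h t j B D E F H))(h t j B C D E F))(h u j B F H I J)))(h t j B E F G H)))(h u j B G H I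
J))))))))))))))))))))))))"

text \<open>The point \<open>p8\<close> follows the six lowest points in both orders, but then \<open>p9\<close> is next in the \<open>Y\<close> order and
\<open>p10\<close> is next in the \<open>X\<close> order.\<close>
lemma refutes_common_apex:
  "refutes [[p0, p1, p2, p3, p4, p5, p6, p7, p8, p9, p10]]
    [[p0, p1, p2, p3, p4, p5, p6, p7, p8],
     [p1, p2, p3, p4, p5, p6, p7, p8, p9],
     [p0, p1, p2, p3, p4, p5, p6, p7, p8],
     [p0, p2, p3, p4, p5, p6, p7, p8, p10]]
    []
    (start_table [[p0, p1, p2, p3, p4, p5, p6, p7, p8, p9, p10]]
      (List.product [p2, p3, p4, p5, p6, p7] [p8, p9, p10] @ [(p8, p10), (p8, p9), (p10, p9)])) tree_common_apex"
  by code_simp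

definition tree_two_apexes :: refutation where
  "tree_two_apexes = spell (\<lambda>b p s h z t u v w i j k l m n q r A B C D E F G H I J K L.
p B C I K(p B D I K(p B E I K(p B F I K(p B G I K(p B C J K(p B D J K(p B E J K(p B F J K(p B G J K(p B C I
L(p B D I L(p B E I L(p B F I L(p B D J L(p B E J L(p B F J L(b G H K(p B G H K(b F G H(h v i A F G H K)(b H K
L(h w i A G H K L)(b E F G(b D E F(h t i A D E F G)(b F G K(h v i A E F G K)(p F G I K(p F G J K(b E G H(h v i
A E G H K)(b D E G(p D E F G(b C D E(h t i A C D E G)(b E G K(h v i A D E G K)(p C D E F(p E G I K(p E G J K(b
D G H(h v i A D G H K)(b B C D(p B C D I(p B C D K(p B C D L(b C D G(h t i A B C D G)(p C D G H(b B D E(h t i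
A B D E G)(p B D E F(b C E K(p B C E K(p C D E K(p C E F K(p C E G K(p B C E F(p D E F K(p C F G K(b F H K(p B
F H K(p E F H K(b E F H(h v l E F G H K)(h t j B C E F H))))(p C F H K(p D F H K(p E F H K(p F H I K(b E F I(p
E F I L(b C E H(h t q C D E G H)(p C E H K(p C D H K(b D E H(b D G K(b G K L(h w i A D G K L)(p E G K L(b E H
L(h w q E G H K L)(p C E H L(p E H I L(p E H J L(p C E G L(p C E I L(p C H I L(p C G I L(b C F I(h t q C E F H
I)(b F I J(p E F I J(h u l E F H I J))(h u j B C F I J)))))))))))))(h v l D E G H K))(h t r C D E F H))))))(h
t j B C E F I))))))))))))))(p C E G K(b E K L(p E G K L(p E H K L(b D G K(h w i A D G K L)(p C E H K(b C F H(p
C D F H(p C E F H(b D E H(p D E H K(p D E F K(h v l D E G H K)))(h t r C D E F H))))(b E F H(p E F H K(b F H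
K(h v l E F G H K)(p C F H K(p C H K L(h w j C F H K L)))))(h t j C D E F H)))))))(p C E K L(p E G K L(p C G K
L(b E F I(p E F I K(p E F I L(b E H K(p C E H K(b C F H(p C D F H(p C E F H(b D E H(b F H K(h v l E F G H K)(p
D E H K(p F H I K(p D E F K(b E H L(b G K L(b D G K(h w i A D G K L)(h v l D E G H K))(h w q E G H K L))(p C E
H L(p E H I L(p E H J L(b C F L(h w q C E F H L)(p C F I L(b B C F(p B C E F(h t n B C D E F))(b F I J(p E F I
J(h u l E F H I J))(h u j B C F I J)))))))))))))(h t r C D E F H))))(b E F H(b F H K(h v l E F G H K)(p C F H
K(h w j C F H K L)))(h t j C D E F H))))(p E H K L(h w n E F H K L)))))(p C E F I(b F H I(p C F H I(p E F H
I(h t j C D E F H)))(h t j C D E F I)))))))))))))))))(p B C D E(p B C E F(h t j B C D E F)))))))))))(p D E G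
H(b C E G(p C D E G(p C E F G(b B C D(h t i A B C D E)(b B C E(h t i A B C E G)(b C E F(h t i A C E F G)(b E G
K(h v i A C E G K)(b C G H(h v i A C G H K)(p B C E F(p D E G K(p E G I K(p E G J K(p D E I K(p D E J K(p D G
I K(p D G J K(b D H K(p B D H K(p D E H K(p B C D H(p B D E H(b E F H(p E F H K(b F H K(h v l E F G H K)(p D F
H K(p D F G H(h t q D E F G H)))))(p B E F H(p C E F H(p D E F H(p E F H K(b C D H(p C D F H(h t n C D E F
H))(b D H I(p D E H I(p D F H I(b D F K(p D F G K(h v q D E F G K))(p D F I K(p D F J K(b E F I(b D I J(p D E
I J(p D F I J(p E F I J(p E H I J(h u l E F G I J)))))(p D H I J(b D H J(p D E H J(b F I J(p E F I J(h u l E F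
G I J))(h u q D F H I J)))(h u j B C D H J))))(h t r D E F H I)))))))(h t j B C D H I))))))))))))(p D H I K(p
D H K L(b D F H(p D F G H(h t q D E F G H))(p D F H K(b F H K(p B F H K(p B C F H(p B E F H(b B D F(p B D E
F(h t q B C D E F))(p B D F H(b F H I(b H I J(p F H I J(h u k F G H I J))(h u j B D H I J))(h t j B D F H
I)))))))(h w j D F H K L))))))))))))))))))))))(p C E F G(p C E G H(b E G K(b G K L(h w i A E G K L)(p F G K
L(b C G L(p C F G L(p C F K L(b C D G(b F H L(p F H K L(h w q F G H K L))(p C F H L(b C D F(p C D F H(h t q C
E F G H))(p C D F G(p C D F H(h t q D E F G H))))))(p C D G H(b C F H(h t q C D F G H)(p C F H K(p C F H L(h w
q F G H K L))))))))(p C E G L(p C G I L(p C E I L(b D G L(p D F G L(p D F K L(b D F H(h t q D E F G H)(p D F H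
K(p D F H L(h w q F G H K L))))))(p D E G L(p D G I L(p D G J L(p D E I L(p D E J L(b F H L(p F H K L(h w q F
G H K L))(p F H I L(p F H J L(b D F H(p D F G H(h t q D E F G H))(p D F H I(p D F H J(b C F H(p C D F H(p C F
G H(p C D G H(h t q C E F G H))))(p C F H I(b C D F(p C D E F(b B C D(h t i A B C D E)(b C D I(p C D H I(h t n
C D F H I))(b D I J(h u r D F H I J)(h u j B C D I J)))))(p C D F H(h t j C D F H I)))))))))))))))))))))))(p C
E G K(p D E G K(p E G I K(p E G J K(p C E I K(p C G I K(p D E I K(p D E J K(p D G I K(p D G J K(b E H L(p B E
H L(p E H K L(b E F H(p E F H K(b F H K(h v l E F G H K)(p F H K L(b D F H(p D F G H(h t q D E F G H))(p D F H
K(p D F K L(h w j D F H K L)))))))(p B E F H(p C E F H(p D E F H(p E F H K(b D F K(p D F G K(p D F H K(h v q D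
E F G K)))(p D F I K(p D F J K(b C D E(b B C D(h t i A B C D E)(b C D H(p C D F H(h t n C D E F H))(p B C D
H(b D H I(p D E H I(p D F H I(b E F I(b D I J(p D E I J(p D F I J(p E F I J(p E H I J(h u l E F G I J)))))(p D
H I J(b D H J(p D E H J(b F I J(p E F I J(h u l E F G I J))(h u q D F H I J)))(h u j B C D H J))))(h t r D E F
H I))))(h t j B C D H I)))))(p C D E F(h t j C D E F H)))))))))))))(p C E H L(p D E H L(p E H I L(p E H J L(p
C H I L(p D H I L(p D H J L(b D F H(p D F G H(h t q D E F G H))(p D F H I(p D F H J(b C F H(p C D F H(p C F G
H(p C D G H(h t q C E F G H))))(p C F H I(b C D F(p C D E F(b B C D(h t i A B C D E)(b C D I(p C D H I(b F H
I(p E F H I(h t n C D E F H))(h t n C D F H I)))(b D I J(b F H J(p E F H J(h u r D E H I J))(h u r D F H I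
J))(h u j B C D I J)))))(p C D F H(b F H I(p B F H I(p E F H I(b B C D(b C D E(h t i A B C D E)(h t j C D E F
H))(p B C D F(p B C E F(h t j B C D F H))))))(h t j C D F H I))))))))))))))))))))))))))))))))))))))(p E F G
H(b D F G(p D E F G(b C D E(h t i A C D E F)(b C D F(h t i A C D F G)(b F G K(h v i A D F G K)(b D G H(h v i A
D G H K)(p E F G K(p F G I K(p E F I K(p E F J K(p E G I K(p E G J K(b E H K(h v r E F G H K)(p E H I K(p E H
J K(p E H K L(b F H K(p B F H K(b C F K(p B C F K(p C D F K(p C E F K(p C F G K(p B C D F(p D E F K(p D F H
K(p B C E F(p C E G K(p C E H K(p B D E F(p D E H K(b C D H(p C D F H(p C D G H(b D G K(h v i A C D G K)(h v l
D F G H K))))(p C D G H(b C F L(b D F H(b D G K(b C D G(h v i A C D G K)(b G K L(h w i A D G K L)(p F G K L(b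
C F H(h t q C D F G H)(p C F H L(h w q F G H K L))))))(h v l D F G H K))(p C D F H(h t q C D E F H)))(p C D F
L(p C F G L(p C F I L(p C F K L(p C D I L(p C G I L(b F H L(p C F H L(b G K L(b D F H(b D G K(h w i A D G K
L)(h v l D F G H K))(h t q C D E F H))(h w q F G H K L)))(p C F H L(p F H I L(p F H J L(p C H I L(b E I J(h u
r E F H I J)(b C E I(b D F I(p D F H I(b D G K(b C D G(h v i A C D G K)(b C F H(h t q C D F G H)(h t n C E F H
I)))(h v l D F G H K)))(h t q C D E F I))(h u j B C E I J)))))))))))))))))))))))))))))(p C D F K(p C F G K(p C
F H K(p C F I K(p C D I K(p C G H K(p C G I K(p C D F H(b C E H(p C D E H(p C E F H(b D F H(p B D F H(p D F H
K(p B D E F(p D E F K(b D G K(b G K L(h w i A D G K L)(p F G K L(b F H L(h w q F G H K L)(p C F H L(p F H I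
L(p F H J L(p C H I L(b E I J(h u r E F H I J)(b B C E(p B C E F(h t l B C D E F))(b C E I(h t n C E F H I)(h
u j B C E I J)))))))))))(h v l D F G H K))))))(h t q C D E F H))))(p C E H K(p C E K L(h w j C E H K
L))))))))))))))(h w j E F H K L)))))))))))))))))(p D F G H(b C F G(p C D F G(p C E F G(b B C F(h t i A B C F
G)(b F G K(h v i A C F G K)(p B C D F(p B C E F(p E F G K(p E F I K(p E G I K(b E H K(h v r E F G H K)(p E H I
K(b C D E(b D E F(h t i A C D E F)(p D E F G(h t j D E F G H)))(p B C D E(p C D E G(b D E I(p D E H I(h t n D
E F G H))(h t j B C D E I))))))))))))))))(p C F G H(b F G L(p B F G L(p F G H L(p F H K L(b D E F(b C D E(h t
i A C D E F)(b D F K(p B D F K(p D F G K(p B D E F(p B D F G(b C D F(h v i A C D F K)(p C D F G(b C E G(p C E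
F G(h t q C D E F G))(b B C E(b B E F(p B C E F(b C E F(h t l B C D E F)(h t j C E F G H)))(p B C E F(h t j C
E F G H)))(p B C E G(h t j B C E G H))))))))))(p D E F K(p D F I K(b B C D(p B C D I(b C D F(h t i A B C D
F)(p C D F I(p C D F G(p C D F H(b D E H(p D E G H(h t n D E F G H))(p C D E H(b C E G(p C E F G(h t q C D E F
G))(b D E G(b D G K(p D E G K(p D F G K(p D G H K(p D E H K(b G K L(h w i A F G K L)(b E G K(h v l D E F G
K)(p C E G K(p E G I K(p E G K L(p C E I K(p C G I K(p E F G L(b C H I(h t r C E G H I)(b E H I(p E H I L(h w
q E G H K L))(h t j C D E H I)))))))))))))))(p C D G K(p D E G K(p C E G K(p C G I K(p E G I K(p C E I K(b C H
I(h t r C E G H I)(b E H I(p E H I K(p E H I L(b F G K(b G K L(h w i A F G K L)(p E G K L(p E F G L(h w q E G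
H K L))))(h v r E F G H K))))(h t j C D E H I))))))))))(h t j C D E G H))))))))))(p B C D E(b B E H(p B D E
H(p D E G H(h t n D E F G H)))(b D E H(p D E G H(h t n D E F G H))(h t j B C D E H)))))))))(p D E F G(h t j D
E F G H))))))(p E F G L(p F G I L(p E F I L(p E G I L(b D E F(b C D E(h t i A C D E F)(b D E H(p D E G H(h t n
D E F G H))(p C D E H(b C H I(p C E H I(h t r E F G H I))(b E H I(h t r E F G H I)(h t j C D E H I))))))(p D E
F G(h t j D E F G H)))))))))))))))))(p G H I K(p G H J K(b F H K(p B F H K(p F G H K(p B F G H(b E F G(h t i A
E F G H)(b E F H(h v i A E F H K)(b H K L(h w i A F H K L)(p G H K L(b D E F(b C D E(h t i A C D E F)(b E F
K(h v i A D E F K)(p E F I K(p E F J K(b D F G(h t i A D F G H)(b D F H(h v i A D F H K)(b C D F(b B C D(h t i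
A B C D F)(b D F K(h v i A C D F K)(p B C D E(p D F I K(b E G L(p B E G L(p E G H L(b D E G(p D E G H(h t l D
E F G H))(h t j B C D E G))))(p E G H L(p E G I L(p E G K L(p E H I L(b D E I(p D E G I(p D E H I(b D G H(b E
G H(h t l D E F G H)(p E G H K(h w j E G H K L)))(p D G H I(h t n D E G H I)))))(h t j B C D E I)))))))))))(p
C D F G(p C D F H(b C H L(p C D H L(p C G H L(p C H K L(p D G H L(p D H K L(p C G K L(p D G K L(b C E H(p C E
F H(b E G H(h t q C D E F H)(p C E G H(h t r C D F G H))))(p C E G H(p C E H K(p C E H L(p C E G K(p C E G L(b
D E H(p D E H K(b D F K(b F K L(h w i A D F K L)(p E F K L(h w q E F H K L)))(h v l D E F H K)))(h t r C D E G
H)))))))))))))))(p C D H L(p C F H L(p C H I L(p C H K L(p C D I L(p C F I L(b D G K(p B D G K(p D G H K(b D E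
G(p D E G H(b E G H(h t l D E F G H)(p E G H K(p E G K L(h w j E G H K L)))))(p B D E G(p C D E G(p D E G H(p
D E G K(b C E H(p C E F H(p C E G H(h t q C D E F H)))(p C E H I(p C E H L(b C G I(p C D G I(p C E G I(p C G H
I(p C G I L(p E G I L(b E H I(b D E H(b E H L(p E H I K(p D E H I(b D F I(p D F I K(b F K L(h w i A D F K L)(p
E F K L(h w q E F H K L))))(h t l D E F H I))))(h w q C E G H L))(h t r C D E G H))(h t q C E G H I)))))))(b E
G I(p E G I L(b B C G(p B C D G(p B C E G(b B D E(h t i A B D E F)(h t n B C D E G))))(b G I J(p E G I J(p G H
I J(b E H J(p B E H J(p E H J K(p E H J L(b C G H(b D E H(p D E H J(p D E G J(p D E I J(b D F J(p D F J K(b F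
K L(h w i A D F K L)(p E F K L(h w q E F H K L))))(h u l D E F H J)))))(h t r C D E G H))(p B C G H(p B C D
H(h t j B C G H I)))))))(p E H I J(h u l E G H I J)))))(h u j B C G I J))))(h t j C D E G I)))))))))))))(p C D
G K(p C F G K(p C G H K(b C E G(p C E F G(h t q C D E F G))(p C E G K(b E G K(p D E G K(h w j C D G K L))(h w
j C E G K L))))))))))))))))))))))))(p D E F G(p D E F H(b D G H(h t r D E F G H)(p D G H K(p D E G K(p D F G
K(p D G K L(h w j D G H K L))))))))))))))))(p F H I K(p F H J K(b E H K(p B E H K(p E F H K(p E G H K(p B E G
H(b D E H(h v i A D E H K)(b H K L(h w i A E H K L)(p D E F H(p D E G H(p F H K L(b C D E(b B C D(h t i A B C
D E)(b C E H(h v i A C E H K)(p C E F H(p C E G H(b F G K(p B F G K(p F G H K(b E F G(h t i A E F G H)(p C E F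
G(p D E F G(b C D G(p C D F G(h t n C D E F G))(p B C D G(b D G I(p D F G I(p F G I L(h w n F G H K L)))(h t j
B C D G I)))))))))(p E F G K(b F G H(h t i A E F G H)(h w j F G H K L))))))))(p C D E F(p C D E G(b C F G(h t
r C D E F G)(b E F G(b F G H(h t i A E F G H)(p F G H K(h w j F G H K L)))(h t j C D E F G)))))))))))))))(p E
H I K(p E H J K(b D H K(p B D H K(p D E H K(p D F H K(p D G H K(p B D E H(p B D F H(p B D G H(b C D H(h v i A
C D H K)(b H K L(h w i A D H K L)(p C D E H(p C D F H(p C D G H(p F H K L(b C H L(p C D H L(p C F H L(p D F H
L(b F G L(p F G K L(h w n F G H K L))(p C F G L(p D F G L(b C E F(p C D E F(b E F G(h t i A D E F G)(b F G H(h
t i A D F G H)(p E F G H(h t j E F G H I)))))(p C E F G(b F G H(h t i A E F G H)(p F G H K(h w j F G H K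
L)))))))))))(p C H K L(b F G H(b E F G(h t i A E F G H)(b C E F(p C D E F(b D F G(h t i A D F G H)(p B D F G(p
C D F G(p D F G K(b F G L(h w n F G H K L)(p E F G L(p E G I L(b C E G(h t q C D E F G)(b B C E(p B C E F(h t
l B C D E F))(p B C E G(h t j B C E G I))))))))))))(p C E F G(b D E F(b E F H(h t i A D E F H)(p C E F H(p C E
H K(p C F H K(p C D E K(b C G H(h t r C E F G H)(p C G H K(h w j C G H K L))))))))(h t j C D E F G)))))(p F G
H K(h w j F G H K L))))))))))))))))))(p D H I K(p D H J K(b C H K(p B C H K(p C D H K(p C E H K(p C F H K(p C
G H K(p B C D H(p B C E H(b H K L(h w i A C H K L)(p F H K L(b F G H(b E F G(h t i A E F G H)(b F G L(p F G K
L(h w n F G H K L))(p E F G L(p F G I L(p E F I L(p E G I L(b C D E(b D E F(h t i A C D E F)(p D E F G(p D E G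
I(h t j D E F G I))))(p B C D E(b D E I(p D E F I(p D E G I(b D F G(h t i A D F G H)(p D F G I(h t n D E F G
I)))))(h t j B C D E I))))))))))(p F G H K(h w j F G H K L))))))))))))(p C H I K(p C H J K(b F G H(b E F G(h t
i A E F G H)(b D E F(b C D E(h t i A C D E F)(b E F H(h t i A D E F H)(p E F H I(p E F H J(p E F H K(b D F G(h
t i A D F G H)(b C E K(p B C E K(p C D E K(p C E F K(p C E H K(p B C D E(p D E H K(b C D F(b B C D(h t i A B C
D F)(b D F H(h t i A C D F H)(p D F H I(p D F H J(p D F H K(b D G K(p D G H K(b E G K(h v n D E F H K)(p D E G
K(h v q D F G H K))))(p D E G K(p D G I K(p D G J K(p E G I K(p E G J K(b D E I(b F G I(b D I J(p D F I J(p D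
G I J(p F G I J(h u l F G H I J))))(p D E I J(b D E J(b G I J(p F G I J(h u l F G H I J))(h u n D E G I J))(h
u j B C D E J))))(h t n D E F G I))(h t j B C D E I)))))))))))))(p C D F G(b C E G(h t q C D E F G)(p C E G
H(p C E G K(h v q E F G H K))))))))))))(p C D E K(p C E F K(p C E I K(p C E J K(p C D I K(p C D J K(p C F I
K(p C F J K(b E G K(p E G H K(h v q E F G H K))(p C E G K(p E G I K(p E G J K(p C G I K(p C G J K(b B C D(b C
D F(h t i A B C D F)(p C D F G(b B D E(h t i A B D E F)(b C E G(p C E F G(h t q C D E F G))(b D E G(b E G H(p
D E G H(b B C E(b D F H(b B D F(h t i A B D F H)(b C E F(p B C E F(h t l B C D E F))(b F G I(b C I J(h u r C E
G I J)(b G I J(p F G I J(h u l F G H I J))(h u j C E G I J)))(h t j C E F G I))))(h t l D E F G H))(p B C E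
G(p B C D G(p B C F G(h t j B C E G I))))))(p C E G H(p C D E H(p C E F H(h t j C E G H I)))))(h t j C D E G
I))))))(p B C D E(b D E I(b E I J(p D E G I(p E F I J(p E G I J(b F G J(b D G I(p D F G I(h u l F G H I J))(p
D F G I(b F G I(h u l F G H I J)(h t n D E F G I))))(h u r E F G I J)))))(h u j B C E I J))(h t j B C D E
I)))))))))))))))))))))))))(p D E F G(b C E F(p C D E F(b E F H(h t i A C E F H)(p D E F H(p E F H I(p D E H
I(p D F H I(b D G H(h t r D E F G H)(p D G H I(b E G H(b F G I(b F I J(p F G I J(b G I J(h u l F G H I J)(p D
G I J(b E G I(h t q E F G H I)(h u j D E G I J)))))(p D F I J(p F G I J(b E G I(h t q E F G H I)(h u j D E G I
J)))))(h t j D E F G I))(h t j D E G H I))))))))))(p C E F G(b E F L(p B E F L(p E F G L(p B E F G(b F H L(p F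
H K L(b E F H(h w i A E F H L)(b G H L(h w i A F G H L)(p D E F H(p E F H K(p E G H L(p D E H I(p D E H J(p D
F H I(p D F H J(b E G K(h v q E F G H K)(p D E G K(p E G I K(p E G J K(p D G I K(p D G J K(b F G I(b D I J(h u
r D E G I J)(b G I J(p F G I J(h u l F G H I J))(h u j D E G I J)))(h t j D E F G I))))))))))))))))))(p E F H
L(p E F G H(b C D E(b B C D(h t i A B C D E)(b D E H(h t i A C D E H)(p D E H I(p D E H J(p D E H K(b C D G(p
C D F G(h t n C D E F G))(p B C D G(b D G I(b D G K(p D E G I(p D F G I(p D G H I(p D F G K(b D F K(p D F H
K(h v q D E F H K))(p D F I K(p D F J K(b E F I(b D I J(p D E I J(p D F I J(p E F I J(p E G I J(h u l E F H I
J)))))(p D G I J(b D G J(p D E G J(b F I J(p E F I J(h u l E F H I J))(h u q D F G I J)))(h u j B C D G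
J))))(h t r D E F G I)))))))))(h v j B C D G K))(h t j B C D G I)))))))))(p C D E F(h t j C D E F G)))))))))(p
D E F L(p E F I L(p D E I L(p D E J L(p D F I L(p D F J L(b E G K(p B E G K(p B E F G(b C D E(b B C D(h t i A
B C D E)(b C D G(p C D F G(h t n C D E F G))(p B C D G(b D G I(h t r D E F G I)(h t j B C D G I)))))(p C D E
F(h t j C D E F G)))))(p D E G K(p E G I K(p E G J K(p D G I K(p D G J K(b F G I(b D I J(h u r D E G I J)(b G
I J(p F G I J(h u l F G H I J))(h u j D E G I J)))(h t j D E F G I))))))))))))))))))))(p F G H I(p F G H J(p F
G H K(b E F G(b D E F(h t i A D E F G)(b D F K(p B D F K(p D E F K(p D F G K(p D F H K(p B D E F(p E F H K(b E
G H(b D E G(h t i A D E G H)(b C D E(b B C D(h t i A B C D E)(b D E H(h t i A C D E H)(p B C D F(p D E H I(p D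
E H J(p D E H K(b C E F(h t i A C E F G)(b C E G(h t i A C E G H)(b C D F(p C D F G(h t l C D E F G))(b D F
I(p D E F I(b F I J(h u r F G H I J)(b D F J(p D E F J(b D G K(p D G H K(h v q D E G H K))(p D G I K(p D G J
K(b E G I(b D I J(p D E I J(p D G I J(p E G I J(h u l E G H I J))))(b G I J(p E G I J(h u l E G H I J))(h u n
D F G I J)))(h t q D E F G I))))))(h u j B C D F J))))(h t j B C D F I)))))))))))(p C D E F(p C D E G(b C F
G(h t r C D E F G)(p C F G H(p C D F H(p C E F H(h t j C F G H I)))))))))(p E G H K(h v n E F G H K)))))))))(p
D E F K(p D F G K(p D F I K(p D F J K(p D E I K(p D E J K(p D G I K(p D G J K(b C D E(b B C D(h t i A B C D
E)(b D E G(h t i A C D E G)(b C E F(h t i A C E F G)(b F I J(h u r F G H I J)(p D F I J(b C D I(p C D F I(p C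
D G I(b E F I(p B E F I(b B D F(p B D E F(b B C E(p B C E I(b C E G(h t i A B C E G)(b C F G(b D F G(h t l C D
E F G)(p D F G H(p D E F H(h t j D F G H I))))(p C F G I(h t n C D F G I)))))(p B C E F(h t q B C D E F))))(p
B C D F(h u j B D F I J))))(h u j D E F I J))))(h u j B C D I J)))))))(p C D E F(p C D E I(p C D E J(p C D F
I(p C D F J(p C D G I(p C D G J(b C I J(h u r C D F I J)(b F I J(h u r F G H I J)(h u j C D F I
J)))))))))))))))))))))(p E F G H(h t j E F G H I)))))))))))))))))))))))))))))))))))))))"

text \<open>The four points that follow the six lowest ones are distinct: \<open>p8\<close>, \<open>p9\<close> in the \<open>Y\<close> order and
\<open>p10\<close>, \<open>p11\<close> in the \<open>X\<close> order.\<close>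
lemma refutes_two_apexes:
  "refutes [[p0, p1, p2, p3, p4, p5, p6, p7, p8, p9, p10, p11]]
    [[p0, p1, p2, p3, p4, p5, p6, p7, p8],
     [p1, p2, p3, p4, p5, p6, p7, p8, p9],
     [p0, p1, p2, p3, p4, p5, p6, p7, p10],
     [p0, p2, p3, p4, p5, p6, p7, p10, p11]]
    []
    (start_table [[p0, p1, p2, p3, p4, p5, p6, p7, p8, p9, p10, p11]]
      (List.product [p2, p3, p4, p5, p6, p7] [p8, p9, p10, p11] @ [(p10, p11), (p10, p8), (p10, p9), (p11, p8), (p11, p9), (p8, p9)])) tree_two_apexes"
  by code_simp

definition tree_X_successor_low :: refutation where
  "tree_X_successor_low = spell (\<lambda>b p s h z t u v w i j k l m n q r A B C D E F G H I J K L.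
p B C K L(p B D K L(p B E K L(p B F K L(p B G K L(p B H K L(b G H K(h w i A G H K L)(b E H K(p E G H K(b E F
H(h w i A E H K L)(p E F G H(p E F H K(h w i A F H K L)))))(b D H K(p D E H K(p D G H K(b D F H(h w i A D H K
L)(p D F G H(p D F H K(h w i A F H K L))))))(b F H K(p F G H K(h w i A F H K L))(b E F G(b D E F(h t i A D E F
G)(b F G H(h t i A E F G H)(p F G H K(b G H L(b E G H(h v i A E G H L)(p E G H K(b D G H(p D E G H(p D F G H(h
v i A D G H L)))(b D F G(b C E F(p C D E F(h t i A C E F G))(b E F K(p E F H K(h w n E F G H K))(p C E F K(b C
D E(b B C D(h t i A B C D E)(b D E G(h t i A C D E G)(p D E G H(b D F H(h t q D E F G H)(b E F H(b F H L(p B F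
H L(p E F H L(p B E F H(b E G L(b C E G(h v i A C E G L)(b B D F(p B C D F(p C D F G(h t l C D E F G)))(p B C
D F(b C D F(p C D F G(h t l C D E F G))(h t j B C D F H)))))(h v l E F G H L)))))(p D F H L(p D E F L(p D F G
L(h w r D F H K L)))))(h w j D E F H K))))))(p C D E F(h w j C D E F K))))))(p D E F G(p D F G H(p D E G H(h w
j D F G H K))))))))(p F G H L(h w r F G H K L))))))(b E G H(p E F G H(b G H I(h t i A F G H I)(b G H L(h v i A
F G H L)(b D F G(p D E F G(h t i A D F G H))(b F G L(p B F G L(b D G H(b C G H(b C F G(p C D F G(p C E F G(h t
i A C F G H)))(b E F K(p E F G K(p E F H K(b F H L(h v i A E F H L)(h w l F G H K L))))(b D F K(p D E F K(p D
F G K(p D F H K(b F H L(h v i A D F H L)(h w l F G H K L)))))(b D E F(b C D E(h t i A C D E F)(b E F H(h t i A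
D E F H)(b D E H(b C D G(p C D E G(p C D F G(b D F H(h t i A C D F H)(h t l D E F G H))))(b C E F(b B D G(p B
C D G(p B D F G(b B D E(h t i A B D E F)(b D F H(h t i A B D F H)(p B D E G(h t l D E F G H))))))(b E F I(p E
F G I(p E F H I(h t i A D E F I)))(b B D E(p B C D E(h t i A B D E F))(b E G K(h w q E F G H K)(b D E G(b D F
H(b C D F(h t i A C D F H)(b F H I(h t i A D F H I)(p E F H I(b C E G(h t q C D E F G)(b B C E(p B C D E(p B C
E F(b B D F(h t i A B D F H)(h t l B C D E F))))(p B C E G(b E G I(h t q E F G H I)(h t j B C E G I))))))))(h
t l D E F G H))(p C D E G(p C E G K(h w j C D E G K))))))))(p C D E F(p C E F H(p C D E H(h t r C E F G
H))))))(p C D E H(p C E F H(h t r C D E G H))))))(p D E F G(p D E F K(b E F H(b F H L(h v i A E F H L)(b D G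
K(h w r D E F G K)(b F G K(h w l F G H K L)(h w j D E F G K))))(p D E F H(h t r D E F G H)))))))))(p C D G H(p
C E G H(p C F G H(p C G H L(p C D G L(p C E G L(p C F G L(h w r C G H K L)))))))))(p D E G H(p D F G H(p D G H
L(p D E G L(p D F G L(h w r D G H K L))))))))(p E F G L(p E G H L(h w r E F G K L))))))))(p E F G H(b F G H(b
G H L(h v i A F G H L)(p E G H L(p E F G L(h w r E G H K L))))(h w j E F G H K)))))))))))))))"

text \<open>The two points that follow in the \<open>X\<close> order are \<open>p11\<close> and \<open>p10\<close>, but \<open>p10\<close> has the smaller \<open>Y\<close>. Their
position relative to \<open>p8\<close> and \<open>p9\<close> is left open, so the two pairs of labels may stand for overlapping
pairs of points.\<close>
lemma refutes_X_successor_low: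
  "refutes [[p0, p1, p2, p3, p4, p5, p6, p7, p8, p9], [p0, p1, p2, p3, p4, p5, p6, p7, p10, p11]]
    [[p0, p1, p2, p3, p4, p5, p6, p7, p8],
     [p1, p2, p3, p4, p5, p6, p7, p8, p9],
     [p0, p1, p2, p3, p4, p5, p6, p7, p11],
     [p0, p2, p3, p4, p5, p6, p7, p10, p11]]
    []
    (start_table [[p0, p1, p2, p3, p4, p5, p6, p7, p8, p9], [p0, p1, p2, p3, p4, p5, p6, p7, p10, p11]]
      (List.product [p2, p3, p4, p5, p6, p7] [p8, p9, p10, p11] @ [(p11, p10)])) tree_X_successor_low"
  by code_simp

definition tree_Y_successor_low :: refutation where
  "tree_Y_successor_low = spell (\<lambda>b p s h z t u v w i j k l m n q r A B C D E F G H I J K L.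
p B C I J(p B D I J(p B E I J(p B F I J(p B G I J(p B H I J(b D E F(b C D E(h t i A C D E F)(b E F G(h t i A D
E F G)(b E F H(p E F G H(h t i A D E F H))(b B D E(p B C D E(h t i A B D E F))(b E F K(p E F G K(p E F H K(h v
i A D E F K)))(b E F I(p E F G I(p E F H I(h t i A D E F I)))(b B C D(p B C D J(p B C D K(b C D F(h t i A B C
D F)(b C D G(p C D E G(p C D F G(h t i A B C D G)))(b C D H(p C D E H(p C D F H(p C D G H(h t i A B C D
H))))(b D F G(p D E F G(b B D F(h t i A B D F G)(b F G H(h t i A D F G H)(p E F G H(b E H K(p E G H K(b F G
K(h v i A D F G K)(p E F G K(h v r E F G H K))))(p E G H K(b G H K(p B G H K(b D G H(h v i A D G H K)(b H K
L(h w i A G H K L)(p C D G H(p E H K L(b F H K(p B F H K(p B D F H(b C E H(p C D E H(p C E F H(p C E G H(b C F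
H(p C F G H(h t q C D F G H))(b D F H(p D F H K(p D E F K(b E H I(p E G H I(b F G I(h t i A D F G I)(p E F G
I(h t r E F G H I))))(b G H I(p G H I J(b D G K(p B D G K(b B E F(p B E F J(b C F G(b B C F(p B C F G(p B C E
G(h t l B C D F G)))(p B C E F(p B C F H(b B E H(h t q B C E F H)(b E H J(p C E H J(b C G J(p C F G J(b F G
J(h u k C D F G J)(p E F G J(h u r E F G H J))))(p C E G J(p C F G J(h u r E F G H J)))))(h u r B E H I
J))))))(h t n C E F G H)))(p B C E F(p B E F G(p B C E G(h t j B E F G H))))))(h v l D F G H K)))(h t j E F G
H I)))))(h t q C D E F H))))))(p C E F H(p C E H K(p C E F K(p C E G K(p C E K L(h w j C E H K L)))))))))(h w
j E F H K L)))))))(h v j E F G H K))))))))(p C D F G(b C E G(p C E F G(h t q C D E F G))(b F G H(b G H I(h t i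
A F G H I)(b G H K(h v i A F G H K)(b E G H(b E G J(p B E G J(p E F G J(p B D E G(p B E F G(b F H J(p B F H
J(b C F H(p C E F H(p C F G H(p C F H J(p C E F J(p C F G J(h u k C D F H J))))))(b D G H(b D G J(b B C E(p B
C E J(p B C E K(p C E F K(b C E H(p B C E H(p C E F H(p C E G H(p B C F H(p B E F H(b D F H(p B D F H(h t l B
C D E F))(h t q C D E F H)))))))(b C G H(b D E H(b C E F(p B C E F(p C E F J(b B D F(p B D F H(p B D F J(b E H
J(p D E H J(h u l D E F H J))(p C E H J(p E G H J(b B C G(b D E G(h t l D E F G H)(h t n B C D E G))(b C G J(h
u q C E G H J)(h u r B C G I J))))))))(h t l B C D E F))))(h t r C E F G H))(h t r C D E G H))(p C G H K(b B C
G(p B C F G(b D E G(p D E G H(b D F H(p B D F H(b F H K(h v i A D F H K)(p E F H K(b G K L(p G H K L(b F H L(h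
w i A D F H L)(b B E F(b C E F(h t l B C D E F)(b F G K(p F G K L(h w l F G H K L))(h v j C E F G K)))(h t n B
C E F G))))(p C G K L(b E G K(h v q E F G H K)(h w j C E G K L)))))))(h t l D E F G H)))(h t n B C D E G)))(p
B C G H(p B C D H(p B C E H(h t j B C G H I)))))))))))(p B C E G(b E G I(b C E H(p C E F H(p C E G H(b D F H(b
F H I(h t i A D F H I)(p E F H I(h t q E F G H I)))(h t q C D E F H))))(p B C E H(p B C D H(b B G H(h t r B C
E G H)(b C G H(b G H J(p C G H J(p E G H J(b E F J(p B E F J(p B C E F(p B D E F(b C E F(p C E F J(h u k C D E
F J))(h t j B C E F G)))))(h u k E F G H J))))(h u r B G H I J))(h t j B C G H I))))))(h t j B C E G I))))(p C
D G J(p D E G J(p D G H J(p C E G J(p C F G J(p C D H J(h u r C D G I J))))))))(p C D G H(p D E G H(p C E G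
H(p C G H I(h t j C D G H I))))))))(p E F H J(h u q E F G H J)))))))(p C E G J(p E G H J(p C F G J(p C E H J(h
u r C E G I J))))))(p C E G H(p C E F H(p C G H I(h t j C E G H I)))))))(p C F G H(p D F G H(p E F G H(p C E G
H(b D E G(b E H I(p B E H I(p E G H I(p E H I J(p B E G H(p G H I J(b B C E(b E G J(p D E G J(p D E H J(b C E
F(p B C E F(b B D F(p B D F J(h u l D E F G J))(h t l B C D E F)))(h t j C E F G H))))(p E F G J(p E G I J(h u
k E G H I J))))(p B C E G(p B C D G(p B C F G(h t j B C E G H))))))))))(p C E H I(b D E H(h t n D E F G H)(h t
j C D E H I))))(h t j C D E G H)))))))))))))))(p B C D E(b D E H(b D E G(b D E I(p D E I J(b C E F(b F G H(b D
F G(h t i A D F G H)(b G H I(h t i A F G H I)(b G H K(h v i A F G H K)(b F G I(p B F G I(p F G I J(b D G H(b D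
G J(p B D G J(p B C D G(b F H J(p B F H J(b D H J(p B D H J(p B C D H(b F H K(b D F H(h v i A D F H K)(b H K
L(h w i A F H K L)(p G H K L(b E G H(h t l D E F G H)(p E G H K(p E G K L(h w j E G H K L)))))))(p E F H K(b C
E G(b C D F(b D F H(h t i A C D F H)(b E G H(h t l D E F G H)(b B E G(p B E F G(p B E G J(p B E F J(b B D F(p
B D F J(b G H J(h u k D F G H J)(p E G H J(h u r E G H I J))))(p B C D F(h t q B D E F G))))))(p B E G H(h t j
B E G H I)))))(p C D F G(h t q C D E F G)))(p B C E G(b E G I(b E G K(p E G H I(h v q E F G H K))(h v j B C E
G K))(h t j B C E G I))))))))(p D E H J(p D F H J(p D G H J(p E F H J(b E G H(h t l D E F G H)(b E G J(h u m D
E G H J)(h u r E G H I J)))))))))(p F H I J(h u l F G H I J)))))(p D F G J(p D G H J(p D G I J(p D F I J(p D H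
I J(h u l D E G I J)))))))(p D F G H(p D G H I(p D F G I(h t n D E G H I)))))))(p D F G I(p D G H I(h t n D E
F G I)))))))(p E F G H(b D F G(b C D F(h t i A C D F G)(p B C D F(b B E F(h t r B C D E F)(p B E F G(p B C E
G(p B D E G(p B E G H(h t j B E F G H))))))))(p D F G H(h t n D E F G H)))))(p B C E F(p B D E F(p B E F G(h t
j B C E F G))))))(p D E G I(p D E H I(h t j B C D E I))))(p B D E G(h t j B C D E G)))(p B D E H(b E G H(p B E
G H(p D E G H(h t j B C D E G)))(h t j B C D E H))))))))))))(b C D E(b B C D(h t i A B C D E)(b D E G(p D E F
G(h t i A C D E G))(b D E H(p D E F H(p D E G H(h t i A C D E H)))(b D E K(p D E F K(p D E G K(p D E H K(h v i
A C D E K))))(b D E I(p D E F I(p D E G I(p D E H I(h t i A C D E I))))(b E F G(b C E F(h t i A C E F G)(b F G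
H(h t i A E F G H)(b G H J(p B G H J(b B E F(p B C E F(p B D E F(h t i A B E F G)))(b F G K(p F G H K(h v i A
E F G K))(b F G I(p F G H I(h t i A E F G I))(b B D G(p B C D G(p B D E G(p B D G H(p B D G I(p B D G J(p B D
E J(b C F G(b D F H(p D F G H(b E G H(b C E G(h t i A C E G H)(b G H I(h t i A E G H I)(p D G H I(p F G H I(b
C D F(h t l C D E F G)(p B C D F(b D F I(h t n D F G H I)(h t j B C D F I))))))))(h t q D E F G H)))(b B D F(p
B C D F(p B D F J(b B C E(p B C E J(b C E G(h t i A B C E G)(b D F G(h t l C D E F G)(b B D H(p B C D H(p B D
H I(p B D H J(b G H I(b F H J(b E G H(h t i A E G H I)(p B F H J(p C E G H(p B E F H(b B C F(p B C F G(p B C F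
H(b E F H(p E F H J(b B E G(p B E G J(h u l E F G H J))(h t l B C E F G)))(h t n C D E F H))))(p B C F H(b C F
H(h t q C E F G H)(h t q B C D F H))))))))(h u r D F H I J))(h t j D F G H I)))))(p B C D H(p B D E H(p B D F
H(b D H J(p D F H J(b F G J(p C F G J(p C D F J(p C F H J(h u k C E F G J))))(h u r D F G H J)))(h u r B D H I
J)))))))))(p B C E F(h t q B C D E F)))))(p B C D F(p B D F G(p B D F H(p B F G J(p B C D H(p B D E H(b F H
I(b F H J(h u k F G H I J)(h u j B D F H J))(h t j B D F H I))))))))))(p C D F G(p C E F G(p C F G H(p D F G
H(p D F G I(p C E F H(b C D H(h t n C D F G H)(p B C D H(p B C E H(p B C F H(b D H I(h t r D F G H I)(h t j B
C D H I)))))))))))))))))))(p B C D G(p B D E G(p B D G H(p B C G H(p B E G H(b D F G(p B D F G(p B C D F(b D F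
J(b C F G(b B F H(p B D F H(p B F G H(b D G H(p D G H J(b B D E(p B D E J(h u k D E G H J))(p B C D E(h t r B
D E F G))))(h t q B D F G H))))(b F H J(p D F H J(b D F H(b E G H(b C E G(h t i A C E G H)(b G H I(h t i A E G
H I)(p F G H I(b C D F(p C D F G(h t l C D E F G))(b D F I(b B F G(b D G H(p D G H J(b B D E(p B D E J(h u k D
E G H J))(p B C D E(h t r B D E F G))))(p D G H I(h t n D F G H I)))(h t j B F G H I))(h t j B C D F I))))))(p
D E G H(h t q D E F G H)))(b C D F(b F H I(p C D F G(p F G H I(b E G H(h t i A E G H I)(b C E G(p B C E G(b E
G I(h t i A C E G I)(b E F H(p E F H I(h t l E F G H I))(b F G J(p D F G J(b B D E(p B D E J(h u k D E F G
J))(h t j B D E F H)))(h u k F G H I J)))))(h t l C D E F G)))))(h t j B D F H I))(h t j B C D F H))))(h u r B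
F H I J)))(p B C F G(p C D F G(h t j B C F G H))))(p D F G J(b F H J(p B F H J(p D F H J(b F H I(h u k F G H I
J)(h t j B D F H I))))(h u r B D F I J))))))(p B D F G(p D F G H(p D F G K(p B F G H(b C D G(b G H I(b D H J(b
G H K(p C D F G(b E G H(h t i A E G H I)(b H K L(h w i A G H K L)(b D H K(h v r D F G H K)(p D H K L(b C D H(p
C D H J(b F H K(b E F H(p E F H K(b E G K(b C E G(h v i A C E G K)(p C E G H(b C F G(p B C F G(b B D F(p B D E
F(p B D F J(p B D E J(b B C E(p B C E J(b C G J(p C F G J(b F G J(h u k C E F G J)(p D F G J(h u r D F G H
J))))(p C D G J(p C F G J(h u r D F G H J)))))(h t q B C D E F)))))(h t j B D F G H)))(p C F G H(h t n C D F G
H)))))(h v l E F G H K)))(p C E F H(p C E G H(h t n C D E F H))))(h w j D F H K L)))(h v j B C D H K)))))))(h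
v j B D G H K))(h u r B D H I J))(h t j B D G H I))(h t j B C D G H)))))))))))))))))(p F G H J(h u r F G H I
J)))))(p D E F G(b E G H(p E F G H(b G H I(h t i A F G H I)(b E G J(p B E G J(p E F G J(p B E F G(b C D F(b C
F G(p C E F G(h t i A C F G H))(b B D E(p B D E J(b B C G(p B C D G(p B C E G(b C E F(h t i A B C E F)(h t n C
D E F G))))(b F G I(b F H J(p B F H J(b D F H(p D F G H(p D F H J(p D F G J(h u k D E F H J))))(b C D G(b D G
H(b E F H(b C E F(h t i A C E F H)(p C E F G(h t n C D E F G)))(h t r D E F G H))(b G H J(p B G H J(p E G H
J(p B C G H(p B E G H(b C E F(b B C E(h t i A B C E F)(b E F H(h t i A C E F H)(b B D G(p B D F G(b B E F(p B
E F J(h u k E F G H J))(p B C E F(h t n B D E F G))))(p B D G H(h t j B D G H I)))))(p C E F G(h t n C D E F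
G)))))))(p D G H J(p D F G J(h u r D G H I J)))))(p B C D G(b D G I(p D G H I(b E F H(b F H I(h t i A E F H
I)(p D F H I(h t q D F G H I)))(h t r D E F G H)))(h t j B C D G I))))))(p F H I J(h u l F G H I J)))(p D F G
I(h t j D E F G I)))))(p B C D E(p B D E F(p B C D F(h t j B D E F G))))))(p B C D F(p B D E F(h t j B C D F
G)))))))(p D E G J(p E G H J(p D F G J(p D E H J(h u r D E G I J))))))))(p D E G H(p D F G H(b F G H(b G H I(h
t i A F G H I)(p D G H I(h t j D E G H I)))(h t j D E F G H))))))))))))(p C D E F(b B C D(p B C D J(p B C D
K(b D F G(p D E F G(b F G H(h t i A E F G H)(b E F I(p B E F I(p E F I J(b G H J(p B G H J(b E H J(p B E H J(b
C D H(p B C D H(p B C E H(s C D E H)))(b E F H(b C D G(p C D E G(h t i A B C D G))(b E F K(b E F L(b F G L(p F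
G H L(b G K L(h w i A E F G L)(p F G K L(p G H K L(h v i A E F G K)))))(b F G K(p F G H K(h v i A E F G K))(b
B C F(p B C E F(p B C F K(p B C E H(p B C E K(p C F G K(b B D E(p B D E H(b D E G(h t i A B D E G)(p C D E G(b
C F G(h t r C D E F G)(p C F G H(b C H K(h v r C F G H K)(b G H K(b E G H(h v i A E G H K)(b H K L(h w i A G H
K L)(p D E G H(p C H K L(b F H K(p E F H K(b D F H(h t q D E F G H)(b F H L(b E G K(b G K L(h w i A E G K L)(p
F G K L(h w q F G H K L)))(h v l E F G H K))(h w j C D F H L))))(h w j C F H K L))))))(h v j C F G H
K))))))))(p B D E F(h t n B C D E F))))))))(p B C D F(b C F G(b D E G(b B D E(h t i A B D E G)(b E G H(h t i A
D E G H)(p B D E H(b E H K(p E G H K(b D G H(h v i A D G H K)(p C D G H(b E G K(h v i A D E G K)(b F H K(h v l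
E F G H K)(b C F H(p C D F H(b C E H(p C E G H(h t q C D E G H))(b D E H(p D E H K(p D E F K(b D G K(p B D G
K(b C E G(b E G J(p C E G J(p C E F J(p C E H J(h u k C D E G J))))(b F H J(h u l E F G H J)(b B C E(p B C E
G(p B C F G(h t l B C D E G)))(p B C E H(b B F H(h t r B C E F H)(h u r B F H I J))))))(h t q C E F G H)))(h v
l D E G H K))))(h t r C D E F H))))(p B C F H(h v j B C F H K))))))))(p E G H K(b G H K(b H K L(h w i A G H K
L)(p E H K L(p E G H L(h w n E F H K L))))(h v n E F G H K)))))))(p C D E G(h t r C D E F G)))(p B C F G(p B C
D G(p B E F G(h t j B C F G H)))))))))(p C E F L(p E F G L(p E F H L(p E F K L(h w j C D E F L))))))(p C E F
K(p E F G K(p E F H K(h v j C D E F K))))))(p C E F H(h t j C D E F H)))))(p E G H J(p E H I J(p E G I J(h u l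
E F H I J))))))(p F G H J(h u r F G H I J)))))(p C E F I(p E F G I(b F H I(p C F H I(p E F H I(h t j C D E F
H)))(h t j C D E F I)))))))(p C D F G(p C E F G(b E F G(b F G H(h t i A E F G H)(p C F G H(h t j C D F G
H)))(h t j C D E F G)))))))(p B C D E(p B C E F(h t j B C D E F)))))))))))))"

text \<open>The case opposite to the previous one: \<open>p8\<close> and \<open>p9\<close> follow in the \<open>Y\<close> order, and \<open>p9\<close> has the smaller
\<open>X\<close>. Again \<open>p10\<close>, \<open>p11\<close> may coincide with \<open>p8\<close> or \<open>p9\<close>.\<close>
lemma refutes_Y_successor_low:
  "refutes [[p0, p1, p2, p3, p4, p5, p6, p7, p8, p9], [p0, p1, p2, p3, p4, p5, p6, p7, p10, p11]]
    [[p0, p1, p2, p3, p4, p5, p6, p7, p8],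
     [p1, p2, p3, p4, p5, p6, p7, p8, p9],
     [p0, p1, p2, p3, p4, p5, p6, p7, p10],
     [p0, p2, p3, p4, p5, p6, p7, p10, p11]]
    []
    (start_table [[p0, p1, p2, p3, p4, p5, p6, p7, p8, p9], [p0, p1, p2, p3, p4, p5, p6, p7, p10, p11]]
      (List.product [p2, p3, p4, p5, p6, p7] [p8, p9, p10, p11] @ [(p10, p11), (p9, p8)])) tree_Y_successor_low"
  by code_simp

section \<open>Nine points are cut off with a hole\<close>

context hole_free_cuts
begin

lemma seven_points_dominated:
  assumes s: "sorted_wrt (\<lambda>p q. Y p < Y q) [a2, a3, a4, a5, a6, a7, a8]"
    and Q: "{a2, a3, a4, a5, a6, a7, a8} \<subseteq> Q"
    and c: "cut T {w, r, a2, a3, a4, a5, a6, a7, a8}"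
  shows "\<forall>p\<in>{a2, a3, a4, a5, a6, a7}. X p < X a8"
proof (rule ccontr)
  define g where "g = tag [w, r, a2, a3, a4, a5, a6, a7, a8]"
  have gs: "g p0 = w" "g p1 = r" "g p2 = a2" "g p3 = a3" "g p4 = a4" "g p5 = a5" "g p6 = a6" "g p7 = a7" "g p8 = a8"
    by (simp_all add: g_def tag_def)
  assume "\<not> ?thesis"
  then obtain p where p: "p \<in> {a2, a3, a4, a5, a6, a7}" "X a8 \<le> X p"
    by force
  then have "p \<noteq> a8" using s by auto
  then have "X a8 \<noteq> X p" using inj_X Q p(1) unfolding inj_on_def by blast
  then have "ccw r p a8" using p Q X_less_iff[of a8 p] by auto
  then show False
    by (intro no_refutation[OF _ _ _ _ _ _ refutes_dominated, of g])
      (use p(1) s Q c in \<open>auto simp: gs\<close>)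
qed

lemma dominated_cut:
  assumes A: "A \<subseteq> Q" "card A = 7" "cut T ({w, r} \<union> A)"
  shows "\<exists>z\<in>A. \<forall>p\<in>A - {z}. Y p < Y z \<and> X p < X z"
proof -
  have "finite A" using A(1) finite_Q by (rule finite_subset)
  then obtain zs where zs: "set zs = A" "distinct zs" "sorted_wrt (\<lambda>p q. Y p < Y q) zs"
    using sorted_list_by_key[of A Y] inj_on_subset[OF inj_Y A(1)] by blast
  then have "length zs = 7"
    using A(2) distinct_card by fastforce
  then obtain a2 a3 a4 a5 a6 a7 a8 where "zs = [a2, a3, a4, a5, a6, a7, a8]"
    by (auto simp: numeral_eq_Suc length_Suc_conv)
  then have s: "sorted_wrt (\<lambda>p q. Y p < Y q) [a2, a3, a4, a5, a6, a7, a8]"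
    and A': "A = {a2, a3, a4, a5, a6, a7, a8}"
    using zs by simp_all
  have "cut T {w, r, a2, a3, a4, a5, a6, a7, a8}"
    using A(3) unfolding A' by (simp only: Un_insert_left Un_empty_left)
  then have "\<forall>p\<in>{a2, a3, a4, a5, a6, a7}. X p < X a8"
    using s A(1) unfolding A' by (intro seven_points_dominated)
  then show ?thesis
    using s unfolding A' by (intro bexI[of _ a8]) auto
qed

text \<open>The time at which \<open>l\<close> in \<open>L\<close> and \<open>u\<close> outside \<open>L\<close> change their order is \<open>\<tau> (l, u)\<close>. Up to the
first such time \<open>t1\<close>, all points of \<open>L\<close> precede all others. Shortly before \<open>t1\<close>, the points of \<open>L\<close> and the
lowest other point \<open>v\<close> form a cut together with \<open>w\<close> and \<open>r\<close>, so \<open>v\<close> dominates \<open>L\<close> in both coordinates, and this stays true at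
\<open>t1\<close>. But then no point outside \<open>L\<close> can have caught up with a point of \<open>L\<close> at \<open>t1\<close>.\<close>
lemma X_less_if_lowest_six:
  assumes L: "L \<subseteq> Q" "card L = 6" and LY: "\<And>l u. l \<in> L \<Longrightarrow> u \<in> Q - L \<Longrightarrow> Y l < Y u"
    and lu: "l \<in> L" "u \<in> Q - L"
  shows "X l < X u"
proof (rule ccontr)
  assume "\<not> X l < X u"
  moreover have "X l \<noteq> X u"
    using inj_X L(1) lu by (auto simp: inj_on_eq_iff subset_iff)
  ultimately have less: "X u < X l" by simp
  define V where "V = {(l, u) \<in> L \<times> (Q - L). X u < X l}"
  define \<tau> where "\<tau> = (\<lambda>(l, u). (Y u - Y l) / ((Y u - Y l) + (X l - X u)))"
  have "finite V"
    using finite_subset[OF L(1) finite_Q] finite_Q by (intro finite_subset[of V "L \<times> Q"]) (auto simp: V_def)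
  moreover have "V \<noteq> {}"
    using lu less by (auto simp: V_def)
  ultimately have "Min (\<tau> ` V) \<in> \<tau> ` V" "\<forall>v\<in>V. Min (\<tau> ` V) \<le> \<tau> v"
    by simp_all
  then obtain l1 u1 where v: "(l1, u1) \<in> V" "\<forall>v\<in>V. \<tau> (l1, u1) \<le> \<tau> v"
    by (metis (no_types, lifting) imageE surj_pair)
  define t1 where "t1 = \<tau> (l1, u1)"
  have lu1: "l1 \<in> L" "u1 \<in> Q - L" "X u1 < X l1" "Y l1 < Y u1"
    using v(1) LY by (auto simp: V_def)
  have t1: "0 < t1" "t1 < 1"
    using lu1 by (auto simp: t1_def \<tau>_def divide_simps)
  have t1_eq: "mix t1 l1 = mix t1 u1"
  proof -
    have "t1 * ((Y u1 - Y l1) + (X l1 - X u1)) = Y u1 - Y l1"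
      using lu1 by (simp add: t1_def \<tau>_def)
    then show ?thesis by (simp add: mix_def algebra_simps)
  qed
  have below: "mix t p < mix t q" if t: "0 \<le> t" "t < t1" and pq: "p \<in> L" "q \<in> Q - L" for t p q
  proof (cases "X q < X p")
    case True
    then have "t1 \<le> \<tau> (p, q)"
      using v(2) pq by (auto simp: t1_def V_def)
    with t have "t < (Y q - Y p) / ((Y q - Y p) + (X p - X q))"
      by (simp add: \<tau>_def)
    moreover have "0 < (Y q - Y p) + (X p - X q)"
      using True LY[OF pq] by simp
    ultimately have "t * ((Y q - Y p) + (X p - X q)) < Y q - Y p"
      by (simp add: pos_less_divide_eq)
    then show ?thesis by (simp add: mix_def algebra_simps)
  next
    case False
    then have "0 \<le> t * (X q - X p)" using t by simp
    moreover have "0 < (1 - t) * (Y q - Y p)"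
      using t t1 LY[OF pq] by (intro mult_pos_pos) simp_all
    ultimately show ?thesis by (simp add: mix_def algebra_simps)
  qed
  obtain \<epsilon> where e: "\<epsilon> > 0"
    "\<forall>t. \<bar>t - t1\<bar> < \<epsilon> \<longrightarrow> (\<forall>p\<in>Q. \<forall>q\<in>Q. mix t1 p < mix t1 q \<longrightarrow> mix t p < mix t q)"
    using mix_stable[of t1] by blast
  \<comment> \<open>A time without ties is needed, so that the lowest point outside \<open>L\<close> is unique.\<close>
  have "max 0 (t1 - \<epsilon>) < t1" using e(1) t1(1) by simp
  then obtain t where t: "max 0 (t1 - \<epsilon>) < t" "t < t1" "inj_on (mix t) Q"
    using mix_injective_dense by blast
  then have t': "0 < t" "t < 1" "\<bar>t - t1\<bar> < \<epsilon>" using t1 by auto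
  have fin: "finite (Q - L)" "Q - L \<noteq> {}"
    using finite_Q lu(2) by auto
  then have "Min (mix t ` (Q - L)) \<in> mix t ` (Q - L)"
    by (intro Min_in) simp_all
  then obtain v where v: "v \<in> Q - L" "mix t v = Min (mix t ` (Q - L))"
    by (auto simp: image_iff)
  have v_min: "mix t v < mix t q" if "q \<in> Q - L" "q \<noteq> v" for q
  proof -
    have "mix t v \<le> mix t q"
      unfolding v(2) using fin that by simp
    moreover have "mix t v \<noteq> mix t q"
      using t(3) v(1) that by (auto simp: inj_on_eq_iff)
    ultimately show ?thesis by simp
  qed
  have "cut T ((if 0 < t then {w} else {}) \<union> (if t < 1 then {r} else {}) \<union> insert v L)"
  proof (rule cut_level)
    show "t \<noteq> 0" "t \<noteq> 1" "insert v L \<subseteq> Q" using t' L(1) v(1) by auto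
    show "mix t p < mix t q" if "p \<in> insert v L" "q \<in> Q - insert v L" for p q
      using that below[of t p q] v_min[of q] t' t(2) by auto
  qed
  then have "cut T ({w, r} \<union> insert v L)"
    using t' by (simp add: insert_commute)
  moreover have "card (insert v L) = 7"
    using L finite_subset[OF L(1) finite_Q] v(1) by simp
  moreover have "insert v L \<subseteq> Q" using L(1) v(1) by auto
  ultimately obtain z where z: "z \<in> insert v L" "\<forall>p\<in>insert v L - {z}. Y p < Y z \<and> X p < X z"
    using dominated_cut by blast
  have "z = v"
  proof (rule ccontr)
    assume "z \<noteq> v"
    then have "Y v < Y z" "z \<in> L" using z by auto
    then show False using LY[of z v] v(1) by simp
  qed
  then have dom: "Y l1 < Y v" "X l1 < X v"
    using z(2) lu1(1) v(1) by auto
  then have "mix t1 l1 < mix t1 v"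
    unfolding mix_def using t1 by (intro add_strict_mono mult_strict_left_mono) simp_all
  then have "mix t1 u1 < mix t1 v" using t1_eq by simp
  then have "mix t u1 < mix t v"
    using e(2) t'(3) lu1(2) v(1) by auto
  then show False
    using v_min[of u1] lu1(2) by force
qed

text \<open>The four extra points are \<open>x\<close>, \<open>y\<close> in the \<open>Y\<close> order and \<open>x'\<close>, \<open>y'\<close> in the \<open>X\<close> order. If one of the pairs
is ordered oppositely in the other coordinate, the relative position of the two pairs is irrelevant.
Otherwise both coordinates increase from \<open>x\<close> to \<open>y\<close> and from \<open>x'\<close> to \<open>y'\<close>, which leaves three possible
arrangements.\<close>
lemma card_Q_less:
  shows "card Q < 8"
proof (rule ccontr)
  assume "\<not> card Q < 8"
  then have card_Q: "8 \<le> card Q" by simp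
  obtain zs where zs: "set zs = Q" "distinct zs" "sorted_wrt (\<lambda>p q. Y p < Y q) zs"
    using sorted_list_by_key[OF finite_Q inj_Y] by blast
  then have "8 \<le> length zs"
    using card_Q distinct_card by metis
  then obtain a2 a3 a4 a5 a6 a7 x y rest where z: "zs = [a2, a3, a4, a5, a6, a7, x, y] @ rest"
    by (auto simp: numeral_eq_Suc Suc_le_length_iff)
  define L where "L = {a2, a3, a4, a5, a6, a7}"
  have sY: "sorted_wrt (\<lambda>p q. Y p < Y q) [a2, a3, a4, a5, a6, a7, x, y]"
    using zs(3) unfolding z sorted_wrt_append by blast
  have Q: "Q = L \<union> {x, y} \<union> set rest" and rest: "\<And>p q. p \<in> L \<union> {x, y} \<Longrightarrow> q \<in> set rest \<Longrightarrow> Y p < Y q"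
    using zs(1,3) unfolding z L_def by (auto simp: sorted_wrt_append)
  have dis: "distinct [a2, a3, a4, a5, a6, a7, x, y]" "(L \<union> {x, y}) \<inter> set rest = {}"
    using zs(2) unfolding z L_def by auto
  have LQ: "L \<subseteq> Q" and L6: "card L = 6" and xy: "x \<in> Q - L" "y \<in> Q - L" "x \<noteq> y"
    using Q dis by (auto simp: L_def)
  have Q_L: "Q - L = {x, y} \<union> set rest"
    using Q dis by (auto simp: L_def)
  have LY: "Y l < Y u" if "l \<in> L" "u \<in> Q - L" for l u
    using that sY rest unfolding Q_L by (auto simp: L_def)
  have x_first: "Y x < Y u" if "u \<in> Q - L" "u \<noteq> x" for u
    using that sY rest unfolding Q_L by auto
  have y_second: "Y y < Y u" if "u \<in> Q - L" "u \<noteq> x" "u \<noteq> y" for u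
    using that sY rest unfolding Q_L by auto
  have LX: "X l < X u" if "l \<in> L" "u \<in> Q - L" for l u
    using LQ L6 LY that by (rule X_less_if_lowest_six)
  obtain zs' where zs': "set zs' = Q - L" "distinct zs'" "sorted_wrt (\<lambda>p q. X p < X q) zs'"
    using sorted_list_by_key[of "Q - L" X] finite_Q inj_on_subset[OF inj_X] by blast
  have "2 \<le> card (Q - L)"
    using card_Q L6 LQ finite_Q by (simp add: card_Diff_subset finite_subset)
  then have "2 \<le> length zs'"
    using zs'(1,2) distinct_card by metis
  then obtain x' y' rest' where z': "zs' = x' # y' # rest'"
    by (auto simp: numeral_eq_Suc Suc_le_length_iff)
  have xy': "x' \<in> Q - L" "y' \<in> Q - L" "x' \<noteq> y'"
    using zs'(1,2) unfolding z' by auto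
  have x'_first: "X x' < X u" if "u \<in> Q - L" "u \<noteq> x'" for u
    using that zs'(1,3) unfolding z' by auto
  have y'_second: "X y' < X u" if "u \<in> Q - L" "u \<noteq> x'" "u \<noteq> y'" for u
    using that zs'(1,3) unfolding z' by auto
  have c1: "cut T ({w, r} \<union> (L \<union> {x}))"
    by (rule cut_first_Y) (use LQ xy LY x_first in auto)
  have c2: "cut T ({r} \<union> (L \<union> {x, y}))"
    by (rule cut_first_Y) (use LQ xy LY x_first y_second in auto)
  have c3: "cut T ({w, r} \<union> (L \<union> {x'}))"
    by (rule cut_first_X) (use LQ xy' LX x'_first in auto)
  have c4: "cut T ({w} \<union> (L \<union> {x', y'}))"
    by (rule cut_first_X) (use LQ xy' LX x'_first y'_second in auto)
  have cuts: "cut T {w, r, a2, a3, a4, a5, a6, a7, x}" "cut T {r, a2, a3, a4, a5, a6, a7, x, y}"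
    "cut T {w, r, a2, a3, a4, a5, a6, a7, x'}" "cut T {w, a2, a3, a4, a5, a6, a7, x', y'}"
    using c1 c2 c3 c4 by (simp_all only: L_def Un_insert_left Un_empty_left)
  then have cuts': "cut T {w, a2, a3, a4, a5, a6, a7, y', x'}"
    by (simp add: insert_commute[of x' y'])
  have inQ: "a2 \<in> Q" "a3 \<in> Q" "a4 \<in> Q" "a5 \<in> Q" "a6 \<in> Q" "a7 \<in> Q" "x \<in> Q" "y \<in> Q" "x' \<in> Q" "y' \<in> Q"
    using LQ xy xy' by (auto simp: L_def)
  have YL: "\<forall>l\<in>{a2, a3, a4, a5, a6, a7}. \<forall>u\<in>{x, y, x', y'}. Y l < Y u"
    and XL: "\<forall>l\<in>{a2, a3, a4, a5, a6, a7}. \<forall>u\<in>{x, y, x', y'}. X l < X u"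
    using LY LX xy xy' by (auto simp: L_def)
  have YX: "Y p < Y q \<or> Y q < Y p" "X p < X q \<or> X q < X p" if "p \<in> Q" "q \<in> Q" "p \<noteq> q" for p q
  proof -
    have "Y p \<noteq> Y q" "X p \<noteq> X q"
      using inj_onD[OF inj_Y _ that(1,2)] inj_onD[OF inj_X _ that(1,2)] that(3) by blast+
    then show "Y p < Y q \<or> Y q < Y p" "X p < X q \<or> X q < X p"
      by linarith+
  qed
  note facts = inQ YL[simplified] XL[simplified] sY[simplified] cuts cuts'
  have "Y x' < Y y' \<or> Y y' < Y x'" "X x < X y \<or> X y < X x"
    by (rule YX; use inQ xy(3) xy'(3) in simp)+
  then consider (A) "Y y' < Y x'" | (B) "X y < X x" "Y x' < Y y'"
    | (C) "X x < X y" "Y x' < Y y'"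
    by blast
  then show False
  proof cases
    case A
    define g where "g = tag [w, r, a2, a3, a4, a5, a6, a7, x, y, y', x']"
    have gs: "g p0 = w" "g p1 = r" "g p2 = a2" "g p3 = a3" "g p4 = a4" "g p5 = a5" "g p6 = a6" "g p7 = a7"
      "g p8 = x" "g p9 = y" "g p10 = y'" "g p11 = x'"
      by (simp_all add: g_def tag_def)
    have o: "X x' < X y'" using x'_first xy' by simp
    show False
      by (rule no_refutation[OF _ _ _ _ _ _ refutes_X_successor_low, of g])
        (simp_all add: gs A o facts)
  next
    case B
    define g where "g = tag [w, r, a2, a3, a4, a5, a6, a7, x, y, x', y']"
    have gs: "g p0 = w" "g p1 = r" "g p2 = a2" "g p3 = a3" "g p4 = a4" "g p5 = a5" "g p6 = a6" "g p7 = a7"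
      "g p8 = x" "g p9 = y" "g p10 = x'" "g p11 = y'"
      by (simp_all add: g_def tag_def)
    have o: "X x' < X y'" using x'_first xy' by simp
    show False
      by (rule no_refutation[OF _ _ _ _ _ _ refutes_Y_successor_low, of g])
        (simp_all add: gs B o facts)
  next
    case C
    show False
    proof (cases "x' = x")
      case True
      show False
      proof (cases "y' = y")
        case True
        define g where "g = tag [w, r, a2, a3, a4, a5, a6, a7, x, y]"
        have gs: "g p0 = w" "g p1 = r" "g p2 = a2" "g p3 = a3" "g p4 = a4" "g p5 = a5" "g p6 = a6" "g p7 = a7"
          "g p8 = x" "g p9 = y"
          by (simp_all add: g_def tag_def)
        show False
          by (rule no_refutation[OF _ _ _ _ _ _ refutes_common_successors, of g])
            (simp_all add: gs C facts[unfolded True \<open>x' = x\<close>])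
      next
        case False
        define g where "g = tag [w, r, a2, a3, a4, a5, a6, a7, x, y, y']"
        have gs: "g p0 = w" "g p1 = r" "g p2 = a2" "g p3 = a3" "g p4 = a4" "g p5 = a5" "g p6 = a6" "g p7 = a7"
          "g p8 = x" "g p9 = y" "g p10 = y'"
          by (simp_all add: g_def tag_def)
        have o: "X x < X y'" "X y' < X y" "Y y < Y y'"
          using x'_first[of y'] y'_second[of y] y_second[of y'] xy xy' True False by auto
        show False
          by (rule no_refutation[OF _ _ _ _ _ _ refutes_common_apex, of g])
            (simp_all add: gs C[unfolded True] o facts[unfolded True])
      qed
    next
      case False
      have o1: "X x' < X x" "Y x < Y x'" "X x' < X y'"
        using x'_first[of x] x_first[of x'] x'_first[of y'] xy xy' False by auto
      have n: "y \<noteq> x'" using o1 C by auto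
      then have o2: "Y y < Y x'" using y_second[of x'] xy' False by auto
      have n': "y' \<noteq> x" using o1 C by auto
      then have o3: "X y' < X x" using y'_second[of x] xy False by auto
      have o4: "Y x < Y y'" "Y y < Y y'" "X x' < X y" "X y' < X y"
        using C o1 o2 o3 by linarith+
      define g where "g = tag [w, r, a2, a3, a4, a5, a6, a7, x, y, x', y']"
      have gs: "g p0 = w" "g p1 = r" "g p2 = a2" "g p3 = a3" "g p4 = a4" "g p5 = a5" "g p6 = a6" "g p7 = a7"
        "g p8 = x" "g p9 = y" "g p10 = x'" "g p11 = y'"
        by (simp_all add: g_def tag_def)
      show False
        by (rule no_refutation[OF _ _ _ _ _ _ refutes_two_apexes, of g])
          (simp_all add: gs C o1 o2 o3 o4 facts)
    qed
  qed
qed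

end

text \<open>From the lexicographically least point \<open>w\<close> all other points are seen within a half-plane, so the
relation \<open>ccw w\<close> is a linear order on them. Its least element is the other end of a hull edge.\<close>
lemma exists_hull_edge:
  assumes fin: "finite T" and gp: "general_position T" and card: "3 \<le> card T"
  shows "\<exists>w r. hull_edge T w r"
proof -
  have "T \<noteq> {}" using card by auto
  define a where "a = Min ((\<lambda>p. p $ 1) ` T)"
  define B where "B = {p \<in> T. p $ 1 = a}"
  have "a \<in> (\<lambda>p. p $ 1) ` T" and a: "\<And>p. p \<in> T \<Longrightarrow> a \<le> p $ 1"
    using fin \<open>T \<noteq> {}\<close> by (simp_all add: a_def)
  then have "B \<noteq> {}" "finite B" using fin by (auto simp: B_def)
  then have "Min ((\<lambda>p. p $ 2) ` B) \<in> (\<lambda>p. p $ 2) ` B" by simp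
  then obtain w where w: "w \<in> B" "w $ 2 = Min ((\<lambda>p. p $ 2) ` B)"
    by (auto simp: image_iff)
  have w2: "w $ 2 \<le> p $ 2" if "p \<in> B" for p
    unfolding w(2) using that \<open>finite B\<close> by simp
  have wT: "w \<in> T" and w1: "w $ 1 = a" using w(1) by (auto simp: B_def)
  have right: "w $ 1 < p $ 1 \<or> w $ 1 = p $ 1 \<and> w $ 2 < p $ 2" if "p \<in> T - {w}" for p
  proof (cases "p $ 1 = a")
    case True
    then have "w $ 2 \<le> p $ 2" using w2 that by (simp add: B_def)
    moreover have "w $ 2 \<noteq> p $ 2"
      using that True w1 by (auto simp: vec_eq_iff forall_2)
    ultimately show ?thesis using True w1 by simp
  next
    case False
    then show ?thesis using a[of p] that w1 by force
  qed
  have trans: "ccw w p s" if "p \<in> T - {w}" "q \<in> T - {w}" "s \<in> T - {w}" "ccw w p q" "ccw w q s" for p q s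
  proof -
    define x1 x2 y1 y2 z1 z2 where d: "x1 = p $ 1 - w $ 1" "x2 = p $ 2 - w $ 2" "y1 = q $ 1 - w $ 1"
      "y2 = q $ 2 - w $ 2" "z1 = s $ 1 - w $ 1" "z2 = s $ 2 - w $ 2"
    have pos: "0 < x1 \<or> x1 = 0 \<and> 0 < x2" "0 < y1 \<or> y1 = 0 \<and> 0 < y2" "0 < z1 \<or> z1 = 0 \<and> 0 < z2"
      using right[OF that(1)] right[OF that(2)] right[OF that(3)] by (auto simp: d)
    have 1: "0 < x1 * y2 - x2 * y1" "0 < y1 * z2 - y2 * z1"
      using that(4,5) by (simp_all add: orient_def d)
    have x1: "0 < x1"
    proof (rule ccontr)
      assume "\<not> 0 < x1"
      then have "x1 = 0" "0 < x2" using pos(1) by auto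
      then have "x2 * y1 < 0" using 1(1) by simp
      then show False using \<open>0 < x2\<close> pos(2) by (auto simp: mult_less_0_iff)
    qed
    have y1: "0 < y1"
    proof (rule ccontr)
      assume "\<not> 0 < y1"
      then have "y1 = 0" "0 < y2" using pos(2) by auto
      then have "y2 * z1 < 0" using 1(2) by simp
      then show False using \<open>0 < y2\<close> pos(3) by (auto simp: mult_less_0_iff)
    qed
    have "0 \<le> z1" using pos(3) by auto
    have "0 < x1 * (y1 * z2 - y2 * z1) + z1 * (x1 * y2 - x2 * y1)"
      using x1 1 \<open>0 \<le> z1\<close> by (intro add_pos_nonneg mult_pos_pos mult_nonneg_nonneg) simp_all
    also have "\<dots> = y1 * (x1 * z2 - x2 * z1)" by (simp add: algebra_simps)
    finally have "0 < x1 * z2 - x2 * z1" using y1 by (simp add: zero_less_mult_iff)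
    then show ?thesis by (simp add: orient_def d)
  qed
  have "finite (T - {w})" "T - {w} \<noteq> {}"
    using fin card card_le_Suc0_iff_eq[OF fin] by (auto simp: subset_singleton_iff)
  moreover have "asymp_on (T - {w}) (ccw w)"
  proof (rule asymp_onI)
    show "\<not> ccw w q p" if "ccw w p q" for p q
      using that orient_swap'[of w p q] by simp
  qed
  moreover have "transp_on (T - {w}) (ccw w)"
    using trans by (intro transp_onI) blast
  ultimately obtain r where r: "r \<in> T - {w}" "\<forall>p\<in>T - {w}. p \<noteq> r \<longrightarrow> \<not> ccw w p r"
    using Finite_Set.bex_min_element[of "T - {w}" "ccw w"] by blast
  have "ccw w r p" if "p \<in> T - {w, r}" for p
    using not_ccw[OF gp wT, of p r] r that by auto
  then have "hull_edge T w r"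
    using fin gp wT r(1) by unfold_locales auto
  then show ?thesis by blast
qed

text \<open>Ten points are needed for the two extra points in each of the orders: besides \<open>w\<close>, \<open>r\<close> and six points,
two must remain.\<close>
theorem exists_cut_with_five_hole:
  assumes fin: "finite T" and gp: "general_position T" and card: "10 \<le> card T"
  shows "\<exists>Z H. cut T Z \<and> card Z = 9 \<and> five_hole Z H"
proof (rule ccontr)
  assume none: "\<not> ?thesis"
  obtain w r where "hull_edge T w r"
    using exists_hull_edge[OF fin gp] card by auto
  then interpret hull_edge T w r .
  interpret hole_free_cuts T w r
    using none by unfold_locales blast
  have "{w, r} \<subseteq> T" "card {w, r} = 2"
    using w_in r_in w_neq_r by simp_all
  then have "card Q = card T - 2"
    unfolding Q_def by (simp only: card_Diff_subset finite.intros)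
  then have "8 \<le> card Q" using card by linarith
  then show False using card_Q_less by simp
qed

section \<open>Disjoint holes\<close>

lemma cut_complement: "cut T Z \<Longrightarrow> cut T (T - Z)"
  by (auto simp: cut_def double_diff Int_commute)

lemma max_disjoint_attained:
  assumes "finite S"
  obtains \<H> where "disjoint_five_holes S \<H>" "card \<H> = max_disjoint_five_holes S"
proof -
  have "disjoint_five_holes S {}" by (simp add: disjoint_five_holes_def)
  then have "{card \<H> |\<H>. disjoint_five_holes S \<H>} \<noteq> {}" by blast
  then have "max_disjoint_five_holes S \<in> {card \<H> |\<H>. disjoint_five_holes S \<H>}"
    unfolding max_disjoint_five_holes_def using finite_card_disjoint_five_holes[OF assms] by (intro Max_in)
  then show ?thesis using that by auto
qed

lemma card_le_max_disjoint:
  assumes "finite S" "disjoint_five_holes S \<H>"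
  shows "card \<H> \<le> max_disjoint_five_holes S"
  unfolding max_disjoint_five_holes_def
  using assms finite_card_disjoint_five_holes[OF assms(1)] by (intro Max_ge) auto

text \<open>Holes of either side of a cut are holes of the whole set, and holes of different sides are disjoint.\<close>
lemma max_disjoint_cut:
  assumes fin: "finite T" and cut: "cut T Z" and H: "five_hole Z H"
  shows "max_disjoint_five_holes (T - Z) + 1 \<le> max_disjoint_five_holes T"
proof -
  have "finite (T - Z)" using fin by simp
  then obtain \<H> where \<H>: "disjoint_five_holes (T - Z) \<H>" "card \<H> = max_disjoint_five_holes (T - Z)"
    by (rule max_disjoint_attained)
  have sub: "K \<subseteq> T - Z" "five_hole T K" if "K \<in> \<H>" for K
    using \<H>(1) that five_hole_cut[OF cut_complement[OF cut]]
    by (auto simp: disjoint_five_holes_def five_hole_def)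
  have "H \<subseteq> Z" "H \<noteq> {}" using H by (auto simp: five_hole_def)
  have disj: "disjnt (convex hull H) (convex hull K)" if "K \<in> \<H>" for K
  proof -
    have "convex hull H \<subseteq> convex hull Z" "convex hull K \<subseteq> convex hull (T - Z)"
      using \<open>H \<subseteq> Z\<close> sub(1)[OF that] by (simp_all add: hull_mono)
    then show ?thesis
      using cut unfolding cut_def disjnt_def by blast
  qed
  have "H \<notin> \<H>"
    using sub(1)[of H] \<open>H \<subseteq> Z\<close> \<open>H \<noteq> {}\<close> by blast
  moreover have "finite \<H>"
    using sub(1) fin by (intro finite_subset[of \<H> "Pow T"]) auto
  ultimately have "card (insert H \<H>) = max_disjoint_five_holes (T - Z) + 1"
    using \<H>(2) by simp
  moreover have "disjoint_five_holes T (insert H \<H>)"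
    using \<H>(1) sub(2) five_hole_cut[OF cut H] disj
    by (auto simp: disjoint_five_holes_def pairwise_insert disjnt_sym)
  ultimately show ?thesis
    using card_le_max_disjoint[OF fin] by metis
qed

lemma max_disjoint_lower_bound:
  assumes "finite T" "general_position T"
  shows "(card T - 1) div 9 \<le> max_disjoint_five_holes T"
  using assms
proof (induction "card T" arbitrary: T rule: less_induct)
  case less
  show ?case
  proof (cases "10 \<le> card T")
    case True
    then obtain Z H where Z: "cut T Z" "card Z = 9" "five_hole Z H"
      using exists_cut_with_five_hole less.prems by blast
    then have "Z \<subseteq> T" by (simp add: cut_def)
    then have card: "card (T - Z) = card T - 9"
      using Z(2) less.prems(1) by (simp add: card_Diff_subset finite_subset)
    have "(card (T - Z) - 1) div 9 \<le> max_disjoint_five_holes (T - Z)"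
      using less.prems True card general_position_subset[of T "T - Z"] by (intro less.hyps) auto
    moreover have "(card T - 1) div 9 = (card (T - Z) - 1) div 9 + 1"
      using True unfolding card by (simp add: div_nat_eqI le_div_geq[of 9 "card T - 1"])
    ultimately show ?thesis
      using max_disjoint_cut[OF less.prems(1) Z(1,3)] by simp
  next
    case False
    then have "(card T - 1) div 9 = 0" by simp
    then show ?thesis by simp
  qed
qed

theorem F5_lower_bound: "(n - 1) div 9 \<le> F5 n"
proof -
  have "F5 n \<in> {max_disjoint_five_holes S |S. finite S \<and> card S = n \<and> general_position S}"
    unfolding F5_def using ex_general_position[of n] by (intro Inf_nat_def1) auto
  then show ?thesis
    using max_disjoint_lower_bound by auto
qed

theorem theorem5:
  fixes k n :: nat
  assumes "k \<ge> 1" and "n = 28 * 2 ^ (k - 1) - 9"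
  shows "real (F5 n) \<ge> (3 * real n - 1) / 28"
proof -
  define m :: nat where "m = 2 ^ (k - 1)"
  have m: "1 \<le> m" "n = 28 * m - 9" by (simp_all add: m_def assms(2))
  then have "3 * m - 1 \<le> (n - 1) div 9"
    by (simp add: less_eq_div_iff_mult_less_eq)
  also have "\<dots> \<le> F5 n" by (rule F5_lower_bound)
  finally have "real (3 * m - 1) \<le> real (F5 n)" by simp
  then show ?thesis using m by (simp add: of_nat_diff)
qed

end
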